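(* Let $\mathcal{M}$ be a Riemannian manifold with boundary $\partial\mathcal{M}$ and outward unit normal $n$. Let $$Q=\Big\{c\in C^\infty(\mathcal{M}): c\ge 0,\ \int_{\mathcal{M}}c\,dV=1\Big\},\qquad E_c=\{w\in\Gamma(T\mathcal{M}): w\cdot n=0\text{ on }\partial\mathcal{M}\}\quad (c\in Q),$$ $$\mathcal{P}_c w=-\nabla\cdot(c\,w),\qquad \mathcal{D}_c(w)=\frac12\int_{\mathcal{M}}c\,|w|^2\,dV .$$ For any free energy $\mathcal{F}:Q\to\mathbb{R}$, Onsager's variational principle for the data $(Q,E,\mathcal{F},\mathcal{D},\mathcal{P})$ yields the gradient flow, expressed in terms of the chemical potential $\mu(c)=\mathrm{grad}_{L^2}\mathcal{F}|_c$, $$\dot c=\nabla\cdot\big(c\,\nabla\mu(c)\big);$$ that is, every solution $t\mapsto c(t)\in Q$ of Onsager's variational principle satisfies this equation.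
   Context: $\Gamma(T\mathcal{M})$ denotes smooth vector fields on $\mathcal{M}$. The tangent space is $T_cQ=\{\mathring c\in C^\infty(\mathcal{M}):\int_{\mathcal{M}}\mathring c\,dV=0\}$. Onsager's variational principle (OVP): a differentiable curve $t\mapsto c(t)\in Q$ is a solution if for every $t$ one has $\dot c(t)=\mathcal{P}_{c(t)}v(t)$, where $v(t)\in E_{c(t)}$ is a minimizer over $w\in E_{c(t)}$ of the Rayleighian $\mathcal{R}_c(w)=\langle d\mathcal{F}_c\,|\,\mathcal{P}_cw\rangle+\mathcal{D}_c(w)$ (at $c=c(t)$), with $\langle\cdot\,|\,\cdot\rangle$ the evaluation pairing of $T_c^*Q$ with $T_cQ$. The free energy is assumed differentiable with a smooth $L^2$-gradient $\mu(c)\in C^\infty(\mathcal{M})$, i.e. $\langle d\mathcal{F}_c\,|\,\mathring c\rangle=\int_{\mathcal{M}}\mu(c)\,\mathring c\,dV$ for all $\mathring c\in T_cQ$ (so $\mu(c)$ is determined up to an additive constant, which does not affect $\nabla\mu$). $\mathcal{M}$ is taken compact so that all integrals and integrations by parts are valid. *)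

theory Defs
  imports "HOL-Analysis.Analysis"
begin

section \<open>Smooth maps on relatively open subsets of a half-space\<close>

definition bcoord :: "'n::finite" where
  "bcoord = (SOME i. True)"

definition halfspace :: "(real^'n::finite) set" where
  "halfspace = {x. 0 \<le> x $ bcoord}"

text \<open>On an open set in finite dimension this is the usual class of \<open>k\<close> times continuously
  differentiable functions.\<close>
primrec Ck_on :: "nat \<Rightarrow> (real^'n::finite) set \<Rightarrow> (real^'n \<Rightarrow> 'b::real_normed_vector) \<Rightarrow> bool" where
  "Ck_on 0 U f \<longleftrightarrow> continuous_on U f"
| "Ck_on (Suc k) U f \<longleftrightarrow>
     (\<forall>x\<in>U. f differentiable (at x)) \<and>
     (\<forall>v. Ck_on k U (\<lambda>x. frechet_derivative f (at x) v))"

text \<open>\<open>S\<close> need not be open; smooth means having a smooth extension near every point.\<close>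
definition smooth_on :: "(real^'n::finite) set \<Rightarrow> (real^'n \<Rightarrow> 'b::real_normed_vector) \<Rightarrow> bool" where
  "smooth_on S f \<longleftrightarrow>
     (\<forall>x\<in>S. \<exists>U h. open U \<and> x \<in> U \<and> (\<forall>k. Ck_on k U h) \<and> (\<forall>y\<in>S \<inter> U. h y = f y))"

text \<open>\<open>iter_deriv S [v\<^sub>1, \<dots>, v\<^sub>k] f\<close> is the iterated directional derivative of \<open>f\<close>. For \<open>S\<close> relatively
  open in the half-space, derivatives within \<open>S\<close> are unique, also at boundary points.\<close>
primrec iter_deriv ::
    "(real^'n::finite) set \<Rightarrow> (real^'n) list \<Rightarrow> (real^'n \<Rightarrow> real) \<Rightarrow> real^'n \<Rightarrow> real" where
  "iter_deriv S [] f = f"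
| "iter_deriv S (v # vs) f = (\<lambda>x. frechet_derivative (iter_deriv S vs f) (at x within S) v)"


section \<open>Smooth manifolds with boundary\<close>

text \<open>A chart \<open>(U, \<phi>)\<close> is given by its domain and its coordinate map; the values of \<open>\<phi>\<close> outside
  \<open>U\<close> are irrelevant.\<close>
type_synonym ('m, 'n) chart = "'m set \<times> ('m \<Rightarrow> real^'n)"

abbreviation chart_dom :: "('m, 'n::finite) chart \<Rightarrow> 'm set" where
  "chart_dom \<alpha> \<equiv> fst \<alpha>"

abbreviation coords :: "('m, 'n::finite) chart \<Rightarrow> 'm \<Rightarrow> real^'n" where
  "coords \<alpha> \<equiv> snd \<alpha>"

abbreviation chart_img :: "('m, 'n::finite) chart \<Rightarrow> (real^'n) set" where
  "chart_img \<alpha> \<equiv> coords \<alpha> ` chart_dom \<alpha>"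

definition chart_inv :: "('m, 'n::finite) chart \<Rightarrow> real^'n \<Rightarrow> 'm" where
  "chart_inv \<alpha> = inv_into (chart_dom \<alpha>) (coords \<alpha>)"

definition transition :: "('m, 'n::finite) chart \<Rightarrow> ('m, 'n) chart \<Rightarrow> real^'n \<Rightarrow> real^'n" where
  "transition \<alpha> \<beta> = (\<lambda>x. coords \<beta> (chart_inv \<alpha> x))"

definition is_chart :: "('m::topological_space, 'n::finite) chart \<Rightarrow> bool" where
  "is_chart \<alpha> \<longleftrightarrow>
     open (chart_dom \<alpha>) \<and>
     openin (top_of_set halfspace) (chart_img \<alpha>) \<and>
     homeomorphism (chart_dom \<alpha>) (chart_img \<alpha>) (coords \<alpha>) (chart_inv \<alpha>)"

definition smooth_atlas :: "('m::topological_space, 'n::finite) chart set \<Rightarrow> bool" where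
  "smooth_atlas A \<longleftrightarrow>
     (\<forall>\<alpha>\<in>A. is_chart \<alpha>) \<and>
     (\<Union>\<alpha>\<in>A. chart_dom \<alpha>) = UNIV \<and>
     (\<forall>\<alpha>\<in>A. \<forall>\<beta>\<in>A. smooth_on (coords \<alpha> ` (chart_dom \<alpha> \<inter> chart_dom \<beta>)) (transition \<alpha> \<beta>))"

definition chart_at :: "('m, 'n::finite) chart set \<Rightarrow> 'm \<Rightarrow> ('m, 'n) chart" where
  "chart_at A p = (SOME \<alpha>. \<alpha> \<in> A \<and> p \<in> chart_dom \<alpha>)"

definition smooth_functions :: "('m, 'n::finite) chart set \<Rightarrow> ('m \<Rightarrow> real) set" where
  "smooth_functions A = {f. \<forall>\<alpha>\<in>A. smooth_on (chart_img \<alpha>) (\<lambda>x. f (chart_inv \<alpha> x))}"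

definition mboundary :: "('m, 'n::finite) chart set \<Rightarrow> 'm set" where
  "mboundary A = {p. \<exists>\<alpha>\<in>A. p \<in> chart_dom \<alpha> \<and> coords \<alpha> p $ bcoord = 0}"


section \<open>Tangent vectors and vector fields\<close>

text \<open>A tangent vector is the family of its coordinate representations \<open>v \<alpha>\<close> in the charts \<open>\<alpha>\<close>
  around its base point, related by the derivatives of the transition maps. For all other \<open>\<alpha>\<close> the
  value is fixed to be \<open>0\<close>, so that equal tangent vectors are equal as functions.\<close>
type_synonym ('m, 'n) tangent = "('m, 'n) chart \<Rightarrow> real^'n"

definition transition_deriv ::
    "('m, 'n::finite) chart \<Rightarrow> ('m, 'n) chart \<Rightarrow> 'm \<Rightarrow> real^'n \<Rightarrow> real^'n" where
  "transition_deriv \<alpha> \<beta> p =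
     frechet_derivative (transition \<alpha> \<beta>)
       (at (coords \<alpha> p) within coords \<alpha> ` (chart_dom \<alpha> \<inter> chart_dom \<beta>))"

definition tangent_space :: "('m, 'n::finite) chart set \<Rightarrow> 'm \<Rightarrow> ('m, 'n) tangent set" where
  "tangent_space A p = {v.
     (\<forall>\<alpha>\<in>A. \<forall>\<beta>\<in>A. p \<in> chart_dom \<alpha> \<inter> chart_dom \<beta> \<longrightarrow> v \<beta> = transition_deriv \<alpha> \<beta> p (v \<alpha>)) \<and>
     (\<forall>\<alpha>. \<alpha> \<notin> A \<or> p \<notin> chart_dom \<alpha> \<longrightarrow> v \<alpha> = 0)}"

text \<open>The tangent vector at \<open>p\<close> whose representation in the chart \<open>\<alpha>\<close> is \<open>\<xi>\<close>.\<close>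
definition coord_vector ::
    "('m, 'n::finite) chart set \<Rightarrow> ('m, 'n) chart \<Rightarrow> 'm \<Rightarrow> real^'n \<Rightarrow> ('m, 'n) tangent" where
  "coord_vector A \<alpha> p \<xi> =
     (\<lambda>\<beta>. if \<beta> \<in> A \<and> p \<in> chart_dom \<beta> then transition_deriv \<alpha> \<beta> p \<xi> else 0)"

type_synonym ('m, 'n) vfield = "'m \<Rightarrow> ('m, 'n) tangent"

definition vector_fields :: "('m, 'n::finite) chart set \<Rightarrow> ('m, 'n) vfield set" where
  "vector_fields A = {w.
     (\<forall>p. w p \<in> tangent_space A p) \<and>
     (\<forall>\<alpha>\<in>A. smooth_on (chart_img \<alpha>) (\<lambda>x. w (chart_inv \<alpha> x) \<alpha>))}"

definition scale_field :: "('m \<Rightarrow> real) \<Rightarrow> ('m, 'n::finite) vfield \<Rightarrow> ('m, 'n) vfield" where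
  "scale_field f w = (\<lambda>p \<alpha>. f p *\<^sub>R w p \<alpha>)"

text \<open>The derivative \<open>df\<^sub>p(v)\<close>, computed in one chart around \<open>p\<close>; by the chain rule every chart of
  the atlas gives the same value.\<close>
definition dir_deriv ::
    "('m, 'n::finite) chart set \<Rightarrow> ('m \<Rightarrow> real) \<Rightarrow> 'm \<Rightarrow> ('m, 'n) tangent \<Rightarrow> real" where
  "dir_deriv A f p v =
     (let \<alpha> = chart_at A p in
        frechet_derivative (\<lambda>x. f (chart_inv \<alpha> x)) (at (coords \<alpha> p) within chart_img \<alpha>) (v \<alpha>))"


section \<open>Riemannian metric, gradient, divergence, normal, volume\<close>

type_synonym ('m, 'n) metric = "'m \<Rightarrow> ('m, 'n) tangent \<Rightarrow> ('m, 'n) tangent \<Rightarrow> real"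

definition metric_matrix ::
    "('m, 'n::finite) chart set \<Rightarrow> ('m, 'n) metric \<Rightarrow> ('m, 'n) chart \<Rightarrow> 'm \<Rightarrow> real^'n^'n" where
  "metric_matrix A g \<alpha> p =
     (\<chi> i j. g p (coord_vector A \<alpha> p (axis i 1)) (coord_vector A \<alpha> p (axis j 1)))"

definition riemannian_metric :: "('m, 'n::finite) chart set \<Rightarrow> ('m, 'n) metric \<Rightarrow> bool" where
  "riemannian_metric A g \<longleftrightarrow>
     (\<forall>p. \<forall>u\<in>tangent_space A p. \<forall>v\<in>tangent_space A p.
        g p u v = g p v u \<and>
        (\<forall>w\<in>tangent_space A p. \<forall>a b.
           g p (\<lambda>\<alpha>. a *\<^sub>R u \<alpha> + b *\<^sub>R v \<alpha>) w = a * g p u w + b * g p v w)) \<and>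
     (\<forall>p. \<forall>u\<in>tangent_space A p. u \<noteq> (\<lambda>_. 0) \<longrightarrow> 0 < g p u u) \<and>
     (\<forall>\<alpha>\<in>A. \<forall>i j. smooth_on (chart_img \<alpha>) (\<lambda>x. metric_matrix A g \<alpha> (chart_inv \<alpha> x) $ i $ j))"

definition volume_density ::
    "('m, 'n::finite) chart set \<Rightarrow> ('m, 'n) metric \<Rightarrow> ('m, 'n) chart \<Rightarrow> 'm \<Rightarrow> real" where
  "volume_density A g \<alpha> p = sqrt (det (metric_matrix A g \<alpha> p))"

text \<open>\<open>dV\<close> is the unique Borel measure that is given by the density \<open>sqrt (det g)\<close> in every chart.\<close>
definition riemannian_volume ::
    "('m::topological_space, 'n::finite) chart set \<Rightarrow> ('m, 'n) metric \<Rightarrow> 'm measure" where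
  "riemannian_volume A g = (THE V. sets V = sets borel \<and>
     (\<forall>\<alpha>\<in>A. \<forall>B\<in>sets borel. B \<subseteq> chart_dom \<alpha> \<longrightarrow>
        emeasure V B =
          (\<integral>\<^sup>+ x\<in>coords \<alpha> ` B. ennreal (volume_density A g \<alpha> (chart_inv \<alpha> x)) \<partial>lborel)))"

definition gradient ::
    "('m, 'n::finite) chart set \<Rightarrow> ('m, 'n) metric \<Rightarrow> ('m \<Rightarrow> real) \<Rightarrow> ('m, 'n) vfield" where
  "gradient A g f p =
     (THE u. u \<in> tangent_space A p \<and> (\<forall>v\<in>tangent_space A p. g p u v = dir_deriv A f p v))"

text \<open>The coordinate formula \<open>(1/\<rho>) \<Sum>\<^sub>i \<partial>\<^sub>i (\<rho> X\<^sup>i)\<close> with \<open>\<rho> = sqrt (det g)\<close>; its value does not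
  depend on the chart.\<close>
definition divergence ::
    "('m, 'n::finite) chart set \<Rightarrow> ('m, 'n) metric \<Rightarrow> ('m, 'n) vfield \<Rightarrow> 'm \<Rightarrow> real" where
  "divergence A g X p =
     (let \<alpha> = chart_at A p; \<rho> = volume_density A g \<alpha> in
        (1 / \<rho> p) *
        (\<Sum>i\<in>UNIV. frechet_derivative
            (\<lambda>x. \<rho> (chart_inv \<alpha> x) * X (chart_inv \<alpha> x) \<alpha> $ i)
            (at (coords \<alpha> p) within chart_img \<alpha>) (axis i 1)))"

text \<open>Meaningful for \<open>p\<close> in the boundary: there the vectors tangent to the boundary are those whose
  coordinate \<open>bcoord\<close> vanishes, and those with negative coordinate \<open>bcoord\<close> point out of the
  half-space. Both properties are independent of the chart.\<close>
definition outward_normal ::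
    "('m, 'n::finite) chart set \<Rightarrow> ('m, 'n) metric \<Rightarrow> ('m, 'n) vfield" where
  "outward_normal A g p =
     (THE u. u \<in> tangent_space A p \<and> g p u u = 1 \<and>
        (\<forall>v\<in>tangent_space A p. v (chart_at A p) $ bcoord = 0 \<longrightarrow> g p u v = 0) \<and>
        u (chart_at A p) $ bcoord < 0)"


section \<open>Differentiable curves in the space of smooth functions\<close>

text \<open>Convergence in the smooth topology: local uniform convergence of all derivatives in charts.\<close>
definition smooth_limit ::
    "('m, 'n::finite) chart set \<Rightarrow> ('t \<Rightarrow> 'm \<Rightarrow> real) \<Rightarrow> ('m \<Rightarrow> real) \<Rightarrow> 't filter \<Rightarrow> bool" where
  "smooth_limit A f l G \<longleftrightarrow>
     (\<forall>\<alpha>\<in>A. \<forall>K vs. compact K \<and> K \<subseteq> chart_img \<alpha> \<longrightarrow>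
        uniform_limit K
          (\<lambda>s. iter_deriv (chart_img \<alpha>) vs (\<lambda>x. f s (chart_inv \<alpha> x)))
          (iter_deriv (chart_img \<alpha>) vs (\<lambda>x. l (chart_inv \<alpha> x))) G)"

definition has_time_derivative ::
    "('m, 'n::finite) chart set \<Rightarrow> (real \<Rightarrow> 'm \<Rightarrow> real) \<Rightarrow> ('m \<Rightarrow> real) \<Rightarrow> real \<Rightarrow> real set \<Rightarrow> bool" where
  "has_time_derivative A c d t I \<longleftrightarrow>
     d \<in> smooth_functions A \<and>
     smooth_limit A (\<lambda>s p. (c s p - c t p) / (s - t)) d (at t within I)"


section \<open>Onsager's variational principle\<close>

text \<open>\<open>L\<close> is the differential at \<open>c\<close> of the function \<open>F\<close> on the convex set \<open>Q\<close>, with tangent space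
  \<open>T\<close>: a linear form on \<open>T\<close> giving the one-sided derivatives of \<open>F\<close> along all segments in \<open>Q\<close>
  that start at \<open>c\<close>. One-sided, since \<open>c\<close> may lie on the boundary of \<open>Q\<close>. The values of \<open>F\<close> outside
  \<open>Q\<close> and of \<open>L\<close> outside \<open>T\<close> are irrelevant.\<close>
definition is_differential ::
    "('m \<Rightarrow> real) set \<Rightarrow> ('m \<Rightarrow> real) set \<Rightarrow> (('m \<Rightarrow> real) \<Rightarrow> real) \<Rightarrow> ('m \<Rightarrow> real) \<Rightarrow>
     (('m \<Rightarrow> real) \<Rightarrow> real) \<Rightarrow> bool" where
  "is_differential Q T F c L \<longleftrightarrow>
     (\<forall>h\<in>T. \<forall>k\<in>T. \<forall>a b. L (\<lambda>p. a * h p + b * k p) = a * L h + b * L k) \<and>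
     (\<forall>c'\<in>Q. ((\<lambda>s. (F (\<lambda>p. c p + s * (c' p - c p)) - F c) / s) \<longlongrightarrow> L (\<lambda>p. c' p - c p))
                (at_right 0))"

definition differential ::
    "('m \<Rightarrow> real) set \<Rightarrow> ('m \<Rightarrow> real) set \<Rightarrow> (('m \<Rightarrow> real) \<Rightarrow> real) \<Rightarrow> ('m \<Rightarrow> real) \<Rightarrow>
     (('m \<Rightarrow> real) \<Rightarrow> real)" where
  "differential Q T F c = (SOME L. is_differential Q T F c L)"

definition rayleighian ::
    "(('m \<Rightarrow> real) \<Rightarrow> real) \<Rightarrow> (('m \<Rightarrow> real) \<Rightarrow> 'w \<Rightarrow> real) \<Rightarrow> (('m \<Rightarrow> real) \<Rightarrow> 'w \<Rightarrow> 'm \<Rightarrow> real) \<Rightarrow>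
     ('m \<Rightarrow> real) \<Rightarrow> 'w \<Rightarrow> real" where
  "rayleighian dF D P c w = dF (P c w) + D c w"

definition ovp_solution ::
    "('m, 'n::finite) chart set \<Rightarrow> ('m \<Rightarrow> real) set \<Rightarrow> ('m \<Rightarrow> real) set \<Rightarrow>
     (('m \<Rightarrow> real) \<Rightarrow> 'w set) \<Rightarrow> (('m \<Rightarrow> real) \<Rightarrow> real) \<Rightarrow>
     (('m \<Rightarrow> real) \<Rightarrow> 'w \<Rightarrow> real) \<Rightarrow> (('m \<Rightarrow> real) \<Rightarrow> 'w \<Rightarrow> 'm \<Rightarrow> real) \<Rightarrow>
     real set \<Rightarrow> (real \<Rightarrow> 'm \<Rightarrow> real) \<Rightarrow> bool" where
  "ovp_solution A Q T E F D P I c \<longleftrightarrow>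
     (\<forall>t\<in>I. c t \<in> Q) \<and>
     (\<forall>t\<in>I. \<exists>d. has_time_derivative A c d t I \<and>
        (\<exists>v. is_arg_min (rayleighian (differential Q T F (c t)) D P (c t)) (\<lambda>w. w \<in> E (c t)) v \<and>
             d = P (c t) v))"


section \<open>The data of the gradient flow\<close>

definition densities ::
    "('m::topological_space, 'n::finite) chart set \<Rightarrow> ('m, 'n) metric \<Rightarrow> ('m \<Rightarrow> real) set" where
  "densities A g =
     {c \<in> smooth_functions A. (\<forall>p. 0 \<le> c p) \<and> (\<integral>p. c p \<partial>riemannian_volume A g) = 1}"

definition density_tangents ::
    "('m::topological_space, 'n::finite) chart set \<Rightarrow> ('m, 'n) metric \<Rightarrow> ('m \<Rightarrow> real) set" where
  "density_tangents A g =
     {h \<in> smooth_functions A. (\<integral>p. h p \<partial>riemannian_volume A g) = 0}"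

definition velocities ::
    "('m, 'n::finite) chart set \<Rightarrow> ('m, 'n) metric \<Rightarrow> ('m \<Rightarrow> real) \<Rightarrow> ('m, 'n) vfield set" where
  "velocities A g c =
     {w \<in> vector_fields A. \<forall>p\<in>mboundary A. g p (w p) (outward_normal A g p) = 0}"

definition transport ::
    "('m, 'n::finite) chart set \<Rightarrow> ('m, 'n) metric \<Rightarrow> ('m \<Rightarrow> real) \<Rightarrow> ('m, 'n) vfield \<Rightarrow> 'm \<Rightarrow> real" where
  "transport A g c w = (\<lambda>p. - divergence A g (scale_field c w) p)"

definition dissipation ::
    "('m::topological_space, 'n::finite) chart set \<Rightarrow> ('m, 'n) metric \<Rightarrow> ('m \<Rightarrow> real) \<Rightarrow>
     ('m, 'n) vfield \<Rightarrow> real" where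
  "dissipation A g c w = 1 / 2 * (\<integral>p. c p * g p (w p) (w p) \<partial>riemannian_volume A g)"

definition has_L2_gradient ::
    "('m::topological_space, 'n::finite) chart set \<Rightarrow> ('m, 'n) metric \<Rightarrow>
     (('m \<Rightarrow> real) \<Rightarrow> real) \<Rightarrow> ('m \<Rightarrow> real) \<Rightarrow> ('m \<Rightarrow> real) \<Rightarrow> bool" where
  "has_L2_gradient A g F c m \<longleftrightarrow>
     m \<in> smooth_functions A \<and>
     (\<exists>L. is_differential (densities A g) (density_tangents A g) F c L) \<and>
     (\<forall>h\<in>density_tangents A g.
        differential (densities A g) (density_tangents A g) F c h =
          (\<integral>p. m p * h p \<partial>riemannian_volume A g))"

end

theory Submission
  imports Defs
begin

text \<open>
  Let \<open>v\<close> minimize the Rayleighian at the density \<open>q = c(t)\<close>, with \<open>\<mu>\<close> the chemical potential. For a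
  velocity field \<open>w\<close> for which the integration by parts is justified,
  \<open>\<R>(w) = - \<integral> \<mu> div (q w) dV + 1/2 \<integral> q |w|\<^sup>2 dV = \<integral> q (\<langle>\<nabla>\<mu>, w\<rangle> + 1/2 |w|\<^sup>2) dV\<close>,
  so the first variation at \<open>v\<close> in the direction \<open>w\<close> is \<open>\<integral> q \<langle>\<nabla>\<mu> + v, w\<rangle> dV\<close>, and it vanishes. Enough
  test fields \<open>w\<close> give \<open>q (\<nabla>\<mu> + v) = 0\<close>, that is \<open>q v = - q \<nabla>\<mu>\<close>, even where \<open>q\<close> vanishes and \<open>v\<close> is
  not determined; taking the divergence gives the equation.

  No boundary terms arise. The test fields are
  \<open>\<phi> \<partial>\<^sub>i\<close> in one chart, with a bump function \<open>\<phi>\<close> supported off the boundary; for them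
  integration by parts reduces to the vanishing of \<open>\<integral> \<partial>\<^sub>i f dx\<close> for compactly supported \<open>f\<close>
  (\<open>transport_supported\<close>), and together they show that \<open>q (\<nabla>\<mu> + v)\<close> vanishes in the interior; the
  boundary points follow by continuity (\<open>stationarity\<close>). That \<open>div (q v)\<close> itself has integral zero, so that
  \<open>d\<F>\<close> may be evaluated on it, comes from the equation \<open>c' = - div (q v)\<close>: the mass of \<open>c\<close> is
  constant, and the difference quotients converge uniformly
  (\<open>time_derivative_in_density_tangents\<close>).

  The objects involved are defined through charts or by description, and must first be shown to be
  what they are meant to be. The volume measure exists and is unique (\<open>riemannian_volume\<close>): the
  densities \<open>sqrt (det g)\<close> of two charts agree on the overlap by the change of variables
  formula, and measures glue. The outward normal exists
  (\<open>outward_normal_in_tangent_space\<close>), the boundary is the same in all charts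
  (\<open>boundary_chart_independent\<close>), and the divergence does not depend on the chart
  (\<open>div_in_chart_independent\<close>). The reason for the last fact is a weak formulation: in each chart
  the divergence satisfies \<open>\<integral> \<psi> div X dV = - \<integral> d\<psi>(X) dV\<close> for all test functions \<open>\<psi>\<close>, and
  the right-hand side does not refer to the chart.
\<close>

section \<open>Functions of class \<open>C\<^sup>k\<close> on open sets\<close>

lemma linear_axis_expansion:
  fixes L :: "real^'n::finite \<Rightarrow> 'b::real_vector"
  assumes "linear L"
  shows "L \<xi> = (\<Sum>i\<in>UNIV. \<xi> $ i *\<^sub>R L (axis i 1))"
proof -
  have "L \<xi> = L (\<Sum>i\<in>UNIV. (\<xi> $ i) *\<^sub>R axis i 1)"
    by (subst basis_expansion[of \<xi>, unfolded scalar_mult_eq_scaleR]) (rule refl)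
  also have "\<dots> = (\<Sum>i\<in>UNIV. \<xi> $ i *\<^sub>R L (axis i 1))"
    by (simp add: linear_sum[OF assms] linear_scale[OF assms])
  finally show ?thesis .
qed

lemma frechet_derivative_at_eq:
  "(f has_derivative f') (at x) \<Longrightarrow> frechet_derivative f (at x) = f'"
  by (metis frechet_derivative_at)

lemma frechet_derivative_worksI:
  "f differentiable F \<Longrightarrow> (f has_derivative frechet_derivative f F) F"
  by (simp add: frechet_derivative_works)

lemma Ck_on_imp_continuous_on: "Ck_on k U f \<Longrightarrow> continuous_on U f"
  by (cases k) (auto intro!: continuous_at_imp_continuous_on differentiable_imp_continuous_within)

lemma Ck_on_SucD: "Ck_on (Suc k) U f \<Longrightarrow> Ck_on k U f"
proof (induction k arbitrary: f)
  case 0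
  then show ?case using Ck_on_imp_continuous_on by fastforce
next
  case (Suc k)
  then show ?case by (metis Ck_on.simps(2))
qed

lemma Ck_on_subset: "Ck_on k U f \<Longrightarrow> V \<subseteq> U \<Longrightarrow> Ck_on k V f"
  by (induction k arbitrary: f) (auto intro: continuous_on_subset)

lemma Ck_on_cong:
  assumes "open U" "\<And>x. x \<in> U \<Longrightarrow> f x = g x" "Ck_on k U f"
  shows "Ck_on k U g"
  using assms(2,3)
proof (induction k arbitrary: f g)
  case 0
  then show ?case using continuous_on_cong by fastforce
next
  case (Suc k)
  have der: "(g has_derivative frechet_derivative f (at x)) (at x)" if "x \<in> U" for x
  proof (rule has_derivative_transform_within_open[OF _ \<open>open U\<close> that])
    show "(f has_derivative frechet_derivative f (at x)) (at x)"
      using Suc.prems that by (simp add: frechet_derivative_worksI)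
  qed (use Suc.prems in auto)
  then have eq: "frechet_derivative f (at x) = frechet_derivative g (at x)" if "x \<in> U" for x
    using frechet_derivative_at_eq that by metis
  have "Ck_on k U (\<lambda>x. frechet_derivative g (at x) v)" for v
    by (rule Suc.IH[where f="\<lambda>x. frechet_derivative f (at x) v"]) (use Suc.prems eq in auto)
  then show ?case using der by (auto simp: differentiable_def)
qed

text \<open>Introduces \<open>C\<^sup>k\<^sup>+\<^sup>1\<close> from an explicit formula for the derivative, so that the closure
  properties below are inductions over the order in which the formula has the same shape again.\<close>
lemma Ck_on_SucI:
  assumes "open U" "\<And>x. x \<in> U \<Longrightarrow> (f has_derivative f' x) (at x)"
    "\<And>v. Ck_on k U (\<lambda>x. f' x v)"
  shows "Ck_on (Suc k) U f"
proof -
  have "Ck_on k U (\<lambda>x. frechet_derivative f (at x) v)" for v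
    by (rule Ck_on_cong[OF assms(1) _ assms(3)[of v]])
      (use frechet_derivative_at_eq[OF assms(2)] in auto)
  then show ?thesis using assms(2) by (auto simp: differentiable_def)
qed

lemma Ck_on_SucE:
  assumes "Ck_on (Suc k) U f"
  shows "\<And>x. x \<in> U \<Longrightarrow> (f has_derivative frechet_derivative f (at x)) (at x)"
    "\<And>v. Ck_on k U (\<lambda>x. frechet_derivative f (at x) v)"
  using assms by (auto intro: frechet_derivative_worksI)

lemma Ck_on_const: "open U \<Longrightarrow> Ck_on k U (\<lambda>_. a)"
  by (induction k arbitrary: a) auto

lemma Ck_on_add:
  assumes "open U" "Ck_on k U f" "Ck_on k U g"
  shows "Ck_on k U (\<lambda>x. f x + g x)"
  using assms(2,3)
proof (induction k arbitrary: f g)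
  case 0
  then show ?case by (auto intro: continuous_intros)
next
  case (Suc k)
  note f = Ck_on_SucE[OF Suc.prems(1)] and g = Ck_on_SucE[OF Suc.prems(2)]
  show ?case
    by (rule Ck_on_SucI[OF assms(1) has_derivative_add[OF f(1) g(1)]]) (auto intro: Suc.IH f g)
qed

lemma Ck_on_sum:
  assumes "open U" "\<And>i. i \<in> I \<Longrightarrow> Ck_on k U (f i)"
  shows "Ck_on k U (\<lambda>x. \<Sum>i\<in>I. f i x)"
  using assms(2)
  by (induction I rule: infinite_finite_induct) (auto intro: Ck_on_const Ck_on_add assms(1))

text \<open>The product rule and induction over the order.\<close>
lemma Ck_on_bilinear:
  assumes "bounded_bilinear P" "open U" "Ck_on k U f" "Ck_on k U g"
  shows "Ck_on k U (\<lambda>x. P (f x) (g x))"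
  using assms(3,4)
proof (induction k arbitrary: f g)
  case 0
  then show ?case using bounded_bilinear.continuous_on[OF assms(1)] by auto
next
  case (Suc k)
  note f = Ck_on_SucE[OF Suc.prems(1)] and g = Ck_on_SucE[OF Suc.prems(2)]
  note f0 = Ck_on_SucD[OF Suc.prems(1)] and g0 = Ck_on_SucD[OF Suc.prems(2)]
  show ?case
    by (rule Ck_on_SucI[OF assms(2) bounded_bilinear.FDERIV[OF assms(1) f(1) g(1)]])
      (auto intro!: Suc.IH f g f0 g0 Ck_on_add assms(2))
qed

lemmas Ck_on_scaleR = Ck_on_bilinear[OF bounded_bilinear_scaleR]
lemmas Ck_on_mult = Ck_on_bilinear[OF bounded_bilinear_mult]

lemma Ck_on_linear_compose:
  assumes "bounded_linear L" "open U" "Ck_on k U f"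
  shows "Ck_on k U (\<lambda>x. L (f x))"
  using assms(3)
proof (induction k arbitrary: f)
  case 0
  then show ?case by (auto intro: bounded_linear.continuous_on[OF assms(1)])
next
  case (Suc k)
  note f = Ck_on_SucE[OF Suc.prems]
  show ?case
    by (rule Ck_on_SucI[OF assms(2) bounded_linear.has_derivative[OF assms(1) f(1)]])
       (auto intro: Suc.IH f)
qed

lemma Ck_on_ident: "open U \<Longrightarrow> Ck_on k U (\<lambda>x. x)"
proof (cases k)
  case (Suc j)
  assume "open U"
  then show ?thesis
    unfolding Suc by (intro Ck_on_SucI[where f'="\<lambda>_ v. v"]) (auto intro: Ck_on_const)
qed auto

text \<open>The chain rule, with the derivative of the outer map expanded in partial derivatives so that
  the induction hypothesis applies to each of them.\<close>
lemma Ck_on_compose: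
  fixes T :: "real^'n::finite \<Rightarrow> real^'m::finite"
  assumes "open U" "open V" "T ` U \<subseteq> V" "Ck_on k V h" "Ck_on k U T"
  shows "Ck_on k U (\<lambda>x. h (T x))"
  using assms(4,5)
proof (induction k arbitrary: h)
  case 0
  then show ?case using continuous_on_compose2[OF _ _ assms(3)] by auto
next
  case (Suc k)
  note h = Ck_on_SucE[OF Suc.prems(1)] and T = Ck_on_SucE[OF Suc.prems(2)]
  have der: "((\<lambda>x. h (T x)) has_derivative
      (\<lambda>v. \<Sum>i\<in>UNIV. (frechet_derivative T (at x) v $ i) *\<^sub>R
                 frechet_derivative h (at (T x)) (axis i 1))) (at x)" if "x \<in> U" for x
  proof -
    have "T x \<in> V" using assms(3) that by auto
    note hx = h(1)[OF this]
    have 1: "((\<lambda>x. h (T x)) has_derivative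
       (\<lambda>v. frechet_derivative h (at (T x)) (frechet_derivative T (at x) v))) (at x)"
      by (rule has_derivative_compose[OF T(1)[OF that] hx])
    note 2 = linear_axis_expansion[OF has_derivative_linear[OF hx]]
    show ?thesis by (rule has_derivative_eq_rhs[OF 1]) (rule ext, rule 2)
  qed
  show ?case
  proof (rule Ck_on_SucI[OF assms(1) der])
    fix v
    have "Ck_on k U (\<lambda>x. frechet_derivative T (at x) v $ i)" for i
      by (rule Ck_on_linear_compose[OF bounded_linear_vec_nth assms(1) T(2)])
    then show "Ck_on k U (\<lambda>x. \<Sum>i\<in>UNIV. (frechet_derivative T (at x) v $ i) *\<^sub>R
                 frechet_derivative h (at (T x)) (axis i 1))"
      by (intro Ck_on_sum Ck_on_scaleR assms(1) Suc.IH h(2) Ck_on_SucD[OF Suc.prems(2)])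
  qed
qed

lemma Ck_on_powr:
  fixes f :: "real^'n::finite \<Rightarrow> real"
  assumes "open U" "\<And>x. x \<in> U \<Longrightarrow> 0 < f x" "Ck_on k U f"
  shows "Ck_on k U (\<lambda>x. f x powr a)"
  using assms(3)
proof (induction k arbitrary: a)
  case 0
  then show ?case using assms(2) by (fastforce intro!: continuous_intros)
next
  case (Suc k)
  note f = Ck_on_SucE[OF Suc.prems]
  have der: "((\<lambda>x. f x powr a) has_derivative
     (\<lambda>v. (a * f x powr (a - 1)) * frechet_derivative f (at x) v)) (at x)" if "x \<in> U" for x
  proof -
    have "((\<lambda>y. y powr a) has_derivative (\<lambda>h. (a * f x powr (a - 1)) * h)) (at (f x))"
      using has_real_derivative_powr[of "f x" a] assms(2)[OF that]
      by (simp add: has_field_derivative_def)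
    from has_derivative_compose[OF f(1)[OF that] this] show ?thesis .
  qed
  show ?case
    by (rule Ck_on_SucI[OF assms(1) der], assumption)
      (intro Ck_on_mult Ck_on_const assms(1) f(2) Suc.IH Ck_on_SucD[OF Suc.prems])
qed

section \<open>Smooth bump functions\<close>

text \<open>The functions \<open>t\<^sup>-\<^sup>m exp (-1/t)\<close>, extended by zero, form a family closed under differentiation;
  hence each of them is smooth across zero.\<close>
definition flat_exp :: "nat \<Rightarrow> real \<Rightarrow> real" where
  "flat_exp m t = (if 0 < t then exp (- (1 / t)) / t ^ m else 0)"

lemma flat_exp_has_derivative:
  "(flat_exp m has_real_derivative (flat_exp (m + 2) t - m * flat_exp (m + 1) t)) (at t)"
proof (cases t "0::real" rule: linorder_cases)
  case less
  have "((\<lambda>_. 0) has_real_derivative 0) (at t)" by simp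
  then have "(flat_exp m has_real_derivative 0) (at t)"
    by (rule has_field_derivative_transform_within_open[where S="{..<0}"])
      (use less in \<open>auto simp: flat_exp_def\<close>)
  then show ?thesis using less by (simp add: flat_exp_def)
next
  case greater
  have "((\<lambda>t. exp (- (1 / t)) / t ^ m) has_real_derivative
     (exp (- (1 / t)) / t ^ (m + 2) - m * (exp (- (1 / t)) / t ^ (m + 1)))) (at t)"
  proof -
    have e: "((\<lambda>t. exp (- (1 / t))) has_real_derivative exp (- (1 / t)) * (1 / t ^ 2)) (at t)"
      using greater by (auto intro!: derivative_eq_intros simp: power2_eq_square)
    have p: "((\<lambda>t. inverse t ^ m) has_real_derivative - (m * inverse t ^ (m + 1))) (at t)"
    proof -
      have "((\<lambda>t. inverse t ^ m) has_real_derivative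
          of_nat m * (- (inverse t ^ Suc (Suc 0)) * inverse t ^ (m - Suc 0))) (at t)"
        by (rule DERIV_power[OF DERIV_inverse]) (use greater in simp)
      then show ?thesis by (cases m) (simp_all add: algebra_simps)
    qed
    have eq: "(\<lambda>s::real. exp (- (1 / s)) / s ^ m) = (\<lambda>s. exp (- (1 / s)) * inverse s ^ m)"
      by (simp add: fun_eq_iff inverse_eq_divide power_one_over)
    show ?thesis
      unfolding eq by (rule DERIV_cong[OF DERIV_mult[OF e p]])
        (simp add: power_inverse divide_inverse algebra_simps power2_eq_square)
  qed
  then have "(flat_exp m has_real_derivative
     (exp (- (1 / t)) / t ^ (m + 2) - m * (exp (- (1 / t)) / t ^ (m + 1)))) (at t)"
    by (rule has_field_derivative_transform_within_open[where S="{0<..}"])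
      (use greater in \<open>auto simp: flat_exp_def\<close>)
  then show ?thesis using greater by (simp add: flat_exp_def)
next
  case equal
  have right: "((\<lambda>t. exp (- (1 / t)) / t ^ (m + 1)) \<longlongrightarrow> 0) (at_right (0::real))"
  proof -
    have "((\<lambda>y::real. y ^ (m + 1) / exp y) \<longlongrightarrow> 0) at_top"
      by (rule tendsto_power_div_exp_0)
    then have "((\<lambda>t::real. (inverse t) ^ (m + 1) / exp (inverse t)) \<longlongrightarrow> 0) (at_right 0)"
      using filterlim_compose[OF _ filterlim_inverse_at_top_right] by blast
    then show ?thesis
      by (simp add: field_simps exp_minus)
  qed
  have "((\<lambda>h. (flat_exp m (0 + h) - flat_exp m 0) / h) \<longlongrightarrow> 0) (at 0)"
  proof (rule filterlim_split_at)
    show "((\<lambda>h. (flat_exp m (0 + h) - flat_exp m 0) / h) \<longlongrightarrow> 0) (at_left 0)"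
      by (rule tendsto_eventually) (auto simp: flat_exp_def eventually_at_filter)
    show "((\<lambda>h. (flat_exp m (0 + h) - flat_exp m 0) / h) \<longlongrightarrow> 0) (at_right 0)"
      by (rule Lim_transform_eventually[OF right])
        (auto simp: flat_exp_def eventually_at_filter field_simps)
  qed
  then show ?thesis using equal by (simp add: DERIV_def flat_exp_def)
qed

lemma Ck_on_flat_exp:
  fixes q :: "real^'n::finite \<Rightarrow> real"
  assumes "open U" "Ck_on k U q"
  shows "Ck_on k U (\<lambda>x. flat_exp m (q x))"
  using assms(2)
proof (induction k arbitrary: m)
  case 0
  have "continuous_on UNIV (flat_exp m)"
    using flat_exp_has_derivative DERIV_isCont by (blast intro: continuous_at_imp_continuous_on)
  with 0 show ?case by (auto intro: continuous_on_compose2)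
next
  case (Suc k)
  note q = Ck_on_SucE[OF Suc.prems]
  have der: "((\<lambda>x. flat_exp m (q x)) has_derivative
     (\<lambda>v. (flat_exp (m + 2) (q x) + (- real m) * flat_exp (m + 1) (q x))
            * frechet_derivative q (at x) v)) (at x)" if "x \<in> U" for x
    using has_derivative_compose[OF q(1)[OF that]
        flat_exp_has_derivative[unfolded has_field_derivative_def]]
    by simp
  show ?case
    by (rule Ck_on_SucI[OF assms(1) der], assumption)
      (intro Ck_on_mult Ck_on_add Ck_on_const assms(1) q(2) Suc.IH Ck_on_SucD[OF Suc.prems])
qed

text \<open>The squared radius keeps the argument polynomial, hence smooth also at the centre.\<close>
definition bump :: "real^'n::finite \<Rightarrow> real \<Rightarrow> real^'n \<Rightarrow> real" where
  "bump x\<^sub>0 r x = flat_exp 0 (r\<^sup>2 - (x - x\<^sub>0) \<bullet> (x - x\<^sub>0))"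

lemma bump_nonneg: "0 \<le> bump x\<^sub>0 r x"
  by (simp add: bump_def flat_exp_def)

lemma bump_pos_iff: "0 < r \<Longrightarrow> 0 < bump x\<^sub>0 r x \<longleftrightarrow> x \<in> ball x\<^sub>0 r"
proof -
  assume "0 < r"
  have "dist x\<^sub>0 x < r \<longleftrightarrow> (dist x\<^sub>0 x)\<^sup>2 < r\<^sup>2"
    using \<open>0 < r\<close> by (metis less_le power2_less_imp_less power_strict_mono zero_le_dist zero_less_numeral)
  moreover have "(dist x\<^sub>0 x)\<^sup>2 = (x - x\<^sub>0) \<bullet> (x - x\<^sub>0)"
    by (metis dist_commute dist_norm dot_square_norm)
  ultimately show ?thesis by (auto simp: bump_def flat_exp_def)
qed

lemma bump_outside: "0 < r \<Longrightarrow> x \<notin> cball x\<^sub>0 r \<Longrightarrow> bump x\<^sub>0 r x = 0"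
  using bump_pos_iff[of r x\<^sub>0 x] bump_nonneg[of x\<^sub>0 r x] by (simp add: mem_ball mem_cball)

lemma Ck_on_bump: "Ck_on k UNIV (bump x\<^sub>0 r)"
proof -
  have d: "Ck_on k UNIV (\<lambda>x. x + (- x\<^sub>0))"
    by (intro Ck_on_add Ck_on_ident Ck_on_const) auto
  have "Ck_on k UNIV (\<lambda>x. (x + (- x\<^sub>0)) \<bullet> (x + (- x\<^sub>0)))"
    by (rule Ck_on_bilinear[OF bounded_bilinear_inner open_UNIV d d])
  then have "Ck_on k UNIV (\<lambda>x. r\<^sup>2 + (-1) * ((x + (- x\<^sub>0)) \<bullet> (x + (- x\<^sub>0))))"
    by (intro Ck_on_add Ck_on_mult Ck_on_const) auto
  then have "Ck_on k UNIV (\<lambda>x. flat_exp 0 (r\<^sup>2 + (-1) * ((x + (- x\<^sub>0)) \<bullet> (x + (- x\<^sub>0)))))"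
    by (intro Ck_on_flat_exp) auto
  moreover have "bump x\<^sub>0 r = (\<lambda>x. flat_exp 0 (r\<^sup>2 + (-1) * ((x + (- x\<^sub>0)) \<bullet> (x + (- x\<^sub>0)))))"
    by (simp add: bump_def fun_eq_iff)
  ultimately show ?thesis by simp
qed

text \<open>If \<open>m\<close> were positive at \<open>x\<^sub>0\<close>, it would be positive on a ball; a bump supported there has a
  nonnegative product with \<open>m\<close>, whose integral vanishes only if it is zero almost everywhere. The
  negative case is the positive one for \<open>- m\<close>.\<close>
lemma bump_test_zero:
  fixes m :: "real^'n::finite \<Rightarrow> real"
  assumes "open W" "x\<^sub>0 \<in> W" "continuous_on W m"
    and test: "\<And>r. 0 < r \<Longrightarrow> cball x\<^sub>0 r \<subseteq> W \<Longrightarrow> (\<integral>x. indicator W x * (bump x\<^sub>0 r x * m x) \<partial>lborel) = 0"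
  shows "m x\<^sub>0 = 0"
proof -
  have aux: False if "continuous_on W m" "0 < m x\<^sub>0"
    and test: "\<And>r. 0 < r \<Longrightarrow> cball x\<^sub>0 r \<subseteq> W \<Longrightarrow> (\<integral>x. indicator W x * (bump x\<^sub>0 r x * m x) \<partial>lborel) = 0"
    for m :: "real^'n \<Rightarrow> real"
  proof -
    have "open (W \<inter> m -` {0<..})"
      using continuous_open_preimage[OF that(1) assms(1)] by simp
    moreover have "x\<^sub>0 \<in> W \<inter> m -` {0<..}" using that assms by auto
    ultimately obtain r where r: "0 < r" "cball x\<^sub>0 r \<subseteq> W \<inter> m -` {0<..}"
      by (meson open_contains_cball)
    then have W: "cball x\<^sub>0 r \<subseteq> W" by auto
    let ?F = "\<lambda>x. bump x\<^sub>0 r x * m x"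
    have eq: "indicator W x * ?F x = indicator (cball x\<^sub>0 r) x *\<^sub>R ?F x" for x
      using bump_outside[OF r(1), of x x\<^sub>0] W by (auto simp: indicator_def)
    have int: "integrable lborel (\<lambda>x. indicator W x * ?F x)"
      unfolding eq
    proof (rule borel_integrable_compact)
      show "continuous_on (cball x\<^sub>0 r) (\<lambda>x. bump x\<^sub>0 r x * m x)"
        using Ck_on_imp_continuous_on[OF Ck_on_bump[of 0]] that(1) W
        by (intro continuous_intros) (auto intro: continuous_on_subset)
    qed simp
    have nn: "0 \<le> indicator W x * ?F x" for x
      using r bump_nonneg[of x\<^sub>0 r x] unfolding eq by (auto simp: indicator_def)
    have "AE x in lborel. indicator W x * ?F x = 0"
      using integral_nonneg_eq_0_iff_AE[OF int] nn test[OF r(1) W] by simp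
    moreover have "indicator W x * ?F x \<noteq> 0" if "x \<in> ball x\<^sub>0 r" for x
    proof -
      have "x \<in> cball x\<^sub>0 r" using that by auto
      then have "0 < m x" "x \<in> W" using r(2) by auto
      then show ?thesis using bump_pos_iff[OF r(1)] that by (auto simp: less_le)
    qed
    ultimately have "AE x in lborel. x \<notin> ball x\<^sub>0 r" by (auto elim: eventually_mono)
    then have "ball x\<^sub>0 r \<in> null_sets lborel"
      by (subst (asm) AE_iff_null_sets[symmetric]) auto
    then show False
      using content_ball_pos[OF r(1), of x\<^sub>0] by (simp add: null_sets_def measure_def)
  qed
  have "\<not> 0 < m x\<^sub>0" using aux[OF assms(3) _ test] by blast
  moreover have "\<not> 0 < - m x\<^sub>0"
    using aux[of "\<lambda>x. - m x"] assms(3) test by (auto intro: continuous_on_minus)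
  ultimately show ?thesis by linarith
qed

section \<open>Derivatives on relatively open subsets of the half-space\<close>

text \<open>A point of the bounding hyperplane can be left in every coordinate direction by a small
  positive step, which does not decrease any coordinate. This is why derivatives
  within the half-space are unique at boundary points too.\<close>
lemma openin_halfspace_direction:
  assumes "openin (top_of_set halfspace) S" "x \<in> S" "0 < e"
  obtains d where "0 < d" "d < e" "\<And>k. x + d *\<^sub>R axis k 1 \<in> S"
proof -
  obtain r where r: "0 < r" "ball x r \<inter> halfspace \<subseteq> S"
    using assms(1,2) by (auto simp: openin_contains_ball)
  define d where "d = min e r / 2"
  have d: "0 < d" "d < e" "d < r" using \<open>0 < e\<close> r by (auto simp: d_def)
  have "x + d *\<^sub>R axis k 1 \<in> S" for k
  proof -
    have "x \<in> halfspace" using assms openin_imp_subset by blast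
    then have "x + d *\<^sub>R axis k 1 \<in> halfspace" using d by (simp add: halfspace_def axis_def)
    moreover have "dist x (x + d *\<^sub>R axis k 1) < r"
      using d by (simp add: dist_norm)
    ultimately show ?thesis using r by (auto simp: mem_ball)
  qed
  then show ?thesis using that d by blast
qed

lemma halfspace_derivative_unique:
  fixes f :: "real^'n::finite \<Rightarrow> 'b::real_normed_vector"
  assumes "openin (top_of_set halfspace) S" "x \<in> S"
    "(f has_derivative f') (at x within S)" "(f has_derivative f'') (at x within S)"
  shows "f' = f''"
proof (rule frechet_derivative_unique_within[OF assms(3,4)])
  fix i :: "real^'n" and e :: real
  assume "i \<in> Basis" "0 < e"
  then obtain k where "i = axis k 1" by (auto simp: Basis_vec_def)
  moreover obtain d where "0 < d" "d < e" "\<And>k. x + d *\<^sub>R axis k 1 \<in> S"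
    using openin_halfspace_direction[OF assms(1,2) \<open>0 < e\<close>] by blast
  ultimately show "\<exists>d. 0 < \<bar>d\<bar> \<and> \<bar>d\<bar> < e \<and> x + d *\<^sub>R i \<in> S"
    by (intro exI[of _ d]) auto
qed

lemma frechet_derivative_halfspace:
  assumes "openin (top_of_set halfspace) S" "x \<in> S" "(f has_derivative f') (at x within S)"
  shows "frechet_derivative f (at x within S) = f'"
  using halfspace_derivative_unique[OF assms(1,2) _ assms(3)] assms(3)
    frechet_derivative_worksI differentiableI by blast

text \<open>The derivative within a relatively open set is local: it may be computed within any other
  relatively open set around the point, from any function that agrees on the overlap.\<close>
lemma frechet_derivative_halfspace_cong:
  assumes "openin (top_of_set halfspace) S" "x \<in> S"
    "openin (top_of_set halfspace) T" "x \<in> T"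
    "(f has_derivative f') (at x within S)" "\<And>y. y \<in> T \<Longrightarrow> y \<in> S \<Longrightarrow> g y = f y"
  shows "(g has_derivative f') (at x within T)"
proof -
  have "openin (top_of_set halfspace) (S \<inter> T)" using assms by blast
  then obtain U where U: "open U" "S \<inter> T = halfspace \<inter> U" by (auto simp: openin_open)
  have sub: "T \<subseteq> halfspace" "S \<subseteq> halfspace"
    using assms(1,3) by (auto dest: openin_imp_subset)
  have "(f has_derivative f') (at x within S \<inter> T)"
    using assms(5) by (rule has_derivative_subset) auto
  then have "(g has_derivative f') (at x within S \<inter> T)"
    by (rule has_derivative_transform[rotated -1]) (use assms in auto)
  moreover have "at x within S \<inter> T = at x within T"
  proof (rule at_within_nhd[of _ U])
    show "x \<in> U" using U assms by auto
    show "S \<inter> T \<inter> U - {x} = T \<inter> U - {x}" using U sub by auto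
  qed (use U in auto)
  ultimately show ?thesis by simp
qed

lemma openin_halfspace_interior:
  assumes "openin (top_of_set halfspace) S"
  shows "open (S \<inter> {x. 0 < x $ bcoord})"
proof -
  obtain U where U: "open U" "S = halfspace \<inter> U" using assms by (auto simp: openin_open)
  then have "S \<inter> {x. 0 < x $ bcoord} = U \<inter> {x. 0 < x $ bcoord}"
    by (auto simp: halfspace_def)
  moreover have "open {x::real^'a. 0 < x $ bcoord}"
    by (intro open_Collect_less continuous_intros)
  ultimately show ?thesis using U by (simp add: open_Int)
qed

lemma at_within_halfspace_interior:
  assumes "openin (top_of_set halfspace) S" "x \<in> S" "0 < x $ bcoord"
  shows "at x within S = at x"
proof (rule at_within_interior)
  show "x \<in> interior S"
    using openin_halfspace_interior[OF assms(1)] assms(2,3)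
    by (auto intro!: interiorI)
qed

text \<open>Every point of a relatively open set is a limit of points of the set off the boundary
  hyperplane, so identities between continuous functions extend to the hyperplane.\<close>
lemma continuous_zero_on_halfspace:
  fixes f :: "real^'n::finite \<Rightarrow> real"
  assumes "openin (top_of_set halfspace) S" "continuous_on S f" "x \<in> S"
    "\<And>y. y \<in> S \<Longrightarrow> 0 < y $ bcoord \<Longrightarrow> f y = 0"
  shows "f x = 0"
proof (rule ccontr)
  assume "f x \<noteq> 0"
  then have "\<exists>e>0. \<forall>y\<in>S. dist y x < e \<longrightarrow> dist (f y) (f x) < \<bar>f x\<bar>"
    using assms(2,3) unfolding continuous_on_iff by auto
  then obtain e where e: "e > 0" "\<And>y. y \<in> S \<Longrightarrow> dist y x < e \<Longrightarrow> dist (f y) (f x) < \<bar>f x\<bar>"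
    by auto
  obtain d where d: "0 < d" "d < e" "\<And>k. x + d *\<^sub>R axis k 1 \<in> S"
    using openin_halfspace_direction[OF assms(1,3) e(1)] by blast
  let ?y = "x + d *\<^sub>R axis bcoord 1"
  have "x \<in> halfspace" using assms openin_imp_subset by blast
  then have "0 < ?y $ bcoord" using d by (simp add: halfspace_def)
  then have "f ?y = 0" using assms(4) d by auto
  moreover have "dist ?y x < e" using d by (simp add: dist_norm)
  ultimately show False using e(2)[OF d(3)[of bcoord]] by (simp add: dist_norm)
qed

section \<open>Smooth maps on arbitrary sets\<close>

lemma smooth_onE:
  assumes "smooth_on S f" "x \<in> S"
  obtains U h where "open U" "x \<in> U" "\<And>k. Ck_on k U h" "\<And>y. y \<in> S \<Longrightarrow> y \<in> U \<Longrightarrow> h y = f y"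
proof -
  have "\<exists>U h. open U \<and> x \<in> U \<and> (\<forall>k. Ck_on k U h) \<and> (\<forall>y\<in>S \<inter> U. h y = f y)"
    using assms unfolding smooth_on_def by simp
  then obtain U h where "open U \<and> x \<in> U \<and> (\<forall>k. Ck_on k U h) \<and> (\<forall>y\<in>S \<inter> U. h y = f y)"
    by (elim exE)
  then show thesis by (intro that[of U h]) auto
qed

lemma smooth_onI:
  assumes "\<And>x. x \<in> S \<Longrightarrow> \<exists>U h. open U \<and> x \<in> U \<and> (\<forall>k. Ck_on k U h) \<and> (\<forall>y\<in>S \<inter> U. h y = f y)"
  shows "smooth_on S f"
  using assms unfolding smooth_on_def by simp

lemma smooth_on_Ck: "open U \<Longrightarrow> S \<subseteq> U \<Longrightarrow> (\<And>k. Ck_on k U f) \<Longrightarrow> smooth_on S f"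
  by (rule smooth_onI) blast

lemma smooth_on_subset:
  assumes "smooth_on S f" "T \<subseteq> S" shows "smooth_on T f"
proof (rule smooth_onI)
  fix x assume "x \<in> T"
  then have "x \<in> S" using assms by auto
  then obtain U h where "open U" "x \<in> U" "\<And>k. Ck_on k U h" "\<And>y. y \<in> S \<Longrightarrow> y \<in> U \<Longrightarrow> h y = f y"
    using smooth_onE[OF assms(1)] by blast
  then show "\<exists>U h. open U \<and> x \<in> U \<and> (\<forall>k. Ck_on k U h) \<and> (\<forall>y\<in>T \<inter> U. h y = f y)"
    using assms(2) by (intro exI[of _ U] exI[of _ h]) auto
qed

lemma smooth_on_cong:
  assumes "\<And>x. x \<in> S \<Longrightarrow> f x = g x" "smooth_on S f" shows "smooth_on S g"
proof (rule smooth_onI)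
  fix x assume "x \<in> S"
  then obtain U h where "open U" "x \<in> U" "\<And>k. Ck_on k U h" "\<And>y. y \<in> S \<Longrightarrow> y \<in> U \<Longrightarrow> h y = f y"
    using smooth_onE[OF assms(2)] by blast
  then show "\<exists>U h. open U \<and> x \<in> U \<and> (\<forall>k. Ck_on k U h) \<and> (\<forall>y\<in>S \<inter> U. h y = g y)"
    using assms(1) by (intro exI[of _ U] exI[of _ h]) auto
qed

lemma smooth_on_local:
  assumes "\<And>x. x \<in> S \<Longrightarrow> \<exists>W. open W \<and> x \<in> W \<and> smooth_on (S \<inter> W) f"
  shows "smooth_on S f"
proof (rule smooth_onI)
  fix x assume "x \<in> S"
  then obtain W where W: "open W" "x \<in> W" "smooth_on (S \<inter> W) f" using assms by blast
  obtain U h where U: "open U" "x \<in> U" "\<And>k. Ck_on k U h" "\<And>y. y \<in> S \<inter> W \<Longrightarrow> y \<in> U \<Longrightarrow> h y = f y"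
    using smooth_onE[OF W(3), of x] W(2) \<open>x \<in> S\<close> by (metis IntI)
  show "\<exists>U h. open U \<and> x \<in> U \<and> (\<forall>k. Ck_on k U h) \<and> (\<forall>y\<in>S \<inter> U. h y = f y)"
    by (rule exI[of _ "U \<inter> W"], rule exI[of _ h])
      (use U(1,2,4) W(1,2) Ck_on_subset[OF U(3), of "U \<inter> W"] in auto)
qed

lemma smooth_on_const: "smooth_on S (\<lambda>_. a)"
  by (rule smooth_on_Ck[of UNIV]) (auto intro: Ck_on_const)

lemma smooth_on_binary:
  fixes S :: "(real^'n::finite) set"
  assumes "smooth_on S f" "smooth_on S g"
    and "\<And>(U :: (real^'n) set) k h h'. open U \<Longrightarrow> Ck_on k U h \<Longrightarrow> Ck_on k U h' \<Longrightarrow> Ck_on k U (\<lambda>x. P (h x) (h' x))"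
  shows "smooth_on S (\<lambda>x. P (f x) (g x))"
proof (rule smooth_onI)
  fix x assume "x \<in> S"
  obtain U h where U: "open U" "x \<in> U" "\<And>k. Ck_on k U h" "\<And>y. y \<in> S \<Longrightarrow> y \<in> U \<Longrightarrow> h y = f y"
    using smooth_onE[OF assms(1) \<open>x \<in> S\<close>] by blast
  obtain V h' where V: "open V" "x \<in> V" "\<And>k. Ck_on k V h'" "\<And>y. y \<in> S \<Longrightarrow> y \<in> V \<Longrightarrow> h' y = g y"
    using smooth_onE[OF assms(2) \<open>x \<in> S\<close>] by blast
  show "\<exists>U h. open U \<and> x \<in> U \<and> (\<forall>k. Ck_on k U h) \<and> (\<forall>y\<in>S \<inter> U. h y = P (f y) (g y))"
  proof (rule exI[of _ "U \<inter> V"], rule exI[of _ "\<lambda>x. P (h x) (h' x)"], intro conjI allI ballI)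
    fix k
    show "Ck_on k (U \<inter> V) (\<lambda>x. P (h x) (h' x))"
      by (rule assms(3)) (use U V in \<open>auto intro: Ck_on_subset\<close>)
  qed (use U V in auto)
qed

lemma smooth_on_bilinear:
  "bounded_bilinear P \<Longrightarrow> smooth_on S f \<Longrightarrow> smooth_on S g \<Longrightarrow> smooth_on S (\<lambda>x. P (f x) (g x))"
  by (rule smooth_on_binary) (auto intro: Ck_on_bilinear)

lemma smooth_on_add: "smooth_on S f \<Longrightarrow> smooth_on S g \<Longrightarrow> smooth_on S (\<lambda>x. f x + g x)"
  by (rule smooth_on_binary[where P="(+)"]) (auto intro: Ck_on_add)

lemmas smooth_on_scaleR = smooth_on_bilinear[OF bounded_bilinear_scaleR]
lemmas smooth_on_mult = smooth_on_bilinear[OF bounded_bilinear_mult]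

lemma smooth_on_linear_compose:
  assumes "bounded_linear L" "smooth_on S f"
  shows "smooth_on S (\<lambda>x. L (f x))"
  by (rule smooth_on_binary[OF assms(2,2), where P="\<lambda>x y. L x"])
    (auto intro: Ck_on_linear_compose assms)

lemmas smooth_on_nth = smooth_on_linear_compose[OF bounded_linear_vec_nth]

lemma smooth_on_sum:
  "(\<And>i. i \<in> I \<Longrightarrow> smooth_on S (f i)) \<Longrightarrow> smooth_on S (\<lambda>x. \<Sum>i\<in>I. f i x)"
  by (induction I rule: infinite_finite_induct) (auto intro: smooth_on_const smooth_on_add)

lemma smooth_on_prod:
  fixes f :: "'i \<Rightarrow> real^'n::finite \<Rightarrow> real"
  shows "(\<And>i. i \<in> I \<Longrightarrow> smooth_on S (f i)) \<Longrightarrow> smooth_on S (\<lambda>x. \<Prod>i\<in>I. f i x)"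
  by (induction I rule: infinite_finite_induct) (auto intro: smooth_on_const smooth_on_mult)

lemma smooth_on_continuous_on:
  assumes "smooth_on S f" shows "continuous_on S f"
  unfolding continuous_on_eq_continuous_within
proof
  fix x assume "x \<in> S"
  obtain U h where U: "open U" "x \<in> U" "\<And>k. Ck_on k U h" "\<And>y. y \<in> S \<Longrightarrow> y \<in> U \<Longrightarrow> h y = f y"
    using smooth_onE[OF assms \<open>x \<in> S\<close>] by blast
  have "continuous (at x) h"
    using Ck_on_imp_continuous_on[OF U(3)[of 0]] U(1,2) continuous_on_eq_continuous_at by blast
  then have "continuous (at x within S) h" by (rule continuous_within_subset) auto
  moreover have "eventually (\<lambda>y. h y = f y) (at x within S)"
    using U by (auto simp: eventually_at_topological)
  ultimately show "continuous (at x within S) f"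
    using U \<open>x \<in> S\<close> unfolding continuous_within by (metis (mono_tags) Lim_transform_eventually)
qed

lemma smooth_on_compose:
  fixes T :: "real^'n::finite \<Rightarrow> real^'m::finite"
  assumes "smooth_on S' h" "smooth_on S T" "T ` S \<subseteq> S'"
  shows "smooth_on S (\<lambda>x. h (T x))"
proof (rule smooth_onI)
  fix x assume "x \<in> S"
  then have "T x \<in> S'" using assms by auto
  obtain U T' where U: "open U" "x \<in> U" "\<And>k. Ck_on k U T'" "\<And>y. y \<in> S \<Longrightarrow> y \<in> U \<Longrightarrow> T' y = T y"
    using smooth_onE[OF assms(2) \<open>x \<in> S\<close>] by blast
  obtain V h' where V: "open V" "T x \<in> V" "\<And>k. Ck_on k V h'" "\<And>y. y \<in> S' \<Longrightarrow> y \<in> V \<Longrightarrow> h' y = h y"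
    using smooth_onE[OF assms(1) \<open>T x \<in> S'\<close>] by blast
  have op: "open (U \<inter> T' -` V)"
    using continuous_open_preimage[OF Ck_on_imp_continuous_on[OF U(3)[of 0]] U(1) V(1)] .
  show "\<exists>U g. open U \<and> x \<in> U \<and> (\<forall>k. Ck_on k U g) \<and> (\<forall>y\<in>S \<inter> U. g y = h (T y))"
  proof (rule exI[of _ "U \<inter> T' -` V"], rule exI[of _ "\<lambda>x. h' (T' x)"], intro conjI allI ballI)
    fix k
    show "Ck_on k (U \<inter> T' -` V) (\<lambda>x. h' (T' x))"
      by (rule Ck_on_compose[OF op V(1) _ V(3)]) (auto intro: Ck_on_subset[OF U(3)])
  next
    fix y assume y: "y \<in> S \<inter> (U \<inter> T' -` V)"
    then have "T' y = T y" using U(4) by auto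
    moreover have "T y \<in> S'" using y assms(3) by auto
    ultimately show "h' (T' y) = h (T y)" using V(4)[of "T y"] y by auto
  qed (use op U V \<open>x \<in> S\<close> in auto)
qed

lemma smooth_on_powr:
  fixes f :: "real^'n::finite \<Rightarrow> real"
  assumes "smooth_on S f" "\<And>x. x \<in> S \<Longrightarrow> 0 < f x"
  shows "smooth_on S (\<lambda>x. f x powr a)"
proof (rule smooth_onI)
  fix x assume "x \<in> S"
  obtain U h where U: "open U" "x \<in> U" "\<And>k. Ck_on k U h" "\<And>y. y \<in> S \<Longrightarrow> y \<in> U \<Longrightarrow> h y = f y"
    using smooth_onE[OF assms(1) \<open>x \<in> S\<close>] by blast
  let ?W = "U \<inter> h -` {0<..}"
  have op: "open ?W"
    using continuous_open_preimage[OF Ck_on_imp_continuous_on[OF U(3)[of 0]] U(1)] by simp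
  have "Ck_on k ?W (\<lambda>x. h x powr a)" for k
    by (rule Ck_on_powr[OF op]) (auto intro: Ck_on_subset[OF U(3)])
  then show "\<exists>U h. open U \<and> x \<in> U \<and> (\<forall>k. Ck_on k U h) \<and> (\<forall>y\<in>S \<inter> U. h y = f y powr a)"
    using op U(2,4) assms(2) \<open>x \<in> S\<close> by (intro exI[of _ ?W] exI[of _ "\<lambda>x. h x powr a"]) auto
qed

text \<open>Within a relatively open subset of the half-space the derivative is that of any local
  extension, by uniqueness; so it is again a restriction of smooth functions.\<close>
lemma smooth_on_has_derivative:
  assumes "openin (top_of_set halfspace) S" "smooth_on S f"
  shows "\<And>x. x \<in> S \<Longrightarrow> (f has_derivative frechet_derivative f (at x within S)) (at x within S)"
    "smooth_on S (\<lambda>x. frechet_derivative f (at x within S) v)"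
proof -
  have ext: "\<exists>U h. open U \<and> x \<in> U \<and> (\<forall>k. Ck_on k U h) \<and> (\<forall>y\<in>S\<inter>U. h y = f y) \<and>
      (\<forall>y\<in>S\<inter>U. (f has_derivative frechet_derivative h (at y)) (at y within S))"
    if "x \<in> S" for x
  proof -
    obtain U h where U: "open U" "x \<in> U" "\<And>k. Ck_on k U h" "\<And>y. y \<in> S \<Longrightarrow> y \<in> U \<Longrightarrow> h y = f y"
      using smooth_onE[OF assms(2) \<open>x \<in> S\<close>] by blast
    have "(f has_derivative frechet_derivative h (at y)) (at y within S)" if y: "y \<in> S \<inter> U" for y
    proof -
      have "(h has_derivative frechet_derivative h (at y)) (at y within S)"
        using Ck_on_SucE(1)[OF U(3)[of "Suc 0"], of y] y by (auto intro: has_derivative_at_withinI)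
      moreover have "eventually (\<lambda>z. h z = f z) (at y within S)"
        using U y by (auto simp: eventually_at_topological)
      ultimately show ?thesis
        using U(4) y by (metis Int_iff has_derivative_transform_eventually)
    qed
    then show ?thesis using U by blast
  qed
  show "(f has_derivative frechet_derivative f (at x within S)) (at x within S)" if "x \<in> S" for x
    using ext[OF that] that by (metis IntI differentiableI frechet_derivative_worksI)
  show "smooth_on S (\<lambda>x. frechet_derivative f (at x within S) v)"
  proof (rule smooth_onI)
    fix x assume "x \<in> S"
    then obtain U h where U: "open U" "x \<in> U" "\<And>k. Ck_on k U h"
      "\<And>y. y \<in> S \<inter> U \<Longrightarrow> (f has_derivative frechet_derivative h (at y)) (at y within S)"
      using ext[OF \<open>x \<in> S\<close>] by blast
    have "frechet_derivative h (at y) v = frechet_derivative f (at y within S) v"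
      if "y \<in> S \<inter> U" for y
      using frechet_derivative_halfspace[OF assms(1) _ U(4)[OF that]] that by simp
    then show "\<exists>U h. open U \<and> x \<in> U \<and> (\<forall>k. Ck_on k U h) \<and>
        (\<forall>y\<in>S \<inter> U. h y = frechet_derivative f (at y within S) v)"
      using U Ck_on_SucE(2)[OF U(3)] by blast
  qed
qed

section \<open>Integration by parts in Euclidean space\<close>

text \<open>By translation invariance of Lebesgue measure the difference quotients of \<open>f\<close> in the direction
  \<open>e\<close> have integral zero, and they converge to the derivative, dominated on a compact set.\<close>
lemma integral_partial_derivative_zero:
  fixes f :: "real^'n::finite \<Rightarrow> real"
  assumes "compact K" and zero: "\<And>x. x \<notin> K \<Longrightarrow> f x = 0"
    and der: "\<And>x. (f has_derivative f' x) (at x)"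
    and cont: "continuous_on UNIV (\<lambda>x. f' x e)"
  shows "(\<integral>x. f' x e \<partial>lborel) = 0"
proof -
  define h where "h n = 1 / real (Suc n)" for n
  have h: "0 < h n" "h n \<le> 1" for n by (auto simp: h_def field_simps)
  define G where "G n x = (f (x + h n *\<^sub>R e) - f x) / h n" for n x
  have contf: "continuous_on UNIV f"
    using der by (meson continuous_at_imp_continuous_on has_derivative_continuous)
  then have [measurable]: "f \<in> borel_measurable borel"
    by (rule borel_measurable_continuous_onI)
  have intf: "integrable lborel f"
  proof -
    have "integrable lborel (\<lambda>x. indicator K x *\<^sub>R f x)"
      by (rule borel_integrable_compact[OF assms(1)]) (use contf continuous_on_subset in auto)
    moreover have "(\<lambda>x. indicator K x *\<^sub>R f x) = f"
      using zero by (auto simp: fun_eq_iff indicator_def)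
    ultimately show ?thesis by simp
  qed
  have shift: "integrable lborel (\<lambda>x. f (x + c))" "(\<integral>x. f (x + c) \<partial>lborel) = (\<integral>x. f x \<partial>lborel)" for c
  proof -
    have d: "distr lborel borel (\<lambda>x. x + c) = lborel"
    proof -
      have "(\<lambda>x. x + c) = (+) c" by (auto simp: fun_eq_iff add.commute)
      then show ?thesis using lborel_distr_plus[of c] by simp
    qed
    have "integrable (distr lborel borel (\<lambda>x. x + c)) f" using intf d by simp
    then show "integrable lborel (\<lambda>x. f (x + c))" by (rule integrable_distr[rotated]) simp
    have "(\<integral>x. f x \<partial>(distr lborel borel (\<lambda>x. x + c))) = (\<integral>x. f (x + c) \<partial>lborel)"
      by (rule integral_distr) simp_all
    then show "(\<integral>x. f (x + c) \<partial>lborel) = (\<integral>x. f x \<partial>lborel)" using d by simp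
  qed
  have G0: "(\<integral>x. G n x \<partial>lborel) = 0" for n
    unfolding G_def by (simp add: shift intf)
  have line: "((\<lambda>t. f (x + t *\<^sub>R e)) has_real_derivative f' (x + t *\<^sub>R e) e) (at t)" for x t
  proof -
    have "((\<lambda>t. x + t *\<^sub>R e) has_derivative (\<lambda>s. s *\<^sub>R e)) (at t)"
      by (auto intro!: derivative_eq_intros)
    from has_derivative_compose[OF this der]
    have "((\<lambda>t. f (x + t *\<^sub>R e)) has_derivative (\<lambda>s. f' (x + t *\<^sub>R e) (s *\<^sub>R e))) (at t)" .
    moreover have "(\<lambda>s. f' (x + t *\<^sub>R e) (s *\<^sub>R e)) = (*) (f' (x + t *\<^sub>R e) e)"
      using linear_scale[OF has_derivative_linear[OF der]] by (auto simp: mult.commute)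
    ultimately show ?thesis by (simp add: has_field_derivative_def)
  qed
  have lim: "(\<lambda>n. G n x) \<longlonglongrightarrow> f' x e" for x
  proof -
    have "((\<lambda>t. (f (x + (0 + t) *\<^sub>R e) - f (x + 0 *\<^sub>R e)) / t) \<longlongrightarrow> f' (x + 0 *\<^sub>R e) e) (at 0)"
      using line[of x 0] unfolding DERIV_def .
    moreover have "h = (\<lambda>n. inverse (real (Suc n)))"
      by (simp add: h_def fun_eq_iff inverse_eq_divide)
    then have "filterlim h (at 0) sequentially"
      unfolding filterlim_at using LIMSEQ_inverse_real_of_nat
      by (auto intro!: always_eventually)
    ultimately show ?thesis unfolding G_def
      by (auto dest: filterlim_compose)
  qed
  have f'0: "f' x e = 0" if "x \<notin> K" for x
  proof -
    have "open (- K)" using assms(1) by (simp add: compact_imp_closed open_Compl)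
    then have "(f has_derivative (\<lambda>_. 0)) (at x)"
      by (intro has_derivative_transform_within_open[where f="\<lambda>_. 0" and s="- K" and g=f]) (use zero that in auto)
    then show ?thesis using has_derivative_unique[OF der] by metis
  qed
  obtain C where C: "\<And>x. \<bar>f' x e\<bar> \<le> C"
  proof -
    have "bounded ((\<lambda>x. f' x e) ` K)"
      by (intro compact_imp_bounded compact_continuous_image assms(1) continuous_on_subset[OF cont]) simp
    then obtain C where "\<And>x. x \<in> K \<Longrightarrow> \<bar>f' x e\<bar> \<le> C" by (auto simp: bounded_iff)
    then have "\<bar>f' x e\<bar> \<le> \<bar>C\<bar>" for x using f'0[of x] by (cases "x \<in> K") force+
    then show ?thesis by (rule that)
  qed
  \<comment> \<open>the points from which a step of length at most one in direction \<open>e\<close> can reach \<open>K\<close>\<close>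
  let ?K' = "(\<lambda>(x, t). x - t *\<^sub>R e) ` (K \<times> {0..1::real})"
  have K': "compact ?K'"
    by (intro compact_continuous_image compact_Times assms(1))
      (auto simp: case_prod_unfold intro!: continuous_intros)
  have bound: "norm (G n x) \<le> indicator ?K' x *\<^sub>R C" for n x
  proof (cases "x \<in> ?K'")
    case True
    have "\<exists>z>0. z < h n \<and> f (x + h n *\<^sub>R e) - f (x + 0 *\<^sub>R e) = (h n - 0) * f' (x + z *\<^sub>R e) e"
      by (rule MVT2) (use h line in auto)
    then obtain z where "f (x + h n *\<^sub>R e) - f x = h n * f' (x + z *\<^sub>R e) e" by auto
    then have "G n x = f' (x + z *\<^sub>R e) e" using h[of n] by (simp add: G_def)
    then show ?thesis using True C by simp
  next
    case False
    have "x + h n *\<^sub>R e \<notin> K"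
    proof
      assume "x + h n *\<^sub>R e \<in> K"
      then have "(\<lambda>(x, t). x - t *\<^sub>R e) (x + h n *\<^sub>R e, h n) \<in> ?K'"
        using h[of n] by (intro imageI) auto
      with False show False by simp
    qed
    moreover have "x \<notin> K"
    proof
      assume "x \<in> K"
      then have "(\<lambda>(x, t). x - t *\<^sub>R e) (x, 0) \<in> ?K'" by (intro imageI) auto
      with False show False by simp
    qed
    ultimately show ?thesis using False zero by (simp add: G_def)
  qed
  have dom: "integrable lborel (\<lambda>x. indicator ?K' x *\<^sub>R C)"
    by (rule borel_integrable_compact[OF K']) simp
  have "(\<lambda>n. \<integral>x. G n x \<partial>lborel) \<longlonglongrightarrow> (\<integral>x. f' x e \<partial>lborel)"
  proof (rule integral_dominated_convergence[OF _ _ dom])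
    show "(\<lambda>x. f' x e) \<in> borel_measurable lborel"
      using borel_measurable_continuous_onI[OF cont] by simp
    show "G n \<in> borel_measurable lborel" for n unfolding G_def by measurable
  qed (use lim bound in auto)
  then show ?thesis using G0 by (simp add: LIMSEQ_const_iff)
qed

text \<open>A function on an open set that vanishes off a compact subset extends by zero, and its derivative
  with it.\<close>
lemma integral_partial_derivative_zero_on:
  fixes f :: "real^'n::finite \<Rightarrow> real"
  assumes "open U" "compact K" "K \<subseteq> U" and zero: "\<And>x. x \<in> U \<Longrightarrow> x \<notin> K \<Longrightarrow> f x = 0"
    and der: "\<And>x. x \<in> U \<Longrightarrow> (f has_derivative f' x) (at x)"
    and cont: "continuous_on U (\<lambda>x. f' x e)"
  shows "integrable lborel (\<lambda>x. indicator U x * f' x e)"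
    and "(\<integral>x. indicator U x * f' x e \<partial>lborel) = 0"
proof -
  let ?f = "\<lambda>x. if x \<in> U then f x else 0"
  let ?f' = "\<lambda>x. if x \<in> U then f' x else (\<lambda>_. 0)"
  have cl: "open (- K)" using assms(2) by (simp add: compact_imp_closed open_Compl)
  have zero': "?f' x e = 0" if "x \<notin> K" for x
  proof (cases "x \<in> U")
    case True
    have "(f has_derivative (\<lambda>_. 0)) (at x)"
      by (intro has_derivative_transform_within_open[where f="\<lambda>_. 0" and s="U - K" and g=f])
        (use zero that True assms cl in \<open>auto simp: Diff_eq\<close>)
    then show ?thesis using has_derivative_unique[OF der[OF True]] True by metis
  qed auto
  have "(\<integral>x. ?f' x e \<partial>lborel) = 0"
  proof (rule integral_partial_derivative_zero[OF assms(2)])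
    show "?f x = 0" if "x \<notin> K" for x using zero that by auto
    show "(?f has_derivative ?f' x) (at x)" for x
    proof (cases "x \<in> U")
      case True
      then show ?thesis
        using has_derivative_transform_within_open[OF der assms(1)] by auto
    next
      case False
      then have "(?f has_derivative (\<lambda>_. 0)) (at x)"
        by (intro has_derivative_transform_within_open[where f="\<lambda>_. 0" and s="- K" and g="?f"])
          (use zero cl assms(3) in auto)
      then show ?thesis using False by simp
    qed
    have "continuous_on (U \<union> - K) (\<lambda>x. ?f' x e)"
    proof (rule continuous_on_open_Un[OF assms(1) cl])
      show "continuous_on U (\<lambda>x. ?f' x e)"
        using cont by (rule continuous_on_eq) auto
      show "continuous_on (- K) (\<lambda>x. ?f' x e)"
        using continuous_on_const[of "- K" 0] by (rule continuous_on_eq) (use zero' in auto)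
    qed
    moreover have "U \<union> - K = UNIV" using assms by auto
    ultimately show "continuous_on UNIV (\<lambda>x. ?f' x e)" by simp
  qed
  moreover have eq: "indicator U x * f' x e = ?f' x e" for x by (simp add: indicator_def)
  ultimately show "(\<integral>x. indicator U x * f' x e \<partial>lborel) = 0" by simp
  have "integrable lborel (\<lambda>x. indicator K x *\<^sub>R f' x e)"
    by (rule borel_integrable_compact[OF assms(2) continuous_on_subset[OF cont assms(3)]])
  moreover have "indicator U x * f' x e = indicator K x *\<^sub>R f' x e" for x
    using zero'[of x] assms(3) by (cases "x \<in> K"; cases "x \<in> U") auto
  ultimately show "integrable lborel (\<lambda>x. indicator U x * f' x e)" by (simp only:)
qed

section \<open>Change of variables\<close>

text \<open>Both integrals may be infinite. When one of them is finite, it is a gauge integral of a nonnegative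
  function, and the change of variables formula for those transports it to the other side.\<close>
lemma nn_integral_change_of_variables_wellorder:
  fixes f :: "real^'n::{finite,wellorder} \<Rightarrow> real" and g :: "real^'n::_ \<Rightarrow> real^'n::_"
  assumes "\<And>x. x \<in> S \<Longrightarrow> (g has_derivative g' x) (at x within S)"
      and "\<And>y. y \<in> T \<Longrightarrow> (h has_derivative h' y) (at y within T)"
      and f0: "\<And>y. y \<in> T \<Longrightarrow> 0 \<le> f y"
      and "\<And>x. x \<in> S \<Longrightarrow> g x \<in> T \<and> h (g x) = x"
      and "\<And>y. y \<in> T \<Longrightarrow> h y \<in> S \<and> g (h y) = y"
      and "\<And>y. y \<in> T \<Longrightarrow> h' y \<circ> g' (h y) = id"
      and k: "\<And>x. x \<in> S \<Longrightarrow> k x = \<bar>det (matrix (g' x))\<bar> * f (g x)"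
      and [measurable]: "(\<lambda>x. indicator S x * k x) \<in> borel_measurable borel"
        "(\<lambda>y. indicator T y * f y) \<in> borel_measurable borel"
  shows "(\<integral>\<^sup>+x. ennreal (k x) * indicator S x \<partial>lborel) = (\<integral>\<^sup>+y. ennreal (f y) * indicator T y \<partial>lborel)"
proof -
  have k0: "0 \<le> k x" if "x \<in> S" for x using k f0 assms(4) that by simp
  have "((\<lambda>x. \<bar>det (matrix (g' x))\<bar> * f (g x)) has_integral b) S \<longleftrightarrow> (f has_integral b) T" for b
    by (rule cov_invertible_nonneg_eq) (use assms in auto)
  moreover have "((\<lambda>x. \<bar>det (matrix (g' x))\<bar> * f (g x)) has_integral b) S \<longleftrightarrow> (k has_integral b) S" for b
    by (rule has_integral_cong) (use k in auto)
  ultimately have iff: "(k has_integral b) S \<longleftrightarrow> (f has_integral b) T" for b by simp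
  have to_has: "(f has_integral enn2real (\<integral>\<^sup>+y. ennreal (f y) * indicator T y \<partial>lborel)) T"
    if [measurable]: "(\<lambda>y. indicator T y * f y) \<in> borel_measurable borel" and f0: "\<And>y. y \<in> T \<Longrightarrow> 0 \<le> f y"
      and fin: "(\<integral>\<^sup>+y. ennreal (f y) * indicator T y \<partial>lborel) < \<infinity>"
    for f :: "real^'n::{finite,wellorder} \<Rightarrow> real" and T
  proof -
    let ?r = "enn2real (\<integral>\<^sup>+y. ennreal (f y) * indicator T y \<partial>lborel)"
    have eq: "(\<integral>\<^sup>+y. ennreal (indicator T y * f y) \<partial>lborel) = (\<integral>\<^sup>+y. ennreal (f y) * indicator T y \<partial>lborel)"
      by (rule nn_integral_cong) (auto simp: indicator_def)
    have "((\<lambda>y. indicator T y * f y) has_integral ?r) UNIV"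
    proof (rule nn_integral_has_integral)
      show "(\<integral>\<^sup>+y. ennreal (indicator T y * f y) \<partial>lborel) = ennreal ?r"
        unfolding eq using fin by simp
    qed (use f0 in \<open>auto simp: indicator_def intro: that(1)[unfolded indicator_def]\<close>)
    moreover have "(\<lambda>y. indicator T y * f y) = (\<lambda>y. if y \<in> T then f y else 0)"
      by (auto simp: fun_eq_iff)
    ultimately show ?thesis by (simp add: has_integral_restrict_UNIV)
  qed
  show ?thesis
  proof (cases "(\<integral>\<^sup>+y. ennreal (f y) * indicator T y \<partial>lborel) < \<infinity>")
    case True
    note * = to_has[OF assms(9) f0 True]
    with nn_integral_has_integral_lebesgue'[OF k0 iff[THEN iffD2, OF *]] True
    show ?thesis by simp
  next
    case False
    show ?thesis
    proof (cases "(\<integral>\<^sup>+x. ennreal (k x) * indicator S x \<partial>lborel) < \<infinity>")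
      case True
      note * = to_has[OF assms(8) k0 True]
      with nn_integral_has_integral_lebesgue'[OF f0 iff[THEN iffD1, OF *]] True
      show ?thesis by simp
    qed (use False in \<open>simp add: not_less top_unique\<close>)
  qed
qed

text \<open>The change of variables formula speaks of vectors with a well-ordered coordinate index, but it does
  not depend on the order. An arbitrary finite index type is copied to one that is ordered by an
  enumeration; relabelling the coordinates preserves Lebesgue measure and determinants, and carries
  the formula back.\<close>
datatype 'a ordered = Ordered (unordered: 'a)

lemma bij_Ordered: "bij Ordered"
  by (metis bijI' ordered.exhaust ordered.inject)

instance ordered :: (finite) finite
proof
  have "(UNIV :: 'a ordered set) = range Ordered"
    using bij_is_surj[OF bij_Ordered] by (rule sym)
  then show "finite (UNIV :: 'a ordered set)" by (metis finite finite_imageI)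
qed

instantiation ordered :: (finite) wellorder
begin

definition less_eq_ordered :: "'a ordered \<Rightarrow> 'a ordered \<Rightarrow> bool" where
  "less_eq_ordered x y \<longleftrightarrow> to_nat_on (UNIV :: 'a set) (unordered x) \<le> to_nat_on UNIV (unordered y)"

definition less_ordered :: "'a ordered \<Rightarrow> 'a ordered \<Rightarrow> bool" where
  "less_ordered x y \<longleftrightarrow> to_nat_on (UNIV :: 'a set) (unordered x) < to_nat_on UNIV (unordered y)"

instance
proof
  fix x y :: "'a ordered"
  have inj: "inj (to_nat_on (UNIV :: 'a set))"
    by (intro inj_on_to_nat_on countable_finite finite)
  show "x = y" if "x \<le> y" "y \<le> x"
    using that injD[OF inj] unfolding less_eq_ordered_def
    by (intro ordered.expand injD[OF inj]) (rule le_antisym)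
next
  fix P :: "'a ordered \<Rightarrow> bool" and a
  assume step: "\<And>x. (\<And>y. y < x \<Longrightarrow> P y) \<Longrightarrow> P x"
  show "P a"
    by (rule measure_induct_rule[of "\<lambda>x. to_nat_on UNIV (unordered x)" P], rule step)
      (simp only: less_ordered_def)
qed (auto simp: less_eq_ordered_def less_ordered_def)

end

lemma det_reindex_ordered:
  fixes M :: "real^'n::finite^'n"
  shows "det (\<chi> i j. M $ unordered i $ unordered j) = det M"
proof -
  have inv: "inv_into UNIV Ordered = unordered"
    by (metis bij_Ordered bij_is_inj inv_f_f ordered.exhaust_sel ext)
  have mp: "map_permutation UNIV Ordered p = Ordered \<circ> p \<circ> unordered" for p :: "'n \<Rightarrow> 'n"
    using bij_Ordered unfolding map_permutation_def inv
    by (simp add: restrict_id_def bij_is_surj[OF bij_Ordered] fun_eq_iff)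
  have sgn: "sign (Ordered \<circ> p \<circ> unordered) = sign p" if "p permutes UNIV" for p :: "'n \<Rightarrow> 'n"
    using sign_map_permutation[OF bij_is_inj[OF bij_Ordered] that] by (simp add: mp)
  have bijO: "bij (\<lambda>x. Ordered (p (unordered x)))" if "bij p" for p :: "'n \<Rightarrow> 'n"
  proof (rule bij_betw_byWitness[where f'="\<lambda>x. Ordered (inv p (unordered x))"])
  qed (use that in \<open>auto simp: bij_is_surj surj_f_inv_f bij_is_inj\<close>)
  have bijU: "bij (\<lambda>x. unordered (q (Ordered x)))" if "bij q" for q :: "'n ordered \<Rightarrow> 'n ordered"
  proof (rule bij_betw_byWitness[where f'="\<lambda>x. unordered (inv q (Ordered x))"])
  qed (use that in \<open>auto simp: bij_is_surj surj_f_inv_f bij_is_inj\<close>)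
  have perm: "q permutes UNIV \<longleftrightarrow> bij q" for q :: "'b \<Rightarrow> 'b"
    by (simp add: permutes_univ bij_iff)
  have prod: "(\<Prod>i\<in>UNIV. M $ unordered i $ p (unordered i)) = (\<Prod>i\<in>UNIV. M $ i $ p i)" for p
  proof -
    have "bij_betw unordered UNIV UNIV"
      by (rule bij_betwI[where g=Ordered]) auto
    then show ?thesis by (rule prod.reindex_bij_betw)
  qed
  have sgnU: "sign (\<lambda>x. unordered (q (Ordered x))) = sign q" if "bij q" for q :: "'n ordered \<Rightarrow> 'n ordered"
    using sgn[of "\<lambda>x. unordered (q (Ordered x))"] bijU[OF that] by (simp add: perm o_def)
  have prodU: "(\<Prod>i\<in>UNIV. M $ i $ unordered (q (Ordered i))) = (\<Prod>i\<in>UNIV. M $ unordered i $ unordered (q i))" for q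
    using prod[of "\<lambda>x. unordered (q (Ordered x))"] by simp
  show ?thesis
    unfolding det_def
    by (rule sum.reindex_bij_witness[of _ "\<lambda>p. Ordered \<circ> p \<circ> unordered" "\<lambda>q. unordered \<circ> q \<circ> Ordered"])
      (auto simp: perm bijO bijU sgnU prodU fun_eq_iff o_def)
qed

definition unorder_vec :: "real^'n::finite ordered \<Rightarrow> real^'n" where
  "unorder_vec x = (\<chi> i. x $ Ordered i)"

definition order_vec :: "real^'n::finite \<Rightarrow> real^'n ordered" where
  "order_vec y = (\<chi> j. y $ unordered j)"

lemma order_unorder_vec [simp]: "order_vec (unorder_vec x) = x" "unorder_vec (order_vec y) = y"
  by (simp_all add: unorder_vec_def order_vec_def vec_eq_iff)

lemma bounded_linear_unorder_vec: "bounded_linear unorder_vec"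
  by (simp add: linear_conv_bounded_linear[symmetric] linear_iff unorder_vec_def vec_eq_iff)

lemma bounded_linear_order_vec: "bounded_linear order_vec"
  by (simp add: linear_conv_bounded_linear[symmetric] linear_iff order_vec_def vec_eq_iff)

lemma prod_Basis_cart:
  "(\<Prod>b\<in>Basis. F ((v :: real^'n::finite) \<bullet> b)) = (\<Prod>i\<in>UNIV. F (v $ i))"
proof -
  have 1: "(Basis :: (real^'n) set) = (\<lambda>i. axis i 1) ` UNIV"
    by (auto simp: Basis_vec_def)
  have 2: "inj (\<lambda>i::'n. axis i (1::real))"
    by (simp add: inj_def axis_eq_axis)
  show ?thesis unfolding 1 prod.reindex[OF 2] by (simp add: inner_axis)
qed

text \<open>Lebesgue measure is determined by the volumes of boxes, and relabelling the coordinates only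
  permutes the factors of these volumes.\<close>
lemma distr_unorder_vec: "distr lborel borel unorder_vec = (lborel :: (real^'n::finite) measure)"
proof (rule lborel_eqI[symmetric])
  have "(unorder_vec :: real^'n ordered \<Rightarrow> real^'n) \<in> borel \<rightarrow>\<^sub>M borel"
    by (intro borel_measurable_continuous_onI linear_continuous_on bounded_linear_unorder_vec)
  then have meas: "(unorder_vec :: real^'n ordered \<Rightarrow> real^'n) \<in> lborel \<rightarrow>\<^sub>M borel" by simp
  fix l u :: "real^'n"
  assume le: "\<And>b. b \<in> Basis \<Longrightarrow> l \<bullet> b \<le> u \<bullet> b"
  then have le': "l $ i \<le> u $ i" for i
    using le[of "axis i 1"] by (simp add: inner_axis axis_in_Basis_iff)
  have "unorder_vec -` box l u = box (order_vec l) (order_vec u)"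
    by (auto simp: mem_box_cart unorder_vec_def order_vec_def) (metis ordered.sel ordered.exhaust)+
  then have "emeasure (distr lborel borel unorder_vec) (box l u) =
      emeasure lborel (box (order_vec l) (order_vec u))"
    by (subst emeasure_distr[OF meas]) simp_all
  also have "\<dots> = (\<Prod>b\<in>Basis. (order_vec u - order_vec l) \<bullet> b)"
    by (rule emeasure_lborel_box) (auto simp: Basis_vec_def inner_axis order_vec_def le')
  also have "\<dots> = (\<Prod>j\<in>UNIV. (u - l) $ unordered j)"
    by (subst prod_Basis_cart[where F="\<lambda>x. x"]) (simp add: order_vec_def)
  also have "(\<Prod>j\<in>UNIV. (u - l) $ unordered j) = (\<Prod>i\<in>UNIV. (u - l) $ i)"
  proof -
    have "bij_betw unordered UNIV UNIV" by (rule bij_betwI[where g=Ordered]) auto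
    then show ?thesis by (rule prod.reindex_bij_betw)
  qed
  also have "\<dots> = (\<Prod>b\<in>Basis. (u - l) \<bullet> b)"
    by (simp add: prod_Basis_cart[where F="\<lambda>x. x"])
  finally show "emeasure (distr lborel borel unorder_vec) (box l u) = (\<Prod>b\<in>Basis. (u - l) \<bullet> b)" .
qed simp

lemma matrix_unorder_conjugate:
  "matrix (\<lambda>v. order_vec (L (unorder_vec v))) = (\<chi> i j. matrix L $ unordered i $ unordered j)"
proof -
  have "unorder_vec (axis j 1) = axis (unordered j) 1" for j :: "'a ordered"
    by (cases j) (auto simp: unorder_vec_def axis_def vec_eq_iff)
  then show ?thesis unfolding matrix_def order_vec_def by simp
qed

lemma nn_integral_change_of_variables:
  fixes f :: "real^'n::finite \<Rightarrow> real" and g :: "real^'n \<Rightarrow> real^'n"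
  assumes g: "\<And>x. x \<in> S \<Longrightarrow> (g has_derivative g' x) (at x within S)"
      and h: "\<And>y. y \<in> T \<Longrightarrow> (h has_derivative h' y) (at y within T)"
      and f0: "\<And>y. y \<in> T \<Longrightarrow> 0 \<le> f y"
      and gT: "\<And>x. x \<in> S \<Longrightarrow> g x \<in> T \<and> h (g x) = x"
      and hS: "\<And>y. y \<in> T \<Longrightarrow> h y \<in> S \<and> g (h y) = y"
      and id: "\<And>y. y \<in> T \<Longrightarrow> h' y \<circ> g' (h y) = id"
      and k: "\<And>x. x \<in> S \<Longrightarrow> k x = \<bar>det (matrix (g' x))\<bar> * f (g x)"
      and km [measurable]: "(\<lambda>x. indicator S x * k x) \<in> borel_measurable borel"
      and fm [measurable]: "(\<lambda>y. indicator T y * f y) \<in> borel_measurable borel"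
  shows "(\<integral>\<^sup>+x. ennreal (k x) * indicator S x \<partial>lborel) = (\<integral>\<^sup>+y. ennreal (f y) * indicator T y \<partial>lborel)"
proof -
  let ?u = "unorder_vec :: real^'n ordered \<Rightarrow> real^'n" and ?o = "order_vec :: real^'n \<Rightarrow> real^'n ordered"
  have um [measurable]: "?u \<in> borel_measurable borel"
    by (intro borel_measurable_continuous_onI linear_continuous_on bounded_linear_unorder_vec)
  have conj: "((\<lambda>x. ?o (p (?u x))) has_derivative (\<lambda>v. ?o (p' (?u x) (?u v)))) (at x within ?u -` X)"
    if "\<And>x. x \<in> X \<Longrightarrow> (p has_derivative p' x) (at x within X)" "x \<in> ?u -` X" for p p' X x
  proof -
    have "(p has_derivative p' (?u x)) (at (?u x) within ?u ` (?u -` X))"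
      by (rule has_derivative_subset[OF that(1)]) (use that(2) in auto)
    then have "((\<lambda>x. p (?u x)) has_derivative (\<lambda>v. p' (?u x) (?u v))) (at x within ?u -` X)"
      by (rule has_derivative_in_compose
          [OF bounded_linear_imp_has_derivative[OF bounded_linear_unorder_vec]])
    then show ?thesis by (rule bounded_linear.has_derivative[OF bounded_linear_order_vec])
  qed
  have pull: "(\<integral>\<^sup>+x. ennreal (q (?u x)) * indicator (?u -` X) x \<partial>lborel)
      = (\<integral>\<^sup>+y. ennreal (q y) * indicator X y \<partial>lborel)"
    if [measurable]: "(\<lambda>x. indicator X x * q x) \<in> borel_measurable borel" for q X
  proof -
    have "(\<lambda>y. ennreal (q y) * indicator X y) = (\<lambda>y. ennreal (indicator X y * q y))"
      by (auto simp: fun_eq_iff indicator_def)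
    then have [measurable]: "(\<lambda>y. ennreal (q y) * indicator X y) \<in> borel_measurable borel" by simp
    have "(\<integral>\<^sup>+y. ennreal (q y) * indicator X y \<partial>(distr lborel borel ?u))
      = (\<integral>\<^sup>+x. ennreal (q (?u x)) * indicator X (?u x) \<partial>lborel)"
      by (rule nn_integral_distr) simp_all
    then show ?thesis unfolding distr_unorder_vec by (simp add: indicator_def)
  qed
  have "(\<integral>\<^sup>+x. ennreal (k (?u x)) * indicator (?u -` S) x \<partial>lborel)
      = (\<integral>\<^sup>+x. ennreal (f (?u x)) * indicator (?u -` T) x \<partial>lborel)"
  proof (rule nn_integral_change_of_variables_wellorder[OF conj[OF g] conj[OF h]])
    show "(\<lambda>v. ?o (h' (?u y) (?u v))) \<circ> (\<lambda>v. ?o (g' (?u (?o (h (?u y)))) (?u v))) = id"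
      if "y \<in> ?u -` T" for y
      using id[of "?u y"] that by (auto simp: fun_eq_iff)
    show "k (?u x) = \<bar>det (matrix (\<lambda>v. ?o (g' (?u x) (?u v))))\<bar> * f (?u (?o (g (?u x))))"
      if "x \<in> ?u -` S" for x
      using k[of "?u x"] that by (simp add: matrix_unorder_conjugate det_reindex_ordered)
    have "(\<lambda>x. indicator S (?u x) * k (?u x)) \<in> borel_measurable borel"
      using measurable_compose[OF um km] by simp
    then show "(\<lambda>x. indicator (?u -` S) x * k (?u x)) \<in> borel_measurable borel"
      by (simp add: indicator_def)
    have "(\<lambda>x. indicator T (?u x) * f (?u x)) \<in> borel_measurable borel"
      using measurable_compose[OF um fm] by simp
    then show "(\<lambda>x. indicator (?u -` T) x * f (?u x)) \<in> borel_measurable borel"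
      by (simp add: indicator_def)
  qed (use f0 gT hS in auto)
  then show ?thesis using pull[OF km] pull[OF fm] by simp
qed

section \<open>Positive definite matrices\<close>

text \<open>The segment from the identity to \<open>G\<close> consists of positive definite, hence invertible, matrices;
  along it the determinant starts at \<open>1\<close> and cannot change sign.\<close>
lemma det_pos_of_pos_def:
  fixes G :: "real^'n::finite^'n"
  assumes "\<And>\<xi>. \<xi> \<noteq> 0 \<Longrightarrow> 0 < \<xi> \<bullet> (G *v \<xi>)"
  shows "0 < det G"
proof -
  let ?f = "\<lambda>t::real. det ((1 - t) *\<^sub>R mat 1 + t *\<^sub>R G)"
  have nz: "?f t \<noteq> 0" if t: "0 \<le> t" "t \<le> 1" for t
  proof -
    let ?M = "(1 - t) *\<^sub>R mat 1 + t *\<^sub>R G"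
    have "\<xi> = 0" if "?M *v \<xi> = 0" for \<xi>
    proof (rule ccontr)
      assume "\<xi> \<noteq> 0"
      have "0 = \<xi> \<bullet> (?M *v \<xi>)" using that by simp
      also have "\<dots> = (1 - t) * (\<xi> \<bullet> \<xi>) + t * (\<xi> \<bullet> (G *v \<xi>))"
        by (simp add: matrix_vector_mult_add_rdistrib scaleR_matrix_vector_assoc[symmetric] inner_add_right)
      also have "\<dots> > 0"
      proof (cases "t = 0")
        case False
        then have "0 < t * (\<xi> \<bullet> (G *v \<xi>))" using t assms[OF \<open>\<xi> \<noteq> 0\<close>] by simp
        moreover have "0 \<le> (1 - t) * (\<xi> \<bullet> \<xi>)" using t by simp
        ultimately show ?thesis by linarith
      qed (use \<open>\<xi> \<noteq> 0\<close> in simp)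
      finally show False by simp
    qed
    then have "invertible ?M"
      using matrix_left_invertible_ker[of ?M] invertible_left_inverse by blast
    then show ?thesis using invertible_det_nz by blast
  qed
  have cont: "continuous_on {0..1} ?f"
    unfolding det_def by (intro continuous_intros)
  have "0 < ?f 1"
  proof (rule ccontr)
    assume "\<not> 0 < ?f 1"
    moreover have "?f 0 = 1" by simp
    ultimately have "\<exists>t. 0 \<le> t \<and> t \<le> 1 \<and> ?f t = 0"
      by (intro IVT2') (use cont in auto)
    then show False using nz by blast
  qed
  then show ?thesis by simp
qed

lemma smooth_on_det:
  fixes M :: "real^'n::finite \<Rightarrow> real^'k::finite^'k"
  assumes "\<And>i j. smooth_on S (\<lambda>x. M x $ i $ j)"
  shows "smooth_on S (\<lambda>x. det (M x))"
  unfolding det_def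
  by (intro smooth_on_sum smooth_on_mult smooth_on_const smooth_on_prod assms)

section \<open>Charts, transition maps and the boundary\<close>

locale smooth_manifold =
  fixes A :: "('m::{t2_space, second_countable_topology}, 'n::finite) chart set"
  assumes atlas: "smooth_atlas A"
begin

lemma chart_open: "\<alpha> \<in> A \<Longrightarrow> open (chart_dom \<alpha>)"
  and chart_img_openin: "\<alpha> \<in> A \<Longrightarrow> openin (top_of_set halfspace) (chart_img \<alpha>)"
  and chart_homeomorphism:
    "\<alpha> \<in> A \<Longrightarrow> homeomorphism (chart_dom \<alpha>) (chart_img \<alpha>) (coords \<alpha>) (chart_inv \<alpha>)"
  using atlas unfolding smooth_atlas_def is_chart_def by auto

lemma chart_inv_coords [simp]: "\<alpha> \<in> A \<Longrightarrow> p \<in> chart_dom \<alpha> \<Longrightarrow> chart_inv \<alpha> (coords \<alpha> p) = p"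
  using homeomorphism_apply1[OF chart_homeomorphism] .

lemma coords_chart_inv [simp]: "\<alpha> \<in> A \<Longrightarrow> x \<in> chart_img \<alpha> \<Longrightarrow> coords \<alpha> (chart_inv \<alpha> x) = x"
  using homeomorphism_apply2[OF chart_homeomorphism] .

lemma chart_inv_in [simp]: "\<alpha> \<in> A \<Longrightarrow> x \<in> chart_img \<alpha> \<Longrightarrow> chart_inv \<alpha> x \<in> chart_dom \<alpha>"
  by auto

lemma chart_at: "chart_at A p \<in> A" "p \<in> chart_dom (chart_at A p)"
proof -
  have "p \<in> (\<Union>\<alpha>\<in>A. chart_dom \<alpha>)" using atlas unfolding smooth_atlas_def by simp
  then have "\<exists>\<alpha>. \<alpha> \<in> A \<and> p \<in> chart_dom \<alpha>" by blast
  then have "chart_at A p \<in> A \<and> p \<in> chart_dom (chart_at A p)"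
    unfolding chart_at_def by (rule someI_ex)
  then show "chart_at A p \<in> A" "p \<in> chart_dom (chart_at A p)" by auto
qed

lemma chart_cases:
  obtains \<alpha> where "\<alpha> \<in> A" "p \<in> chart_dom \<alpha>"
  using chart_at by blast

lemma chart_inv_continuous: "\<alpha> \<in> A \<Longrightarrow> continuous_on (chart_img \<alpha>) (chart_inv \<alpha>)"
  and coords_continuous: "\<alpha> \<in> A \<Longrightarrow> continuous_on (chart_dom \<alpha>) (coords \<alpha>)"
  using chart_homeomorphism homeomorphism_cont2 homeomorphism_cont1 by blast+

lemma coords_image_eq:
  "\<alpha> \<in> A \<Longrightarrow> coords \<alpha> ` (chart_dom \<alpha> \<inter> W) = chart_img \<alpha> \<inter> chart_inv \<alpha> -` W"
proof (intro set_eqI iffI)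
  fix x assume "\<alpha> \<in> A" "x \<in> chart_img \<alpha> \<inter> chart_inv \<alpha> -` W"
  then show "x \<in> coords \<alpha> ` (chart_dom \<alpha> \<inter> W)"
    by (intro image_eqI[of _ _ "chart_inv \<alpha> x"]) auto
qed auto

lemma coords_image_openin:
  assumes "\<alpha> \<in> A" "open W"
  shows "openin (top_of_set halfspace) (coords \<alpha> ` (chart_dom \<alpha> \<inter> W))"
  unfolding coords_image_eq[OF assms(1)]
  using continuous_openin_preimage_gen[OF chart_inv_continuous[OF assms(1)] assms(2)]
    chart_img_openin[OF assms(1)] openin_trans by blast

lemma coords_in_halfspace: "\<alpha> \<in> A \<Longrightarrow> x \<in> chart_img \<alpha> \<Longrightarrow> 0 \<le> x $ bcoord"
  using subsetD[OF openin_imp_subset[OF chart_img_openin]] by (simp add: halfspace_def)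

lemma chart_preimage_open:
  assumes "\<alpha> \<in> A" "open W"
  shows "open {p \<in> chart_dom \<alpha>. coords \<alpha> p \<in> W}"
  using continuous_open_preimage[OF coords_continuous[OF assms(1)] chart_open[OF assms(1)] assms(2)]
  by (simp add: Int_def vimage_def)

lemma transition_smooth:
  "\<alpha> \<in> A \<Longrightarrow> \<beta> \<in> A \<Longrightarrow> smooth_on (coords \<alpha> ` (chart_dom \<alpha> \<inter> chart_dom \<beta>)) (transition \<alpha> \<beta>)"
  using atlas unfolding smooth_atlas_def by blast

lemma transition_coords: "\<alpha> \<in> A \<Longrightarrow> p \<in> chart_dom \<alpha> \<Longrightarrow> transition \<alpha> \<beta> (coords \<alpha> p) = coords \<beta> p"
  by (simp add: transition_def)

text \<open>The definition of \<open>transition_deriv\<close> differentiates within the overlap of the two charts; by locality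
  every relatively open set around the point serves as well, for instance the whole image of the chart.\<close>
lemma transition_has_derivative:
  assumes "\<alpha> \<in> A" "\<beta> \<in> A" "p \<in> chart_dom \<alpha>" "p \<in> chart_dom \<beta>"
    and "openin (top_of_set halfspace) T" "coords \<alpha> p \<in> T"
  shows "(transition \<alpha> \<beta> has_derivative transition_deriv \<alpha> \<beta> p) (at (coords \<alpha> p) within T)"
proof -
  let ?S = "coords \<alpha> ` (chart_dom \<alpha> \<inter> chart_dom \<beta>)"
  have S: "openin (top_of_set halfspace) ?S" "coords \<alpha> p \<in> ?S"
    using coords_image_openin[OF assms(1) chart_open[OF assms(2)]] assms by auto
  show ?thesis
    using frechet_derivative_halfspace_cong[OF S assms(5,6), of "transition \<alpha> \<beta>"]
      smooth_on_has_derivative(1)[OF S(1) transition_smooth[OF assms(1,2)] S(2)]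
    unfolding transition_deriv_def by simp
qed

lemma transition_deriv_linear:
  assumes "\<alpha> \<in> A" "\<beta> \<in> A" "p \<in> chart_dom \<alpha>" "p \<in> chart_dom \<beta>"
  shows "linear (transition_deriv \<alpha> \<beta> p)"
  using has_derivative_linear[OF transition_has_derivative[OF assms chart_img_openin[OF assms(1)]]]
    assms by auto

text \<open>The chain rule for the passage from chart \<open>\<beta>\<close> to chart \<open>\<alpha>\<close>. Taken with \<open>f\<close> a coordinate map, it
  is the cocycle identity of the transition derivatives; with \<open>f\<close> real-valued, it shows
  that \<open>df\<close> does not depend on the chart.\<close>
lemma chart_change_derivative:
  assumes "\<alpha> \<in> A" "\<beta> \<in> A" "p \<in> chart_dom \<alpha>" "p \<in> chart_dom \<beta>"
    and "((\<lambda>x. f (chart_inv \<beta> x)) has_derivative D) (at (coords \<beta> p) within chart_img \<beta>)"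
  shows "((\<lambda>x. f (chart_inv \<alpha> x)) has_derivative (\<lambda>\<xi>. D (transition_deriv \<alpha> \<beta> p \<xi>)))
           (at (coords \<alpha> p) within chart_img \<alpha>)"
proof -
  let ?S = "coords \<alpha> ` (chart_dom \<alpha> \<inter> chart_dom \<beta>)"
  have S: "openin (top_of_set halfspace) ?S" "coords \<alpha> p \<in> ?S"
    using coords_image_openin[OF assms(1) chart_open[OF assms(2)]] assms by auto
  have "transition \<alpha> \<beta> ` ?S \<subseteq> chart_img \<beta>"
    using assms(1) by (auto simp: transition_coords)
  then have "((\<lambda>x. f (chart_inv \<beta> x)) has_derivative D)
      (at (transition \<alpha> \<beta> (coords \<alpha> p)) within transition \<alpha> \<beta> ` ?S)"
    using assms by (auto simp: transition_coords intro: has_derivative_subset)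
  from has_derivative_in_compose[OF transition_has_derivative[OF assms(1-4) S] this]
  have "((\<lambda>x. f (chart_inv \<beta> (transition \<alpha> \<beta> x))) has_derivative
      (\<lambda>\<xi>. D (transition_deriv \<alpha> \<beta> p \<xi>))) (at (coords \<alpha> p) within ?S)" .
  then show ?thesis
  proof (rule frechet_derivative_halfspace_cong[OF S chart_img_openin[OF assms(1)] imageI[OF assms(3)]])
    show "f (chart_inv \<alpha> y) = f (chart_inv \<beta> (transition \<alpha> \<beta> y))" if "y \<in> ?S" for y
      using that assms(1,2) by (auto simp: transition_def)
  qed
qed

lemma transition_deriv_compose:
  assumes "\<alpha> \<in> A" "\<beta> \<in> A" "\<gamma> \<in> A" "p \<in> chart_dom \<alpha>" "p \<in> chart_dom \<beta>" "p \<in> chart_dom \<gamma>"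
  shows "transition_deriv \<beta> \<gamma> p (transition_deriv \<alpha> \<beta> p \<xi>) = transition_deriv \<alpha> \<gamma> p \<xi>"
proof -
  have img: "coords \<alpha> p \<in> chart_img \<alpha>" "coords \<beta> p \<in> chart_img \<beta>" using assms by auto
  note 1 = transition_has_derivative[OF assms(2,3,5,6) chart_img_openin[OF assms(2)] img(2)]
  note 2 = transition_has_derivative[OF assms(1,3,4,6) chart_img_openin[OF assms(1)] img(1)]
  have "(\<lambda>\<xi>. transition_deriv \<beta> \<gamma> p (transition_deriv \<alpha> \<beta> p \<xi>)) = transition_deriv \<alpha> \<gamma> p"
    using chart_change_derivative[OF assms(1,2,4,5), of "coords \<gamma>"] 1 2
    by (intro halfspace_derivative_unique[OF chart_img_openin[OF assms(1)] img(1)])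
      (auto simp: transition_def)
  then show ?thesis by (rule fun_cong)
qed

lemma transition_deriv_self:
  assumes "\<alpha> \<in> A" "p \<in> chart_dom \<alpha>"
  shows "transition_deriv \<alpha> \<alpha> p \<xi> = \<xi>"
proof -
  have img: "coords \<alpha> p \<in> chart_img \<alpha>" using assms by auto
  have "((\<lambda>x. x) has_derivative (\<lambda>\<xi>. \<xi>)) (at (coords \<alpha> p) within chart_img \<alpha>)" by simp
  then have "(transition \<alpha> \<alpha> has_derivative (\<lambda>\<xi>. \<xi>)) (at (coords \<alpha> p) within chart_img \<alpha>)"
    by (rule has_derivative_transform[OF img, rotated])
      (use assms in \<open>auto simp: transition_def\<close>)
  from halfspace_derivative_unique[OF chart_img_openin[OF assms(1)] img this
      transition_has_derivative[OF assms(1,1,2,2) chart_img_openin[OF assms(1)] img]]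
  show ?thesis by metis
qed

lemma transition_deriv_inverse:
  assumes "\<alpha> \<in> A" "\<beta> \<in> A" "p \<in> chart_dom \<alpha>" "p \<in> chart_dom \<beta>"
  shows "transition_deriv \<beta> \<alpha> p (transition_deriv \<alpha> \<beta> p \<xi>) = \<xi>"
  using transition_deriv_compose[OF assms(1,2,1,3,4,3)] transition_deriv_self[OF assms(1,3)] by simp

text \<open>If a chart took an interior point to the boundary hyperplane, then the normal coordinate of the
  transition map would have a minimum there, so its derivative would not be onto.\<close>
lemma boundary_chart_independent:
  assumes "\<alpha> \<in> A" "\<beta> \<in> A" "p \<in> chart_dom \<alpha>" "p \<in> chart_dom \<beta>" "coords \<beta> p $ bcoord = 0"
  shows "coords \<alpha> p $ bcoord = 0"
proof (rule ccontr)
  assume "coords \<alpha> p $ bcoord \<noteq> 0"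
  then have pos: "0 < coords \<alpha> p $ bcoord"
    using coords_in_halfspace[OF assms(1), of "coords \<alpha> p"] assms by auto
  let ?S = "coords \<alpha> ` (chart_dom \<alpha> \<inter> chart_dom \<beta>)"
  have S: "openin (top_of_set halfspace) ?S" "coords \<alpha> p \<in> ?S"
    using coords_image_openin[OF assms(1) chart_open[OF assms(2)]] assms by auto
  let ?f = "\<lambda>x. transition \<alpha> \<beta> x $ bcoord"
  have "(?f has_derivative (\<lambda>\<xi>. transition_deriv \<alpha> \<beta> p \<xi> $ bcoord)) (at (coords \<alpha> p))"
    using bounded_linear.has_derivative[OF bounded_linear_vec_nth
      transition_has_derivative[OF assms(1-4) S]] at_within_halfspace_interior[OF S pos] by simp
  then have "(\<lambda>\<xi>. transition_deriv \<alpha> \<beta> p \<xi> $ bcoord) = (\<lambda>_. 0)"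
  proof (rule differential_zero_maxmin[rotated 2])
    show "coords \<alpha> p \<in> ?S \<inter> {x. 0 < x $ bcoord}" using S pos by auto
    show "open (?S \<inter> {x. 0 < x $ bcoord})" by (rule openin_halfspace_interior[OF S(1)])
    have "?f (coords \<alpha> p) \<le> ?f y" if "y \<in> ?S" for y
      using that assms coords_in_halfspace[OF assms(2)] by (auto simp: transition_coords)
    then show "(\<forall>y\<in>?S \<inter> {x. 0 < x $ bcoord}. ?f y \<le> ?f (coords \<alpha> p)) \<or>
        (\<forall>y\<in>?S \<inter> {x. 0 < x $ bcoord}. ?f (coords \<alpha> p) \<le> ?f y)" by auto
  qed
  then have "transition_deriv \<alpha> \<beta> p (transition_deriv \<beta> \<alpha> p (axis bcoord 1)) $ bcoord = 0"
    by metis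
  then show False using transition_deriv_inverse[OF assms(2,1,4,3)] by simp
qed

lemma mboundary_iff:
  assumes "\<alpha> \<in> A" "p \<in> chart_dom \<alpha>"
  shows "p \<in> mboundary A \<longleftrightarrow> coords \<alpha> p $ bcoord = 0"
  using assms boundary_chart_independent unfolding mboundary_def by blast

section \<open>Tangent vectors\<close>

lemma tangent_spaceD:
  assumes "v \<in> tangent_space A p" "\<alpha> \<in> A" "\<beta> \<in> A" "p \<in> chart_dom \<alpha>" "p \<in> chart_dom \<beta>"
  shows "v \<beta> = transition_deriv \<alpha> \<beta> p (v \<alpha>)"
  using assms unfolding tangent_space_def by blast

lemma coord_vector_self [simp]:
  "\<alpha> \<in> A \<Longrightarrow> p \<in> chart_dom \<alpha> \<Longrightarrow> coord_vector A \<alpha> p \<xi> \<alpha> = \<xi>"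
  by (simp add: coord_vector_def transition_deriv_self)

lemma coord_vector_in_tangent_space:
  "\<alpha> \<in> A \<Longrightarrow> p \<in> chart_dom \<alpha> \<Longrightarrow> coord_vector A \<alpha> p \<xi> \<in> tangent_space A p"
  by (auto simp: tangent_space_def coord_vector_def transition_deriv_compose)

lemma tangent_eq_coord_vector:
  assumes "\<alpha> \<in> A" "p \<in> chart_dom \<alpha>" "v \<in> tangent_space A p"
  shows "v = coord_vector A \<alpha> p (v \<alpha>)"
proof
  fix \<beta>
  show "v \<beta> = coord_vector A \<alpha> p (v \<alpha>) \<beta>"
  proof (cases "\<beta> \<in> A \<and> p \<in> chart_dom \<beta>")
    case True
    then have "v \<beta> = transition_deriv \<alpha> \<beta> p (v \<alpha>)"
      using tangent_spaceD[OF assms(3,1)] assms(2) by blast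
    with True show ?thesis by (simp add: coord_vector_def)
  next
    case False
    then have "v \<beta> = 0" using assms(3) unfolding tangent_space_def by blast
    with False show ?thesis by (auto simp: coord_vector_def)
  qed
qed

lemma tangent_eqI:
  assumes "\<alpha> \<in> A" "p \<in> chart_dom \<alpha>" "u \<in> tangent_space A p" "v \<in> tangent_space A p" "u \<alpha> = v \<alpha>"
  shows "u = v"
  using tangent_eq_coord_vector[OF assms(1,2,3)] tangent_eq_coord_vector[OF assms(1,2,4)] assms(5) by simp

lemma tangent_space_lincomb:
  assumes "u \<in> tangent_space A p" "v \<in> tangent_space A p"
  shows "(\<lambda>\<alpha>. a *\<^sub>R u \<alpha> + b *\<^sub>R v \<alpha>) \<in> tangent_space A p"
  unfolding tangent_space_def
proof (intro CollectI conjI ballI impI allI)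
  fix \<alpha> \<beta> assume *: "\<alpha> \<in> A" "\<beta> \<in> A" "p \<in> chart_dom \<alpha> \<inter> chart_dom \<beta>"
  then have uv: "u \<beta> = transition_deriv \<alpha> \<beta> p (u \<alpha>)" "v \<beta> = transition_deriv \<alpha> \<beta> p (v \<alpha>)"
    using tangent_spaceD assms by blast+
  have lin: "linear (transition_deriv \<alpha> \<beta> p)" using transition_deriv_linear * by auto
  show "a *\<^sub>R u \<beta> + b *\<^sub>R v \<beta> = transition_deriv \<alpha> \<beta> p (a *\<^sub>R u \<alpha> + b *\<^sub>R v \<alpha>)"
    by (simp only: uv linear_add[OF lin] linear_scale[OF lin])
next
  fix \<alpha> assume "\<alpha> \<notin> A \<or> p \<notin> chart_dom \<alpha>"
  then have "u \<alpha> = 0" "v \<alpha> = 0" using assms unfolding tangent_space_def by blast+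
  then show "a *\<^sub>R u \<alpha> + b *\<^sub>R v \<alpha> = 0" by simp
qed

lemma zero_tangent: "(\<lambda>_. 0) \<in> tangent_space A p"
proof -
  have "coord_vector A (chart_at A p) p 0 \<in> tangent_space A p"
    by (rule coord_vector_in_tangent_space[OF chart_at])
  from tangent_space_lincomb[OF this this, where a=0 and b=0] show ?thesis by simp
qed

lemma tangent_space_scale: "u \<in> tangent_space A p \<Longrightarrow> (\<lambda>\<alpha>. a *\<^sub>R u \<alpha>) \<in> tangent_space A p"
  using tangent_space_lincomb[where u=u and v=u and a=a and b=0] by simp

lemma coord_vector_lincomb:
  assumes "\<alpha> \<in> A" "p \<in> chart_dom \<alpha>"
  shows "coord_vector A \<alpha> p (a *\<^sub>R \<xi> + b *\<^sub>R \<eta>) =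
    (\<lambda>\<beta>. a *\<^sub>R coord_vector A \<alpha> p \<xi> \<beta> + b *\<^sub>R coord_vector A \<alpha> p \<eta> \<beta>)"
  by (rule tangent_eqI[OF assms])
    (use assms in \<open>auto intro: coord_vector_in_tangent_space tangent_space_lincomb\<close>)

section \<open>Smooth functions and vector fields\<close>

lemma smooth_functionsD: "f \<in> smooth_functions A \<Longrightarrow> \<alpha> \<in> A \<Longrightarrow> smooth_on (chart_img \<alpha>) (\<lambda>x. f (chart_inv \<alpha> x))"
  by (simp add: smooth_functions_def)

lemma smooth_functionsI:
  "(\<And>\<alpha>. \<alpha> \<in> A \<Longrightarrow> smooth_on (chart_img \<alpha>) (\<lambda>x. f (chart_inv \<alpha> x))) \<Longrightarrow> f \<in> smooth_functions A"
  by (simp add: smooth_functions_def)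

lemma smooth_functions_mult:
  "f \<in> smooth_functions A \<Longrightarrow> h \<in> smooth_functions A \<Longrightarrow> (\<lambda>p. f p * h p) \<in> smooth_functions A"
  by (rule smooth_functionsI, rule smooth_on_mult) (rule smooth_functionsD; assumption)+

lemma smooth_functions_add:
  "f \<in> smooth_functions A \<Longrightarrow> h \<in> smooth_functions A \<Longrightarrow> (\<lambda>p. f p + h p) \<in> smooth_functions A"
  by (rule smooth_functionsI, rule smooth_on_add) (rule smooth_functionsD; assumption)+

lemma smooth_functions_const: "(\<lambda>_. a) \<in> smooth_functions A"
  by (intro smooth_functionsI smooth_on_const)

lemma continuous_on_charts:
  assumes "\<And>\<alpha>. \<alpha> \<in> A \<Longrightarrow> continuous_on (chart_img \<alpha>) (\<lambda>x. f (chart_inv \<alpha> x))"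
  shows "continuous_on UNIV f"
proof -
  have "continuous_on (\<Union>\<alpha>\<in>A. chart_dom \<alpha>) f"
  proof (rule continuous_on_open_UN)
    fix \<alpha> assume "\<alpha> \<in> A"
    then show "open (chart_dom \<alpha>)" by (rule chart_open)
    have "continuous_on (chart_dom \<alpha>) (\<lambda>p. f (chart_inv \<alpha> (coords \<alpha> p)))"
      by (rule continuous_on_compose2[OF assms[OF \<open>\<alpha> \<in> A\<close>] coords_continuous[OF \<open>\<alpha> \<in> A\<close>]]) auto
    then show "continuous_on (chart_dom \<alpha>) f"
      by (rule continuous_on_eq) (use \<open>\<alpha> \<in> A\<close> in auto)
  qed
  then show ?thesis using atlas unfolding smooth_atlas_def by simp
qed

lemma smooth_functions_continuous: "f \<in> smooth_functions A \<Longrightarrow> continuous_on UNIV f"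
  by (intro continuous_on_charts smooth_on_continuous_on smooth_functionsD)

lemma smooth_function_has_derivative:
  assumes "f \<in> smooth_functions A" "\<alpha> \<in> A" "p \<in> chart_dom \<alpha>"
  shows "((\<lambda>x. f (chart_inv \<alpha> x)) has_derivative
      frechet_derivative (\<lambda>x. f (chart_inv \<alpha> x)) (at (coords \<alpha> p) within chart_img \<alpha>))
      (at (coords \<alpha> p) within chart_img \<alpha>)"
  by (rule smooth_on_has_derivative(1)[OF chart_img_openin smooth_functionsD]) (use assms in auto)

lemma dir_deriv_chart:
  assumes "f \<in> smooth_functions A" "\<alpha> \<in> A" "p \<in> chart_dom \<alpha>" "v \<in> tangent_space A p"
  shows "dir_deriv A f p v =
    frechet_derivative (\<lambda>x. f (chart_inv \<alpha> x)) (at (coords \<alpha> p) within chart_img \<alpha>) (v \<alpha>)"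
proof -
  let ?\<beta> = "chart_at A p"
  let ?D = "\<lambda>\<alpha>. frechet_derivative (\<lambda>x. f (chart_inv \<alpha> x)) (at (coords \<alpha> p) within chart_img \<alpha>)"
  have "(\<lambda>\<xi>. ?D \<alpha> (transition_deriv ?\<beta> \<alpha> p \<xi>)) = ?D ?\<beta>"
    by (rule halfspace_derivative_unique[OF chart_img_openin _
        chart_change_derivative[OF chart_at(1) assms(2) chart_at(2) assms(3)
          smooth_function_has_derivative[OF assms(1-3)]]
        smooth_function_has_derivative[OF assms(1) chart_at]])
      (use chart_at in auto)
  then have "?D ?\<beta> (v ?\<beta>) = ?D \<alpha> (transition_deriv ?\<beta> \<alpha> p (v ?\<beta>))" by metis
  also have "transition_deriv ?\<beta> \<alpha> p (v ?\<beta>) = v \<alpha>"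
    using tangent_spaceD[OF assms(4) chart_at(1) assms(2) chart_at(2) assms(3)] by simp
  finally show ?thesis by (simp add: dir_deriv_def Let_def)
qed

lemma dir_deriv_lincomb:
  assumes "f \<in> smooth_functions A" "u \<in> tangent_space A p" "v \<in> tangent_space A p"
  shows "dir_deriv A f p (\<lambda>\<alpha>. a *\<^sub>R u \<alpha> + b *\<^sub>R v \<alpha>) = a * dir_deriv A f p u + b * dir_deriv A f p v"
proof -
  have "linear (frechet_derivative (\<lambda>x. f (chart_inv (chart_at A p) x))
      (at (coords (chart_at A p) p) within chart_img (chart_at A p)))"
    using has_derivative_linear[OF smooth_function_has_derivative[OF assms(1) chart_at]] .
  then show ?thesis by (simp add: dir_deriv_def Let_def linear_add linear_scale)
qed

lemma dir_deriv_scale: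
  assumes "f \<in> smooth_functions A" "u \<in> tangent_space A p"
  shows "dir_deriv A f p (\<lambda>\<alpha>. a *\<^sub>R u \<alpha>) = a * dir_deriv A f p u" "dir_deriv A f p (\<lambda>_. 0) = 0"
  using dir_deriv_lincomb[OF assms(1,2,2), where a=a and b=0]
    dir_deriv_lincomb[OF assms(1,2,2), where a=0 and b=0] by simp_all

lemma vector_fieldsD:
  assumes "w \<in> vector_fields A"
  shows "w p \<in> tangent_space A p"
    "\<alpha> \<in> A \<Longrightarrow> smooth_on (chart_img \<alpha>) (\<lambda>x. w (chart_inv \<alpha> x) \<alpha>)"
  using assms by (auto simp: vector_fields_def)

lemma vector_fields_lincomb:
  assumes "u \<in> vector_fields A" "w \<in> vector_fields A"
  shows "(\<lambda>p \<alpha>. a *\<^sub>R u p \<alpha> + b *\<^sub>R w p \<alpha>) \<in> vector_fields A"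
  using assms unfolding vector_fields_def
  by (auto intro!: tangent_space_lincomb smooth_on_add smooth_on_scaleR[OF smooth_on_const])

lemma scale_field_vector_fields:
  assumes "f \<in> smooth_functions A" "w \<in> vector_fields A"
  shows "scale_field f w \<in> vector_fields A"
  using assms unfolding vector_fields_def scale_field_def
  by (auto intro!: tangent_space_scale smooth_on_scaleR smooth_functionsD)

lemma dir_deriv_smooth:
  assumes "f \<in> smooth_functions A" "w \<in> vector_fields A"
  shows "(\<lambda>p. dir_deriv A f p (w p)) \<in> smooth_functions A"
proof (rule smooth_functionsI)
  fix \<alpha> assume \<alpha>: "\<alpha> \<in> A"
  let ?D = "\<lambda>x. frechet_derivative (\<lambda>x. f (chart_inv \<alpha> x)) (at x within chart_img \<alpha>)"
  have "smooth_on (chart_img \<alpha>) (\<lambda>x. \<Sum>i\<in>UNIV. w (chart_inv \<alpha> x) \<alpha> $ i *\<^sub>R ?D x (axis i 1))"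
    by (intro smooth_on_sum smooth_on_scaleR smooth_on_nth vector_fieldsD assms \<alpha>
      smooth_on_has_derivative(2)[OF chart_img_openin] smooth_functionsD)
  then show "smooth_on (chart_img \<alpha>) (\<lambda>x. dir_deriv A f (chart_inv \<alpha> x) (w (chart_inv \<alpha> x)))"
  proof (rule smooth_on_cong[rotated])
    fix x assume x: "x \<in> chart_img \<alpha>"
    have lin: "linear (?D x)"
      using has_derivative_linear[OF smooth_on_has_derivative(1)[OF chart_img_openin
        smooth_functionsD[OF assms(1)] x]] \<alpha> by blast
    have "dir_deriv A f (chart_inv \<alpha> x) (w (chart_inv \<alpha> x)) = ?D x (w (chart_inv \<alpha> x) \<alpha>)"
      using dir_deriv_chart[OF assms(1) \<alpha> chart_inv_in[OF \<alpha> x] vector_fieldsD(1)[OF assms(2)]] x \<alpha>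
      by simp
    then show "(\<Sum>i\<in>UNIV. w (chart_inv \<alpha> x) \<alpha> $ i *\<^sub>R ?D x (axis i 1)) =
        dir_deriv A f (chart_inv \<alpha> x) (w (chart_inv \<alpha> x))"
      using linear_axis_expansion[OF lin] by metis
  qed
qed

end

section \<open>Gluing measures\<close>

text \<open>Measures on an open cover that agree on overlaps glue to a unique measure: a countable
  subcover is made disjoint, and the pieces are summed.\<close>
lemma measure_gluing:
  fixes U :: "'i \<Rightarrow> 'm::topological_space set" and N :: "'i \<Rightarrow> 'm measure" and s :: "nat \<Rightarrow> 'i"
  assumes s: "\<And>n. s n \<in> A" and cover: "(\<Union>n. U (s n)) = UNIV"
    and U: "\<And>i. i \<in> A \<Longrightarrow> U i \<in> sets borel" and N: "\<And>i. i \<in> A \<Longrightarrow> sets (N i) = sets borel"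
    and agree: "\<And>i j B. i \<in> A \<Longrightarrow> j \<in> A \<Longrightarrow> B \<in> sets borel \<Longrightarrow> B \<subseteq> U i \<Longrightarrow> B \<subseteq> U j \<Longrightarrow>
      emeasure (N i) B = emeasure (N j) B"
  shows "\<exists>!V. sets V = sets borel \<and> (\<forall>i\<in>A. \<forall>B\<in>sets borel. B \<subseteq> U i \<longrightarrow> emeasure V B = emeasure (N i) B)"
proof -
  define D where "D = disjointed (\<lambda>n. U (s n))"
  have D: "D n \<in> sets borel" "D n \<subseteq> U (s n)" "disjoint_family D" "(\<Union>n. D n) = UNIV" for n
  proof -
    have "range D \<subseteq> sets borel"
      unfolding D_def by (rule sets.range_disjointed_sets) (use U s in auto)
    then show "D n \<in> sets borel" by auto
    show "D n \<subseteq> U (s n)" unfolding D_def by (rule disjointed_subset)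
    show "disjoint_family D" unfolding D_def by (rule disjoint_family_disjointed)
    show "(\<Union>n. D n) = UNIV" unfolding D_def UN_disjointed_eq by (rule cover)
  qed
  have split: "emeasure M B = (\<Sum>n. emeasure M (B \<inter> D n))" if "sets M = sets borel" "B \<in> sets borel" for M B
  proof -
    have "(\<Sum>n. emeasure M (B \<inter> D n)) = emeasure M (\<Union>n. B \<inter> D n)"
    proof (rule suminf_emeasure)
      show "disjoint_family (\<lambda>n. B \<inter> D n)" using D(3) unfolding disjoint_family_on_def by blast
    qed (use that D(1) in auto)
    also have "(\<Union>n. B \<inter> D n) = B" using D(4) by blast
    finally show ?thesis by simp
  qed
  define V where "V = measure_of UNIV (sets borel) (\<lambda>B. \<Sum>n. emeasure (N (s n)) (B \<inter> D n))"
  have setsV: "sets V = sets borel"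
    unfolding V_def using sets.sets_measure_of_eq[of "borel :: 'm measure"] by simp
  have emV: "emeasure V B = (\<Sum>n. emeasure (N (s n)) (B \<inter> D n))" if B: "B \<in> sets borel" for B
  proof (rule emeasure_measure_of[OF V_def])
    show "countably_additive (sets V) (\<lambda>B. \<Sum>n. emeasure (N (s n)) (B \<inter> D n))"
      unfolding countably_additive_def setsV
    proof (intro allI impI)
      fix F :: "nat \<Rightarrow> 'm set"
      assume F: "range F \<subseteq> sets borel" "disjoint_family F"
      have "(\<Sum>i. \<Sum>n. emeasure (N (s n)) (F i \<inter> D n)) = (\<Sum>n. \<Sum>i. emeasure (N (s n)) (F i \<inter> D n))"
        using nn_integral_suminf[of "\<lambda>i n. emeasure (N (s n)) (F i \<inter> D n)" "count_space UNIV"]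
        by (simp add: nn_integral_count_space_nat)
      moreover have "(\<Sum>i. emeasure (N (s n)) (F i \<inter> D n)) = emeasure (N (s n)) ((\<Union>i. F i) \<inter> D n)" for n
      proof -
        have "disjoint_family (\<lambda>i. F i \<inter> D n)" using F(2) unfolding disjoint_family_on_def by blast
        then have "(\<Sum>i. emeasure (N (s n)) (F i \<inter> D n)) = emeasure (N (s n)) (\<Union>i. F i \<inter> D n)"
          by (intro suminf_emeasure) (use F(1) D(1) N[OF s] in auto)
        then show ?thesis by simp
      qed
      ultimately show "(\<Sum>i. \<Sum>n. emeasure (N (s n)) (F i \<inter> D n)) =
          (\<Sum>n. emeasure (N (s n)) ((\<Union>i. F i) \<inter> D n))" by simp
    qed
  qed (use B setsV in \<open>auto simp: positive_def\<close>)
  show ?thesis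
  proof (rule ex1I[of _ V], intro conjI ballI impI setsV)
    fix i B assume i: "i \<in> A" and B: "B \<in> sets borel" "B \<subseteq> U i"
    have "emeasure V B = (\<Sum>n. emeasure (N i) (B \<inter> D n))"
      unfolding emV[OF B(1)]
      by (rule suminf_cong, rule agree) (use i B s D(1) D(2) in blast)+
    then show "emeasure V B = emeasure (N i) B"
      using split[OF N[OF i] B(1)] by simp
  next
    fix V' assume V': "sets V' = sets borel \<and>
      (\<forall>i\<in>A. \<forall>B\<in>sets borel. B \<subseteq> U i \<longrightarrow> emeasure V' B = emeasure (N i) B)"
    show "V' = V"
    proof (rule measure_eqI)
      show "sets V' = sets V" using V' setsV by simp
      fix B assume "B \<in> sets V'"
      then have B: "B \<in> sets borel" using V' by simp
      have "emeasure V' (B \<inter> D n) = emeasure (N (s n)) (B \<inter> D n)" for n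
      proof -
        have "B \<inter> D n \<in> sets borel" "B \<inter> D n \<subseteq> U (s n)"
          using B D(1)[of n] D(2)[of n] by auto
        then show ?thesis using V' s by blast
      qed
      then show "emeasure V' B = emeasure V B"
        using split[of V' B] V' B emV[OF B] by simp
    qed
  qed
qed

section \<open>The metric in coordinates\<close>

locale riemannian_manifold = smooth_manifold A
  for A :: "('m::{t2_space, second_countable_topology}, 'n::finite) chart set" +
  fixes g :: "('m, 'n) metric"
  assumes metric: "riemannian_metric A g"
begin

lemma metric_sym: "u \<in> tangent_space A p \<Longrightarrow> v \<in> tangent_space A p \<Longrightarrow> g p u v = g p v u"
  using metric unfolding riemannian_metric_def by blast

lemma metric_lincomb_left:
  assumes "u \<in> tangent_space A p" "v \<in> tangent_space A p" "w \<in> tangent_space A p"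
  shows "g p (\<lambda>\<alpha>. a *\<^sub>R u \<alpha> + b *\<^sub>R v \<alpha>) w = a * g p u w + b * g p v w"
  using metric assms unfolding riemannian_metric_def by blast

lemma metric_lincomb_right:
  assumes "u \<in> tangent_space A p" "v \<in> tangent_space A p" "w \<in> tangent_space A p"
  shows "g p w (\<lambda>\<alpha>. a *\<^sub>R u \<alpha> + b *\<^sub>R v \<alpha>) = a * g p w u + b * g p w v"
  using metric_lincomb_left[OF assms] metric_sym[OF assms(3)] assms tangent_space_lincomb by simp

lemma metric_scale:
  assumes "u \<in> tangent_space A p" "w \<in> tangent_space A p"
  shows "g p (\<lambda>\<alpha>. a *\<^sub>R u \<alpha>) w = a * g p u w" "g p w (\<lambda>\<alpha>. a *\<^sub>R u \<alpha>) = a * g p w u"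
  using metric_lincomb_left[OF assms(1,1,2), where a=a and b=0]
    metric_lincomb_right[OF assms(1,1,2), where a=a and b=0] by simp_all

lemma metric_zero:
  assumes "w \<in> tangent_space A p"
  shows "g p (\<lambda>_. 0) w = 0" "g p w (\<lambda>_. 0) = 0"
  using metric_scale[OF assms assms, where a=0] by simp_all

lemma metric_pos: "u \<in> tangent_space A p \<Longrightarrow> u \<noteq> (\<lambda>_. 0) \<Longrightarrow> 0 < g p u u"
  using metric unfolding riemannian_metric_def by blast

lemma metric_coords:
  assumes "\<alpha> \<in> A" "p \<in> chart_dom \<alpha>" "u \<in> tangent_space A p" "v \<in> tangent_space A p"
  shows "g p u v = u \<alpha> \<bullet> (metric_matrix A g \<alpha> p *v v \<alpha>)"
proof -
  let ?E = "coord_vector A \<alpha> p"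
  note E = coord_vector_in_tangent_space[OF assms(1,2)]
  have lin1: "linear (\<lambda>\<xi>. g p (?E \<xi>) w)" if "w \<in> tangent_space A p" for w
    using metric_lincomb_left[OF E E that, of 1 _ 1] coord_vector_lincomb[OF assms(1,2), of 1 _ 1]
      metric_lincomb_left[OF E E that, of _ _ 0] coord_vector_lincomb[OF assms(1,2), of _ _ 0]
    by (intro linearI) simp_all
  have lin2: "linear (\<lambda>\<xi>. g p w (?E \<xi>))" if "w \<in> tangent_space A p" for w
    using lin1[OF that] metric_sym[OF that E] by simp
  have expand2: "g p w (?E \<eta>) = (\<Sum>j\<in>UNIV. \<eta> $ j * g p w (?E (axis j 1)))"
    if "w \<in> tangent_space A p" for w \<eta>
    using linear_axis_expansion[OF lin2[OF that], of \<eta>] by (simp only: real_scaleR_def)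
  have "g p u v = g p (?E (u \<alpha>)) (?E (v \<alpha>))"
    using tangent_eq_coord_vector[OF assms(1,2)] assms(3,4) by metis
  also have "\<dots> = (\<Sum>i\<in>UNIV. u \<alpha> $ i * g p (?E (axis i 1)) (?E (v \<alpha>)))"
    using linear_axis_expansion[OF lin1[OF E], of "u \<alpha>" "v \<alpha>"] by (simp only: real_scaleR_def)
  also have "\<dots> = (\<Sum>i\<in>UNIV. u \<alpha> $ i * (\<Sum>j\<in>UNIV. v \<alpha> $ j * g p (?E (axis i 1)) (?E (axis j 1))))"
    by (intro sum.cong refl arg_cong2[where f="(*)"] expand2 E)
  finally show ?thesis
    by (simp add: inner_vec_def matrix_vector_mult_def metric_matrix_def mult.commute)
qed

lemma metric_matrix_pos:
  assumes "\<alpha> \<in> A" "p \<in> chart_dom \<alpha>" "\<xi> \<noteq> 0"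
  shows "0 < \<xi> \<bullet> (metric_matrix A g \<alpha> p *v \<xi>)"
proof -
  let ?E = "coord_vector A \<alpha> p \<xi>"
  have "?E \<noteq> (\<lambda>_. 0)" using coord_vector_self[OF assms(1,2), of \<xi>] assms(3) by metis
  then show ?thesis
    using metric_pos[OF coord_vector_in_tangent_space[OF assms(1,2)]]
      metric_coords[OF assms(1,2), of ?E ?E] coord_vector_in_tangent_space[OF assms(1,2)]
      coord_vector_self[OF assms(1,2)] by metis
qed

lemma metric_matrix_det_pos: "\<alpha> \<in> A \<Longrightarrow> p \<in> chart_dom \<alpha> \<Longrightarrow> 0 < det (metric_matrix A g \<alpha> p)"
  by (intro det_pos_of_pos_def metric_matrix_pos)

lemma volume_density_pos: "\<alpha> \<in> A \<Longrightarrow> p \<in> chart_dom \<alpha> \<Longrightarrow> 0 < volume_density A g \<alpha> p"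
  by (simp add: volume_density_def metric_matrix_det_pos)

lemma metric_matrix_change:
  assumes "\<alpha> \<in> A" "\<beta> \<in> A" "p \<in> chart_dom \<alpha>" "p \<in> chart_dom \<beta>"
  defines "J \<equiv> matrix (transition_deriv \<alpha> \<beta> p)"
  shows "metric_matrix A g \<alpha> p = transpose J ** metric_matrix A g \<beta> p ** J"
proof -
  have J: "J *v \<xi> = transition_deriv \<alpha> \<beta> p \<xi>" for \<xi>
    unfolding J_def
    by (rule matrix_works) (use transition_deriv_linear[OF assms(1-4)] in \<open>simp add: linear_matrix_vector_mul_eq\<close>)
  have eq: "\<xi> \<bullet> (metric_matrix A g \<alpha> p *v \<eta>) = \<xi> \<bullet> ((transpose J ** metric_matrix A g \<beta> p ** J) *v \<eta>)" for \<xi> \<eta>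
  proof -
    let ?E = "coord_vector A \<alpha> p"
    note E = coord_vector_in_tangent_space[OF assms(1,3)]
    have "\<xi> \<bullet> (metric_matrix A g \<alpha> p *v \<eta>) = g p (?E \<xi>) (?E \<eta>)"
      using metric_coords[OF assms(1,3) E E] assms by simp
    also have "\<dots> = (J *v \<xi>) \<bullet> (metric_matrix A g \<beta> p *v (J *v \<eta>))"
      using metric_coords[OF assms(2,4) E E] assms(2,4) by (simp add: coord_vector_def J)
    also have "\<dots> = \<xi> \<bullet> (transpose J *v (metric_matrix A g \<beta> p *v (J *v \<eta>)))"
      by (simp add: transpose_matrix_vector inner_commute[of \<xi>] dot_lmul_matrix inner_commute[of "J *v \<xi>"])
    finally show ?thesis by (simp add: matrix_vector_mul_assoc matrix_mul_assoc)
  qed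
  have "metric_matrix A g \<alpha> p *v \<eta> = (transpose J ** metric_matrix A g \<beta> p ** J) *v \<eta>" for \<eta>
    by (rule vector_eq_ldot[THEN iffD1]) (rule allI, rule eq)
  then show ?thesis by (simp add: matrix_eq)
qed

lemma volume_density_change:
  assumes "\<alpha> \<in> A" "\<beta> \<in> A" "p \<in> chart_dom \<alpha>" "p \<in> chart_dom \<beta>"
  shows "volume_density A g \<alpha> p = \<bar>det (matrix (transition_deriv \<alpha> \<beta> p))\<bar> * volume_density A g \<beta> p"
proof -
  let ?d = "det (matrix (transition_deriv \<alpha> \<beta> p))"
  have "det (metric_matrix A g \<alpha> p) = ?d\<^sup>2 * det (metric_matrix A g \<beta> p)"
    unfolding metric_matrix_change[OF assms] by (simp add: det_mul det_transpose power2_eq_square)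
  then show ?thesis by (simp add: volume_density_def real_sqrt_mult)
qed

lemma metric_matrix_smooth:
  "\<alpha> \<in> A \<Longrightarrow> smooth_on (chart_img \<alpha>) (\<lambda>x. metric_matrix A g \<alpha> (chart_inv \<alpha> x) $ i $ j)"
  using metric unfolding riemannian_metric_def by blast

lemma volume_density_smooth:
  assumes "\<alpha> \<in> A"
  shows "smooth_on (chart_img \<alpha>) (\<lambda>x. volume_density A g \<alpha> (chart_inv \<alpha> x))"
    "smooth_on (chart_img \<alpha>) (\<lambda>x. 1 / volume_density A g \<alpha> (chart_inv \<alpha> x))"
proof -
  let ?d = "\<lambda>x. det (metric_matrix A g \<alpha> (chart_inv \<alpha> x))"
  have pos: "0 < ?d x" if "x \<in> chart_img \<alpha>" for x
    using metric_matrix_det_pos[OF assms chart_inv_in[OF assms that]] .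
  have sm: "smooth_on (chart_img \<alpha>) (\<lambda>x. ?d x powr a)" for a
    by (intro smooth_on_powr smooth_on_det metric_matrix_smooth assms pos)
  show "smooth_on (chart_img \<alpha>) (\<lambda>x. volume_density A g \<alpha> (chart_inv \<alpha> x))"
    by (rule smooth_on_cong[OF _ sm[of "1/2"]])
      (use pos in \<open>auto simp: volume_density_def powr_half_sqrt less_imp_le\<close>)
  show "smooth_on (chart_img \<alpha>) (\<lambda>x. 1 / volume_density A g \<alpha> (chart_inv \<alpha> x))"
    by (rule smooth_on_cong[OF _ sm[of "- (1/2)"]])
      (use pos in \<open>auto simp: volume_density_def powr_half_sqrt powr_minus_divide less_imp_le\<close>)
qed

lemma metric_smooth:
  assumes "u \<in> vector_fields A" "w \<in> vector_fields A"
  shows "(\<lambda>p. g p (u p) (w p)) \<in> smooth_functions A"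
proof (rule smooth_functionsI)
  fix \<alpha> assume \<alpha>: "\<alpha> \<in> A"
  have "smooth_on (chart_img \<alpha>) (\<lambda>x. \<Sum>i\<in>UNIV. u (chart_inv \<alpha> x) \<alpha> $ i *
      (\<Sum>j\<in>UNIV. metric_matrix A g \<alpha> (chart_inv \<alpha> x) $ i $ j * w (chart_inv \<alpha> x) \<alpha> $ j))"
    by (intro smooth_on_sum smooth_on_mult smooth_on_nth vector_fieldsD assms \<alpha> metric_matrix_smooth)
  then show "smooth_on (chart_img \<alpha>) (\<lambda>x. g (chart_inv \<alpha> x) (u (chart_inv \<alpha> x)) (w (chart_inv \<alpha> x)))"
    by (rule smooth_on_cong[rotated])
      (simp add: metric_coords[OF \<alpha>] vector_fieldsD[OF assms(1)] vector_fieldsD[OF assms(2)] \<alpha>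
        inner_vec_def matrix_vector_mult_def)
qed

section \<open>The volume measure\<close>

definition density_on :: "('m, 'n) chart \<Rightarrow> real^'n \<Rightarrow> real" where
  "density_on \<alpha> x = (if x \<in> chart_img \<alpha> then volume_density A g \<alpha> (chart_inv \<alpha> x) else 0)"

text \<open>The value off the image of the chart only serves to make the map total and Borel measurable; the
  density vanishes there.\<close>
definition param :: "('m, 'n) chart \<Rightarrow> real^'n \<Rightarrow> 'm" where
  "param \<alpha> x = (if x \<in> chart_img \<alpha> then chart_inv \<alpha> x else undefined)"

definition chart_measure :: "('m, 'n) chart \<Rightarrow> 'm measure" where
  "chart_measure \<alpha> = distr (density lborel (\<lambda>x. ennreal (density_on \<alpha> x))) borel (param \<alpha>)"

lemma chart_img_borel: "\<alpha> \<in> A \<Longrightarrow> chart_img \<alpha> \<in> sets borel"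
proof -
  assume "\<alpha> \<in> A"
  then obtain U where "open U" "chart_img \<alpha> = halfspace \<inter> U"
    using chart_img_openin[of \<alpha>] by (auto simp: openin_open)
  moreover have "closed (halfspace :: (real^'n) set)"
    unfolding halfspace_def by (intro closed_Collect_le continuous_intros)
  ultimately show ?thesis by auto
qed

lemma param_measurable: "\<alpha> \<in> A \<Longrightarrow> param \<alpha> \<in> borel_measurable borel"
  unfolding param_def[abs_def]
  by (intro borel_measurable_continuous_on_if chart_img_borel chart_inv_continuous) auto

lemma density_on_measurable: "\<alpha> \<in> A \<Longrightarrow> density_on \<alpha> \<in> borel_measurable borel"
  unfolding density_on_def[abs_def]
  by (intro borel_measurable_continuous_on_if chart_img_borel continuous_on_const
      smooth_on_continuous_on[OF volume_density_smooth(1)])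

lemma density_on_nonneg: "\<alpha> \<in> A \<Longrightarrow> 0 \<le> density_on \<alpha> x"
  using volume_density_pos[OF _ chart_inv_in] by (auto simp: density_on_def less_imp_le)

lemma coords_image_borel:
  assumes "\<alpha> \<in> A" "B \<in> sets borel" "B \<subseteq> chart_dom \<alpha>"
  shows "coords \<alpha> ` B \<in> sets borel"
proof -
  have "coords \<alpha> ` B = chart_img \<alpha> \<inter> param \<alpha> -` B"
    using coords_image_eq[OF assms(1), of B] assms(3)
    by (auto simp: param_def Int_absorb1)
  moreover have "param \<alpha> -` B \<in> sets borel"
    using measurable_sets[OF param_measurable[OF assms(1)] assms(2)] by simp
  ultimately show ?thesis using chart_img_borel[OF assms(1)] by auto
qed

lemma emeasure_chart_measure:
  assumes "\<alpha> \<in> A" "B \<in> sets borel"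
  shows "emeasure (chart_measure \<alpha>) B =
    (\<integral>\<^sup>+x. ennreal (density_on \<alpha> x) * indicator B (param \<alpha> x) \<partial>lborel)"
proof -
  note [measurable] = param_measurable[OF assms(1)] density_on_measurable[OF assms(1)]
  have B: "param \<alpha> -` B \<in> sets borel"
    using measurable_sets[OF param_measurable[OF assms(1)] assms(2)] by simp
  have "emeasure (chart_measure \<alpha>) B =
      emeasure (density lborel (\<lambda>x. ennreal (density_on \<alpha> x))) (param \<alpha> -` B)"
    unfolding chart_measure_def by (subst emeasure_distr) (use assms in auto)
  also have "\<dots> = (\<integral>\<^sup>+x. ennreal (density_on \<alpha> x) * indicator (param \<alpha> -` B) x \<partial>lborel)"
    by (subst emeasure_density) (use B in auto)
  finally show ?thesis by (simp add: indicator_def)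
qed

lemma emeasure_chart_measure_eq:
  assumes "\<alpha> \<in> A" "B \<in> sets borel" "B \<subseteq> chart_dom \<alpha>"
  shows "emeasure (chart_measure \<alpha>) B =
    (\<integral>\<^sup>+ x\<in>coords \<alpha> ` B. ennreal (volume_density A g \<alpha> (chart_inv \<alpha> x)) \<partial>lborel)"
  unfolding emeasure_chart_measure[OF assms(1,2)]
proof (rule nn_integral_cong)
  fix x :: "real^'n"
  have "x \<in> coords \<alpha> ` B \<longleftrightarrow> x \<in> chart_img \<alpha> \<and> chart_inv \<alpha> x \<in> B"
    using coords_image_eq[OF assms(1), of B] assms(3) by (auto simp: Int_absorb1)
  then show "ennreal (density_on \<alpha> x) * indicator B (param \<alpha> x) =
      ennreal (volume_density A g \<alpha> (chart_inv \<alpha> x)) * indicator (coords \<alpha> ` B) x"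
    by (auto simp: density_on_def param_def indicator_def)
qed

text \<open>The change of variables formula for the transition map, whose Jacobian determinant is the ratio of
  the two densities. All derivatives are taken within the set that is transformed, so the
  formula covers boundary points.\<close>
lemma chart_measure_agree:
  assumes "\<alpha> \<in> A" "\<beta> \<in> A" "B \<in> sets borel" "B \<subseteq> chart_dom \<alpha>" "B \<subseteq> chart_dom \<beta>"
  shows "emeasure (chart_measure \<alpha>) B = emeasure (chart_measure \<beta>) B"
  unfolding emeasure_chart_measure_eq[OF assms(1,3,4)] emeasure_chart_measure_eq[OF assms(2,3,5)]
proof (rule nn_integral_change_of_variables)
  have der: "(transition \<alpha> \<beta> has_derivative transition_deriv \<alpha> \<beta> (chart_inv \<alpha> x)) (at x within coords \<alpha> ` B)"
    if "\<alpha> \<in> A" "\<beta> \<in> A" "B \<subseteq> chart_dom \<alpha>" "B \<subseteq> chart_dom \<beta>" and x: "x \<in> coords \<alpha> ` B" for \<alpha> \<beta> x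
  proof -
    obtain p where p: "p \<in> B" "x = coords \<alpha> p" using x by blast
    have "(transition \<alpha> \<beta> has_derivative transition_deriv \<alpha> \<beta> p) (at (coords \<alpha> p) within chart_img \<alpha>)"
      by (rule transition_has_derivative[OF that(1,2) _ _ chart_img_openin]) (use that p in auto)
    then have "(transition \<alpha> \<beta> has_derivative transition_deriv \<alpha> \<beta> p) (at (coords \<alpha> p) within coords \<alpha> ` B)"
      by (rule has_derivative_subset) (use that in auto)
    moreover have "chart_inv \<alpha> x = p" using that p by auto
    ultimately show ?thesis using p by simp
  qed
  show "(transition \<alpha> \<beta> has_derivative transition_deriv \<alpha> \<beta> (chart_inv \<alpha> x)) (at x within coords \<alpha> ` B)"
    if "x \<in> coords \<alpha> ` B" for x by (rule der) (use assms that in auto)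
  show "(transition \<beta> \<alpha> has_derivative transition_deriv \<beta> \<alpha> (chart_inv \<beta> y)) (at y within coords \<beta> ` B)"
    if "y \<in> coords \<beta> ` B" for y by (rule der) (use assms that in auto)
  show "0 \<le> volume_density A g \<beta> (chart_inv \<beta> y)" if y: "y \<in> coords \<beta> ` B" for y
  proof -
    obtain p where p: "p \<in> B" "y = coords \<beta> p" using y by blast
    then have "p \<in> chart_dom \<beta>" using assms by auto
    then show ?thesis using p assms(2) volume_density_pos[OF assms(2), of p] by simp
  qed
  show "transition \<alpha> \<beta> x \<in> coords \<beta> ` B \<and> transition \<beta> \<alpha> (transition \<alpha> \<beta> x) = x"
    if x: "x \<in> coords \<alpha> ` B" for x
  proof -
    obtain p where p: "p \<in> B" "x = coords \<alpha> p" using x by blast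
    then have "p \<in> chart_dom \<alpha>" "p \<in> chart_dom \<beta>" using assms by auto
    then show ?thesis using p assms(1,2) by (simp add: transition_coords)
  qed
  show "transition \<beta> \<alpha> y \<in> coords \<alpha> ` B \<and> transition \<alpha> \<beta> (transition \<beta> \<alpha> y) = y"
    if y: "y \<in> coords \<beta> ` B" for y
  proof -
    obtain p where p: "p \<in> B" "y = coords \<beta> p" using y by blast
    then have "p \<in> chart_dom \<alpha>" "p \<in> chart_dom \<beta>" using assms by auto
    then show ?thesis using p assms(1,2) by (simp add: transition_coords)
  qed
  show "transition_deriv \<beta> \<alpha> (chart_inv \<beta> y) \<circ> transition_deriv \<alpha> \<beta> (chart_inv \<alpha> (transition \<beta> \<alpha> y)) = id"
    if y: "y \<in> coords \<beta> ` B" for y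
  proof -
    obtain p where p: "p \<in> B" "y = coords \<beta> p" using y by blast
    then have "p \<in> chart_dom \<alpha>" "p \<in> chart_dom \<beta>" using assms by auto
    then show ?thesis
      using p assms(1,2) by (auto simp: fun_eq_iff transition_coords transition_deriv_inverse)
  qed
  show "volume_density A g \<alpha> (chart_inv \<alpha> x) =
      \<bar>det (matrix (transition_deriv \<alpha> \<beta> (chart_inv \<alpha> x)))\<bar> *
      volume_density A g \<beta> (chart_inv \<beta> (transition \<alpha> \<beta> x))" if x: "x \<in> coords \<alpha> ` B" for x
  proof -
    obtain p where p: "p \<in> B" "x = coords \<alpha> p" using x by blast
    then have "p \<in> chart_dom \<alpha>" "p \<in> chart_dom \<beta>" using assms by auto
    then show ?thesis
      using p assms(1,2) volume_density_change[OF assms(1,2), of p] by (simp add: transition_coords)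
  qed
  have meas: "(\<lambda>x. indicator (coords \<alpha> ` B) x * volume_density A g \<alpha> (chart_inv \<alpha> x)) \<in> borel_measurable borel"
    if "\<alpha> \<in> A" "B \<subseteq> chart_dom \<alpha>" for \<alpha>
  proof -
    have "(\<lambda>x. indicator (coords \<alpha> ` B) x * density_on \<alpha> x) \<in> borel_measurable borel"
      using density_on_measurable[OF that(1)] coords_image_borel[OF that(1) assms(3) that(2)]
      by measurable
    moreover have "(\<lambda>x. indicator (coords \<alpha> ` B) x * volume_density A g \<alpha> (chart_inv \<alpha> x)) =
        (\<lambda>x. indicator (coords \<alpha> ` B) x * density_on \<alpha> x)"
      using that by (auto simp: fun_eq_iff density_on_def indicator_def)
    ultimately show ?thesis by simp
  qed
  show "(\<lambda>x. indicator (coords \<alpha> ` B) x * volume_density A g \<alpha> (chart_inv \<alpha> x)) \<in> borel_measurable borel"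
    by (rule meas) (use assms in auto)
  show "(\<lambda>x. indicator (coords \<beta> ` B) x * volume_density A g \<beta> (chart_inv \<beta> x)) \<in> borel_measurable borel"
    by (rule meas) (use assms in auto)
qed

text \<open>A countable subfamily of the charts covers the manifold, because its topology is second countable;
  so the chart measures glue, and the description of the volume measure defines it.\<close>
lemma riemannian_volume:
  shows sets_volume: "sets (riemannian_volume A g) = sets borel"
    and emeasure_volume: "\<And>\<alpha> B. \<alpha> \<in> A \<Longrightarrow> B \<in> sets borel \<Longrightarrow> B \<subseteq> chart_dom \<alpha> \<Longrightarrow>
      emeasure (riemannian_volume A g) B = emeasure (chart_measure \<alpha>) B"
proof -
  obtain F where F: "F \<subseteq> chart_dom ` A" "countable F" "\<Union>F = \<Union>(chart_dom ` A)"
    by (rule Lindelof[of "chart_dom ` A"]) (use chart_open in blast)+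
  obtain C where C: "C \<subseteq> A" "countable C" "F = chart_dom ` C"
    using countable_subset_image[of F chart_dom A] F by auto
  have cov: "(\<Union>\<alpha>\<in>C. chart_dom \<alpha>) = UNIV"
    using F C atlas unfolding smooth_atlas_def by simp
  then have ne: "C \<noteq> {}" by auto
  have range: "range (from_nat_into C) = C" using ne C(2) by (rule range_from_nat_into)
  let ?P = "\<lambda>V. sets V = sets borel \<and> (\<forall>\<alpha>\<in>A. \<forall>B\<in>sets borel. B \<subseteq> chart_dom \<alpha> \<longrightarrow>
      emeasure V B = emeasure (chart_measure \<alpha>) B)"
  have "\<exists>!V. ?P V"
  proof (rule measure_gluing[where s = "from_nat_into C"])
    show "from_nat_into C n \<in> A" for n using range C by auto
    show "(\<Union>n. chart_dom (from_nat_into C n)) = UNIV"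
      using cov range by (metis image_image)
    show "chart_dom \<alpha> \<in> sets borel" if "\<alpha> \<in> A" for \<alpha> using chart_open[OF that] by simp
    show "sets (chart_measure \<alpha>) = sets borel" for \<alpha> by (simp add: chart_measure_def)
  qed (rule chart_measure_agree)
  then have "?P (THE V. ?P V)" by (rule theI')
  moreover have "(THE V. ?P V) = riemannian_volume A g"
    unfolding riemannian_volume_def
    by (intro arg_cong[where f=The] ext conj_cong refl ball_cong imp_cong)
      (simp only: emeasure_chart_measure_eq)
  ultimately have P: "?P (riemannian_volume A g)" by simp
  then show "sets (riemannian_volume A g) = sets borel" by simp
  show "emeasure (riemannian_volume A g) B = emeasure (chart_measure \<alpha>) B"
    if "\<alpha> \<in> A" "B \<in> sets borel" "B \<subseteq> chart_dom \<alpha>" for \<alpha> B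
    using P that by blast
qed

abbreviation V :: "'m measure" where "V \<equiv> riemannian_volume A g"

lemma space_volume: "space (V) = UNIV"
  using sets_eq_imp_space_eq[OF sets_volume] by simp

lemma borel_measurable_volume [simp]: "borel_measurable (V) = borel_measurable borel"
  using sets_volume by (intro measurable_cong_sets) auto

text \<open>Integrals of functions that vanish off the chart are computed with this identity.\<close>
lemma volume_restrict_chart:
  assumes "\<alpha> \<in> A"
  shows "density (V) (\<lambda>p. ennreal (indicator (chart_dom \<alpha>) p)) = chart_measure \<alpha>"
proof (rule measure_eqI)
  show "sets (density V (\<lambda>p. ennreal (indicator (chart_dom \<alpha>) p))) = sets (chart_measure \<alpha>)"
    by (simp add: sets_volume chart_measure_def)
  fix B assume "B \<in> sets (density V (\<lambda>p. ennreal (indicator (chart_dom \<alpha>) p)))"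
  then have B: "B \<in> sets borel" by (simp add: sets_volume)
  have dom: "chart_dom \<alpha> \<in> sets borel" using chart_open[OF assms] by simp
  have "emeasure (density V (\<lambda>p. ennreal (indicator (chart_dom \<alpha>) p))) B =
      (\<integral>\<^sup>+p. indicator (chart_dom \<alpha> \<inter> B) p \<partial>V)"
  proof (subst emeasure_density)
    show "(\<integral>\<^sup>+p. ennreal (indicator (chart_dom \<alpha>) p) * indicator B p \<partial>V) =
        (\<integral>\<^sup>+p. indicator (chart_dom \<alpha> \<inter> B) p \<partial>V)"
      by (rule nn_integral_cong) (simp split: split_indicator)
  qed (use B dom in \<open>auto simp: sets_volume\<close>)
  also have "\<dots> = emeasure V (chart_dom \<alpha> \<inter> B)"
    by (rule nn_integral_indicator) (use B dom in \<open>auto simp: sets_volume\<close>)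
  also have "\<dots> = emeasure (chart_measure \<alpha>) (chart_dom \<alpha> \<inter> B)"
    by (rule emeasure_volume[OF assms]) (use B dom in auto)
  also have "\<dots> = emeasure (chart_measure \<alpha>) B"
    using assms B dom
    by (auto simp: emeasure_chart_measure density_on_def param_def indicator_def intro!: nn_integral_cong)
  finally show "emeasure (density V (\<lambda>p. ennreal (indicator (chart_dom \<alpha>) p))) B =
      emeasure (chart_measure \<alpha>) B" .
qed

lemma integral_in_chart:
  fixes f :: "'m \<Rightarrow> real"
  assumes "\<alpha> \<in> A" "f \<in> borel_measurable borel" "\<And>p. p \<notin> chart_dom \<alpha> \<Longrightarrow> f p = 0"
  shows "(\<integral>p. f p \<partial>V) =
    (\<integral>x. indicator (chart_img \<alpha>) x * (volume_density A g \<alpha> (chart_inv \<alpha> x) * f (chart_inv \<alpha> x)) \<partial>lborel)"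
proof -
  note [measurable] = param_measurable[OF assms(1)] density_on_measurable[OF assms(1)] assms(2)
  have "(\<integral>p. f p \<partial>V) = (\<integral>p. indicator (chart_dom \<alpha>) p *\<^sub>R f p \<partial>V)"
    by (intro Bochner_Integration.integral_cong) (use assms(3) in \<open>auto simp: indicator_def\<close>)
  also have "\<dots> = (\<integral>p. f p \<partial>density V (\<lambda>p. ennreal (indicator (chart_dom \<alpha>) p)))"
    by (rule integral_density[symmetric])
      (use assms chart_open[OF assms(1)] in \<open>auto intro!: borel_measurable_indicator\<close>)
  also have "\<dots> = (\<integral>x. f (param \<alpha> x) \<partial>density lborel (\<lambda>x. ennreal (density_on \<alpha> x)))"
    unfolding volume_restrict_chart[OF assms(1)] chart_measure_def
    by (rule integral_distr) simp_all
  also have "\<dots> = (\<integral>x. density_on \<alpha> x *\<^sub>R f (param \<alpha> x) \<partial>lborel)"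
    by (rule integral_density) (use density_on_nonneg[OF assms(1)] in auto)
  also have "\<dots> = (\<integral>x. indicator (chart_img \<alpha>) x * (volume_density A g \<alpha> (chart_inv \<alpha> x) * f (chart_inv \<alpha> x)) \<partial>lborel)"
    by (intro Bochner_Integration.integral_cong) (auto simp: density_on_def param_def)
  finally show ?thesis .
qed

section \<open>Gradient and outward normal\<close>

lemma metric_zero_iff:
  assumes "u \<in> tangent_space A p" "g p u u = 0"
  shows "u = (\<lambda>_. 0)"
  using metric_pos[OF assms(1)] assms(2) by force

text \<open>In coordinates the representing vector solves the linear system with matrix \<open>G\<^sup>T\<close>, which is
  invertible because \<open>det G > 0\<close>.\<close>
lemma tangent_riesz:
  assumes "\<alpha> \<in> A" "p \<in> chart_dom \<alpha>" "linear (L :: real^'n \<Rightarrow> real)"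
  obtains u where "u \<in> tangent_space A p" "\<And>v. v \<in> tangent_space A p \<Longrightarrow> g p u v = L (v \<alpha>)"
proof -
  let ?G = "metric_matrix A g \<alpha> p"
  define l where "l = (\<chi> i. L (axis i 1))"
  have L: "L \<eta> = l \<bullet> \<eta>" for \<eta>
    using linear_axis_expansion[OF assms(3), of \<eta>]
    by (simp add: l_def inner_vec_def mult.commute)
  have "det (transpose ?G) \<noteq> 0"
    using metric_matrix_det_pos[OF assms(1,2)] by (simp add: det_transpose)
  then have "invertible (transpose ?G)" by (simp add: invertible_det_nz)
  then obtain B where B: "transpose ?G ** B = mat 1" unfolding invertible_def by blast
  define \<xi> where "\<xi> = B *v l"
  have "transpose ?G *v \<xi> = l"
    unfolding \<xi>_def by (simp add: matrix_vector_mul_assoc B)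
  then have "\<xi> \<bullet> (?G *v \<eta>) = l \<bullet> \<eta>" for \<eta>
    by (simp add: transpose_matrix_vector dot_lmul_matrix[symmetric])
  then show ?thesis
    using that[OF coord_vector_in_tangent_space[OF assms(1,2), of \<xi>]]
      metric_coords[OF assms(1,2) coord_vector_in_tangent_space[OF assms(1,2)]]
      coord_vector_self[OF assms(1,2)] L by simp
qed

lemma tangent_metric_eqI:
  assumes "u \<in> tangent_space A p" "u' \<in> tangent_space A p"
    "\<And>v. v \<in> tangent_space A p \<Longrightarrow> g p u v = g p u' v"
  shows "u = u'"
proof -
  let ?w = "\<lambda>\<alpha>. 1 *\<^sub>R u \<alpha> + (-1) *\<^sub>R u' \<alpha>"
  have w: "?w \<in> tangent_space A p" by (rule tangent_space_lincomb[OF assms(1,2)])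
  have "g p ?w ?w = 1 * g p u ?w + (-1) * g p u' ?w"
    by (rule metric_lincomb_left[OF assms(1,2) w])
  then have "g p ?w ?w = 0" using assms(3)[OF w] by simp
  from metric_zero_iff[OF w this] show ?thesis by (simp add: fun_eq_iff)
qed

lemma gradient_eqI:
  assumes "u \<in> tangent_space A p" "\<And>v. v \<in> tangent_space A p \<Longrightarrow> g p u v = dir_deriv A f p v"
  shows "gradient A g f p = u"
  unfolding gradient_def
  by (rule the_equality) (use assms in \<open>auto intro: tangent_metric_eqI\<close>)

text \<open>Existence: the vector that represents the negative normal coordinate, normalized. Uniqueness: two
  candidates have negative normal coordinates \<open>a\<close> and \<open>a'\<close>; the combination of them whose normal
  coordinate cancels is orthogonal to both, hence to itself, so it vanishes, and the normalization gives
  \<open>a = a'\<close>. Only when both are known does the description of the normal give a tangent vector, to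
  which the bilinearity of the metric applies.\<close>
lemma outward_normal_in_tangent_space: "outward_normal A g p \<in> tangent_space A p"
proof -
  let ?\<alpha> = "chart_at A p"
  let ?P = "\<lambda>u. u \<in> tangent_space A p \<and> g p u u = 1 \<and>
        (\<forall>v\<in>tangent_space A p. v ?\<alpha> $ bcoord = 0 \<longrightarrow> g p u v = 0) \<and> u ?\<alpha> $ bcoord < 0"
  have "linear (\<lambda>\<eta>::real^'n. - (\<eta> $ bcoord))" by (intro linearI) auto
  from tangent_riesz[OF chart_at this]
  obtain u where u: "u \<in> tangent_space A p" "\<And>v. v \<in> tangent_space A p \<Longrightarrow> g p u v = - (v ?\<alpha> $ bcoord)"
    by metis
  have "u \<noteq> (\<lambda>_. 0)"
  proof
    assume u0: "u = (\<lambda>_. 0)"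
    let ?v = "coord_vector A ?\<alpha> p (axis bcoord 1)"
    have v: "?v \<in> tangent_space A p" by (rule coord_vector_in_tangent_space[OF chart_at])
    have "g p u ?v = 0" unfolding u0 by (rule metric_zero(1)[OF v])
    then show False using u(2)[OF v] coord_vector_self[OF chart_at] by simp
  qed
  then have pos: "0 < g p u u" by (rule metric_pos[OF u(1)])
  let ?s = "1 / sqrt (g p u u)"
  let ?n = "\<lambda>\<alpha>. ?s *\<^sub>R u \<alpha>"
  have n: "?n \<in> tangent_space A p" by (rule tangent_space_scale[OF u(1)])
  note gn = metric_scale(1)[OF u(1), where a="?s"]
  have "g p ?n ?n = ?s * (?s * g p u u)"
    using gn[OF n] metric_sym[OF u(1) n] gn[OF u(1)] by simp
  then have "g p ?n ?n = 1" using pos by (simp add: field_simps real_sqrt_mult[symmetric])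
  moreover have "?n ?\<alpha> $ bcoord < 0"
    using u(2)[OF u(1)] pos by (simp add: divide_neg_pos)
  ultimately have Pn: "?P ?n" using n gn u(2) by auto
  have "u = u'" if u: "?P u" and u': "?P u'" for u u'
  proof -
    let ?a = "u ?\<alpha> $ bcoord" and ?a' = "u' ?\<alpha> $ bcoord"
    let ?w = "\<lambda>\<alpha>. ?a' *\<^sub>R u \<alpha> + (- ?a) *\<^sub>R u' \<alpha>"
    have w: "?w \<in> tangent_space A p" by (rule tangent_space_lincomb) (use u u' in auto)
    have "?w ?\<alpha> $ bcoord = 0" by simp
    then have "g p u ?w = 0" "g p u' ?w = 0" using u u' w by auto
    then have "g p ?w ?w = 0"
      using metric_lincomb_left[of u p u' ?w ?a' "- ?a"] u u' w by simp
    then have w0: "?w = (\<lambda>_. 0)" by (rule metric_zero_iff[OF w])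
    have eq: "?a' *\<^sub>R u \<alpha> = ?a *\<^sub>R u' \<alpha>" for \<alpha>
      using fun_cong[OF w0, of \<alpha>] by simp
    have sc: "g p (\<lambda>\<alpha>. b *\<^sub>R v \<alpha>) (\<lambda>\<alpha>. b *\<^sub>R v \<alpha>) = b * b * g p v v" if "v \<in> tangent_space A p" for b v
      using metric_scale[OF that that] metric_scale(2)[OF that tangent_space_scale[OF that]] by simp
    have "?a' * ?a' = ?a * ?a"
      using sc[of u ?a'] sc[of u' ?a] u u' eq by simp
    then have "?a' = ?a" using u u' by (auto simp: square_eq_iff)
    show "u = u'"
    proof
      fix \<alpha>
      show "u \<alpha> = u' \<alpha>" using eq[of \<alpha>] \<open>?a' = ?a\<close> u by auto
    qed
  qed
  then have "?P (outward_normal A g p)"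
    unfolding outward_normal_def using Pn by (intro theI2[of ?P ?n ?P]) auto
  then show ?thesis by blast
qed

section \<open>Functions and fields supported in one chart\<close>

text \<open>Every point has a neighbourhood that lies in the chart or avoids the closed set \<open>C\<close>.\<close>
lemma smooth_extension_by_zero:
  fixes F :: "'m \<Rightarrow> 'b::real_normed_vector"
  assumes "\<alpha> \<in> A" "\<beta> \<in> A" "closed C" "C \<subseteq> chart_dom \<alpha>" "\<And>p. p \<notin> C \<Longrightarrow> F p = 0"
    "smooth_on (coords \<beta> ` (chart_dom \<beta> \<inter> chart_dom \<alpha>)) (\<lambda>x. F (chart_inv \<beta> x))"
  shows "smooth_on (chart_img \<beta>) (\<lambda>x. F (chart_inv \<beta> x))"
proof (rule smooth_on_local)
  fix x assume x: "x \<in> chart_img \<beta>"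
  have img: "chart_img \<beta> \<subseteq> halfspace" using chart_img_openin[OF assms(2)] by (rule openin_imp_subset)
  show "\<exists>W. open W \<and> x \<in> W \<and> smooth_on (chart_img \<beta> \<inter> W) (\<lambda>x. F (chart_inv \<beta> x))"
  proof (cases "chart_inv \<beta> x \<in> chart_dom \<alpha>")
    case True
    obtain W where W: "open W" "coords \<beta> ` (chart_dom \<beta> \<inter> chart_dom \<alpha>) = halfspace \<inter> W"
      using coords_image_openin[OF assms(2) chart_open[OF assms(1)]] by (auto simp: openin_open)
    moreover have "x \<in> coords \<beta> ` (chart_dom \<beta> \<inter> chart_dom \<alpha>)"
      using True x by (simp add: coords_image_eq[OF assms(2)])
    ultimately show ?thesis
      using assms(6) img by (intro exI[of _ W]) (auto intro: smooth_on_subset)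
  next
    case False
    have op: "open (- C)" using assms(3) by auto
    obtain W where W: "open W" "coords \<beta> ` (chart_dom \<beta> \<inter> - C) = halfspace \<inter> W"
      using coords_image_openin[OF assms(2) op] by (auto simp: openin_open)
    have "x \<in> coords \<beta> ` (chart_dom \<beta> \<inter> - C)"
      using False x assms(4) by (auto simp: coords_image_eq[OF assms(2)])
    then have "x \<in> W" using W by auto
    have "F (chart_inv \<beta> y) = 0" if "y \<in> chart_img \<beta> \<inter> W" for y
    proof -
      have "y \<in> coords \<beta> ` (chart_dom \<beta> \<inter> - C)" using that img W by auto
      then show ?thesis using assms(5) by (simp add: coords_image_eq[OF assms(2)])
    qed
    then have "smooth_on (chart_img \<beta> \<inter> W) (\<lambda>x. F (chart_inv \<beta> x))"
      by (intro smooth_on_cong[OF _ smooth_on_const[of _ 0]]) auto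
    then show ?thesis using W(1) \<open>x \<in> W\<close> by blast
  qed
qed

lemma smooth_in_other_chart:
  assumes "\<alpha> \<in> A" "\<beta> \<in> A" "smooth_on (chart_img \<alpha>) (\<lambda>x. F (chart_inv \<alpha> x))"
  shows "smooth_on (coords \<beta> ` (chart_dom \<beta> \<inter> chart_dom \<alpha>)) (\<lambda>x. F (chart_inv \<beta> x))"
proof -
  let ?S = "coords \<beta> ` (chart_dom \<beta> \<inter> chart_dom \<alpha>)"
  have "smooth_on ?S (\<lambda>x. F (chart_inv \<alpha> (transition \<beta> \<alpha> x)))"
    by (rule smooth_on_compose[OF assms(3) transition_smooth[OF assms(2,1)]])
      (use assms(2) in \<open>auto simp: transition_coords\<close>)
  then show ?thesis
    by (rule smooth_on_cong[rotated]) (use assms(1,2) in \<open>auto simp: transition_coords\<close>)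
qed

lemma smooth_functions_extend:
  assumes "\<alpha> \<in> A" "closed C" "C \<subseteq> chart_dom \<alpha>" "\<And>p. p \<notin> C \<Longrightarrow> f p = 0"
    "smooth_on (chart_img \<alpha>) (\<lambda>x. f (chart_inv \<alpha> x))"
  shows "f \<in> smooth_functions A"
  by (rule smooth_functionsI)
    (rule smooth_extension_by_zero[OF assms(1) _ assms(2,3,4) smooth_in_other_chart[OF assms(1) _ assms(5)]])

definition lift_function :: "('m, 'n) chart \<Rightarrow> (real^'n \<Rightarrow> real) \<Rightarrow> 'm \<Rightarrow> real" where
  "lift_function \<alpha> \<phi> p = (if p \<in> chart_dom \<alpha> then \<phi> (coords \<alpha> p) else 0)"

text \<open>A multiple of a coordinate vector field of the chart. Off the chart, where the coordinate vector has
  no meaning, the factor is zero.\<close>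
definition lift_field :: "('m, 'n) chart \<Rightarrow> (real^'n \<Rightarrow> real) \<Rightarrow> real^'n \<Rightarrow> ('m, 'n) vfield" where
  "lift_field \<alpha> \<phi> e p = (\<lambda>\<beta>. lift_function \<alpha> \<phi> p *\<^sub>R coord_vector A \<alpha> p e \<beta>)"

lemma compact_chart_inv_image:
  assumes "\<alpha> \<in> A" "compact K" "K \<subseteq> chart_img \<alpha>"
  shows "compact (chart_inv \<alpha> ` K)" "closed (chart_inv \<alpha> ` K)" "chart_inv \<alpha> ` K \<subseteq> chart_dom \<alpha>"
proof -
  show "compact (chart_inv \<alpha> ` K)"
    by (intro compact_continuous_image continuous_on_subset[OF chart_inv_continuous[OF assms(1)]] assms)
  then show "closed (chart_inv \<alpha> ` K)" by (rule compact_imp_closed)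
  show "chart_inv \<alpha> ` K \<subseteq> chart_dom \<alpha>" using assms chart_inv_in[OF assms(1)] by blast
qed

context
  fixes \<alpha> :: "('m, 'n) chart" and \<phi> :: "real^'n \<Rightarrow> real" and K :: "(real^'n) set"
  assumes \<alpha>: "\<alpha> \<in> A" and K: "compact K" "K \<subseteq> chart_img \<alpha>"
    and \<phi>: "\<And>k. Ck_on k UNIV \<phi>" "\<And>x. x \<notin> K \<Longrightarrow> \<phi> x = 0"
begin

lemma lift_function_outside: "p \<notin> chart_inv \<alpha> ` K \<Longrightarrow> lift_function \<alpha> \<phi> p = 0"
  using \<phi>(2) \<alpha> by (force simp: lift_function_def)

lemma lift_function_smooth: "lift_function \<alpha> \<phi> \<in> smooth_functions A"
proof (rule smooth_functions_extend[OF \<alpha> compact_chart_inv_image(2,3)[OF \<alpha> K] lift_function_outside])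
  have "smooth_on (chart_img \<alpha>) \<phi>" by (rule smooth_on_Ck[OF open_UNIV _ \<phi>(1)]) auto
  then show "smooth_on (chart_img \<alpha>) (\<lambda>x. lift_function \<alpha> \<phi> (chart_inv \<alpha> x))"
    by (rule smooth_on_cong[rotated]) (simp add: lift_function_def \<alpha>)
qed auto

lemma lift_field_smooth: "lift_field \<alpha> \<phi> e \<in> vector_fields A"
proof -
  have tan: "lift_field \<alpha> \<phi> e p \<in> tangent_space A p" for p
  proof (cases "p \<in> chart_dom \<alpha>")
    case True
    then show ?thesis unfolding lift_field_def
      by (intro tangent_space_scale coord_vector_in_tangent_space \<alpha>)
  next
    case False
    then show ?thesis using zero_tangent by (simp add: lift_field_def lift_function_def)
  qed
  have "smooth_on (chart_img \<beta>) (\<lambda>x. lift_field \<alpha> \<phi> e (chart_inv \<beta> x) \<beta>)" if \<beta>: "\<beta> \<in> A" for \<beta>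
  proof (rule smooth_extension_by_zero[OF \<alpha> \<beta> compact_chart_inv_image(2,3)[OF \<alpha> K]])
    show "lift_field \<alpha> \<phi> e p \<beta> = 0" if "p \<notin> chart_inv \<alpha> ` K" for p
      using lift_function_outside[OF that] by (simp add: lift_field_def)
    let ?S = "coords \<alpha> ` (chart_dom \<alpha> \<inter> chart_dom \<beta>)" and ?T = "coords \<beta> ` (chart_dom \<beta> \<inter> chart_dom \<alpha>)"
    have S: "openin (top_of_set halfspace) ?S" by (rule coords_image_openin[OF \<alpha> chart_open[OF \<beta>]])
    have "smooth_on ?T (\<lambda>x. \<phi> (transition \<beta> \<alpha> x) *\<^sub>R
        frechet_derivative (transition \<alpha> \<beta>) (at (transition \<beta> \<alpha> x) within ?S) e)"
    proof (rule smooth_on_scaleR)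
      show "smooth_on ?T (\<lambda>x. \<phi> (transition \<beta> \<alpha> x))"
        by (rule smooth_on_compose[OF _ transition_smooth[OF \<beta> \<alpha>], of UNIV])
          (auto intro: smooth_on_Ck[OF open_UNIV _ \<phi>(1)])
      show "smooth_on ?T (\<lambda>x. frechet_derivative (transition \<alpha> \<beta>) (at (transition \<beta> \<alpha> x) within ?S) e)"
        by (rule smooth_on_compose[OF smooth_on_has_derivative(2)[OF S transition_smooth[OF \<alpha> \<beta>]]
              transition_smooth[OF \<beta> \<alpha>]])
          (use \<beta> in \<open>auto simp: transition_coords\<close>)
    qed
    then show "smooth_on ?T (\<lambda>x. lift_field \<alpha> \<phi> e (chart_inv \<beta> x) \<beta>)"
      by (rule smooth_on_cong[rotated])
        (use \<beta> \<alpha> in \<open>auto simp: transition_coords lift_field_def lift_function_def coord_vector_def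
          transition_deriv_def\<close>)
  qed
  with tan show ?thesis by (simp add: vector_fields_def)
qed

end

section \<open>The divergence in a chart\<close>

text \<open>The value of \<open>divergence\<close> with an arbitrary chart in place of the one chosen at \<open>p\<close>.\<close>
definition div_in :: "('m, 'n) chart \<Rightarrow> ('m, 'n) vfield \<Rightarrow> 'm \<Rightarrow> real" where
  "div_in \<alpha> X p = (1 / volume_density A g \<alpha> p) *
     (\<Sum>i\<in>UNIV. frechet_derivative
        (\<lambda>x. volume_density A g \<alpha> (chart_inv \<alpha> x) * X (chart_inv \<alpha> x) \<alpha> $ i)
        (at (coords \<alpha> p) within chart_img \<alpha>) (axis i 1))"

lemma divergence_eq_div_in: "divergence A g X p = div_in (chart_at A p) X p"
  by (simp add: divergence_def div_in_def Let_def)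

lemma flux_smooth:
  assumes "\<alpha> \<in> A" "X \<in> vector_fields A"
  shows "smooth_on (chart_img \<alpha>) (\<lambda>x. volume_density A g \<alpha> (chart_inv \<alpha> x) * X (chart_inv \<alpha> x) \<alpha> $ i)"
  by (intro smooth_on_mult smooth_on_nth vector_fieldsD assms volume_density_smooth)

lemma div_in_smooth:
  assumes "\<alpha> \<in> A" "X \<in> vector_fields A"
  shows "smooth_on (chart_img \<alpha>) (\<lambda>x. div_in \<alpha> X (chart_inv \<alpha> x))"
proof -
  have "smooth_on (chart_img \<alpha>) (\<lambda>x. (1 / volume_density A g \<alpha> (chart_inv \<alpha> x)) *
     (\<Sum>i\<in>UNIV. frechet_derivative
        (\<lambda>x. volume_density A g \<alpha> (chart_inv \<alpha> x) * X (chart_inv \<alpha> x) \<alpha> $ i)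
        (at x within chart_img \<alpha>) (axis i 1)))"
    by (intro smooth_on_mult smooth_on_sum smooth_on_has_derivative(2)[OF chart_img_openin]
      flux_smooth volume_density_smooth assms)
  then show ?thesis
    by (rule smooth_on_cong[rotated]) (simp add: div_in_def assms(1))
qed

lemma div_in_zero:
  assumes "\<alpha> \<in> A" "p \<in> chart_dom \<alpha>" "closed C" "p \<notin> C" "\<And>q. q \<notin> C \<Longrightarrow> X q = (\<lambda>_. 0)"
  shows "div_in \<alpha> X p = 0"
proof -
  let ?S = "coords \<alpha> ` (chart_dom \<alpha> \<inter> - C)"
  have S: "openin (top_of_set halfspace) ?S" "coords \<alpha> p \<in> ?S"
    using coords_image_openin[OF assms(1), of "- C"] assms by auto
  have img: "coords \<alpha> p \<in> chart_img \<alpha>" using assms by auto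
  have "((\<lambda>x. volume_density A g \<alpha> (chart_inv \<alpha> x) * X (chart_inv \<alpha> x) \<alpha> $ i) has_derivative (\<lambda>_. 0))
      (at (coords \<alpha> p) within chart_img \<alpha>)" for i
    by (rule frechet_derivative_halfspace_cong[OF S chart_img_openin[OF assms(1)] img, of "\<lambda>_. 0"])
      (use assms in auto)
  from frechet_derivative_halfspace[OF chart_img_openin[OF assms(1)] img this]
  show ?thesis by (simp add: div_in_def)
qed

lemma div_in_lincomb:
  assumes "\<alpha> \<in> A" "p \<in> chart_dom \<alpha>" "X \<in> vector_fields A" "Y \<in> vector_fields A"
  shows "div_in \<alpha> (\<lambda>p \<beta>. a *\<^sub>R X p \<beta> + b *\<^sub>R Y p \<beta>) p = a * div_in \<alpha> X p + b * div_in \<alpha> Y p"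
proof -
  let ?f = "\<lambda>X i x. volume_density A g \<alpha> (chart_inv \<alpha> x) * X (chart_inv \<alpha> x) \<alpha> $ i"
  let ?D = "\<lambda>h. frechet_derivative h (at (coords \<alpha> p) within chart_img \<alpha>)"
  have img: "coords \<alpha> p \<in> chart_img \<alpha>" using assms by auto
  note D = smooth_on_has_derivative(1)[OF chart_img_openin[OF assms(1)] flux_smooth[OF assms(1)] img]
  have "?D (?f (\<lambda>p \<beta>. a *\<^sub>R X p \<beta> + b *\<^sub>R Y p \<beta>) i) = (\<lambda>v. a * ?D (?f X i) v + b * ?D (?f Y i) v)" for i
  proof (rule frechet_derivative_halfspace[OF chart_img_openin[OF assms(1)] img])
    have "((\<lambda>x. a * ?f X i x + b * ?f Y i x) has_derivative (\<lambda>v. a * ?D (?f X i) v + b * ?D (?f Y i) v))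
        (at (coords \<alpha> p) within chart_img \<alpha>)"
      by (intro has_derivative_add has_derivative_mult_right D assms)
    then show "(?f (\<lambda>p \<beta>. a *\<^sub>R X p \<beta> + b *\<^sub>R Y p \<beta>) i has_derivative
        (\<lambda>v. a * ?D (?f X i) v + b * ?D (?f Y i) v)) (at (coords \<alpha> p) within chart_img \<alpha>)"
      by (simp add: algebra_simps)
  qed
  then show ?thesis
    by (simp add: div_in_def sum.distrib sum_distrib_left algebra_simps)
qed

text \<open>The product rule \<open>div (\<psi> X) = \<psi> div X + d\<psi>(X)\<close>, the only form in which integration by parts is used
  on the manifold.\<close>
lemma div_in_scale_field:
  assumes "\<alpha> \<in> A" "p \<in> chart_dom \<alpha>" "\<psi> \<in> smooth_functions A" "X \<in> vector_fields A"
  shows "div_in \<alpha> (scale_field \<psi> X) p = \<psi> p * div_in \<alpha> X p + dir_deriv A \<psi> p (X p)"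
proof -
  let ?\<rho> = "volume_density A g \<alpha> p"
  let ?f = "\<lambda>X i x. volume_density A g \<alpha> (chart_inv \<alpha> x) * X (chart_inv \<alpha> x) \<alpha> $ i"
  let ?D = "\<lambda>h. frechet_derivative h (at (coords \<alpha> p) within chart_img \<alpha>)"
  let ?\<psi> = "\<lambda>x. \<psi> (chart_inv \<alpha> x)"
  have img: "coords \<alpha> p \<in> chart_img \<alpha>" using assms by auto
  have inv: "chart_inv \<alpha> (coords \<alpha> p) = p" using assms by simp
  note D = smooth_on_has_derivative(1)[OF chart_img_openin[OF assms(1)] flux_smooth[OF assms(1,4)] img]
  note D\<psi> = smooth_function_has_derivative[OF assms(3,1,2)]
  have eq: "?D (?f (scale_field \<psi> X) i) = (\<lambda>v. \<psi> p * ?D (?f X i) v + ?D ?\<psi> v * (?\<rho> * X p \<alpha> $ i))" for i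
  proof (rule frechet_derivative_halfspace[OF chart_img_openin[OF assms(1)] img])
    have "((\<lambda>x. ?\<psi> x * ?f X i x) has_derivative
        (\<lambda>v. ?\<psi> (coords \<alpha> p) * ?D (?f X i) v + ?D ?\<psi> v * ?f X i (coords \<alpha> p)))
        (at (coords \<alpha> p) within chart_img \<alpha>)"
      by (rule has_derivative_mult[OF D\<psi> D])
    then show "(?f (scale_field \<psi> X) i has_derivative
        (\<lambda>v. \<psi> p * ?D (?f X i) v + ?D ?\<psi> v * (?\<rho> * X p \<alpha> $ i))) (at (coords \<alpha> p) within chart_img \<alpha>)"
      unfolding inv by (simp add: scale_field_def algebra_simps)
  qed
  have "dir_deriv A \<psi> p (X p) = ?D ?\<psi> (X p \<alpha>)"
    by (rule dir_deriv_chart[OF assms(3,1,2) vector_fieldsD(1)[OF assms(4)]])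
  also have "\<dots> = (\<Sum>i\<in>UNIV. X p \<alpha> $ i *\<^sub>R ?D ?\<psi> (axis i 1))"
    by (rule linear_axis_expansion[OF has_derivative_linear[OF D\<psi>]])
  finally have dd: "dir_deriv A \<psi> p (X p) = (\<Sum>i\<in>UNIV. X p \<alpha> $ i * ?D ?\<psi> (axis i 1))" by simp
  have "?\<rho> \<noteq> 0" using volume_density_pos[OF assms(1,2)] by simp
  then show ?thesis
    unfolding div_in_def eq dd
    by (simp add: sum.distrib sum_distrib_left field_simps)
qed

text \<open>Only the interior of the chart contributes, where the integral of each coordinate derivative
  of a compactly supported function vanishes.\<close>
lemma integral_div_in:
  assumes \<alpha>: "\<alpha> \<in> A" and X: "X \<in> vector_fields A" and C: "compact C" "C \<subseteq> chart_dom \<alpha>"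
    "C \<inter> mboundary A = {}" "\<And>p. p \<notin> C \<Longrightarrow> X p = (\<lambda>_. 0)"
  shows "(\<lambda>p. if p \<in> chart_dom \<alpha> then div_in \<alpha> X p else 0) \<in> smooth_functions A" (is "?h \<in> _")
    and "(\<integral>p. (if p \<in> chart_dom \<alpha> then div_in \<alpha> X p else 0) \<partial>V) = 0"
proof -
  have cl: "closed C" using C(1) by (rule compact_imp_closed)
  show sm: "?h \<in> smooth_functions A"
  proof (rule smooth_functions_extend[OF \<alpha> cl C(2)])
    show "?h p = 0" if "p \<notin> C" for p using div_in_zero[OF \<alpha> _ cl that C(4)] by simp
    show "smooth_on (chart_img \<alpha>) (\<lambda>x. ?h (chart_inv \<alpha> x))"
      by (rule smooth_on_cong[OF _ div_in_smooth[OF \<alpha> X]]) (simp add: \<alpha>)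
  qed
  let ?f = "\<lambda>i x. volume_density A g \<alpha> (chart_inv \<alpha> x) * X (chart_inv \<alpha> x) \<alpha> $ i"
  let ?U = "chart_img \<alpha> \<inter> {x. 0 < x $ bcoord}"
  let ?D = "\<lambda>i x. frechet_derivative (?f i) (at x within chart_img \<alpha>)"
  have opU: "open ?U" by (rule openin_halfspace_interior[OF chart_img_openin[OF \<alpha>]])
  have K: "compact (coords \<alpha> ` C)"
    by (intro compact_continuous_image continuous_on_subset[OF coords_continuous[OF \<alpha>]] C)
  have KU: "coords \<alpha> ` C \<subseteq> ?U"
  proof
    fix x assume "x \<in> coords \<alpha> ` C"
    then obtain p where p: "p \<in> C" "x = coords \<alpha> p" by blast
    then have "p \<in> chart_dom \<alpha>" "p \<notin> mboundary A" using C by auto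
    then show "x \<in> ?U"
      using p mboundary_iff[OF \<alpha>] coords_in_halfspace[OF \<alpha>, of x] by (auto simp: less_le)
  qed
  have part: "integrable lborel (\<lambda>x. indicator ?U x * ?D i x (axis i 1))"
      "(\<integral>x. indicator ?U x * ?D i x (axis i 1) \<partial>lborel) = 0" for i
  proof -
    have zero: "?f i x = 0" if "x \<in> ?U" "x \<notin> coords \<alpha> ` C" for x
    proof -
      have "chart_inv \<alpha> x \<notin> C"
        using that coords_chart_inv[OF \<alpha>, of x] by (metis IntD1 image_eqI)
      then show ?thesis using C(4) by simp
    qed
    have der: "(?f i has_derivative ?D i x) (at x)" if "x \<in> ?U" for x
      using smooth_on_has_derivative(1)[OF chart_img_openin[OF \<alpha>] flux_smooth[OF \<alpha> X], of x i]
        at_within_halfspace_interior[OF chart_img_openin[OF \<alpha>], of x] that by simp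
    have cont: "continuous_on ?U (\<lambda>x. ?D i x (axis i 1))"
      by (rule continuous_on_subset[OF smooth_on_continuous_on[OF smooth_on_has_derivative(2)[OF
        chart_img_openin[OF \<alpha>] flux_smooth[OF \<alpha> X]]]]) auto
    show "integrable lborel (\<lambda>x. indicator ?U x * ?D i x (axis i 1))"
      "(\<integral>x. indicator ?U x * ?D i x (axis i 1) \<partial>lborel) = 0"
      using integral_partial_derivative_zero_on[OF opU K KU zero der cont] by auto
  qed
  have "?h \<in> borel_measurable borel"
    by (rule borel_measurable_continuous_onI[OF smooth_functions_continuous[OF sm]])
  then have "(\<integral>p. ?h p \<partial>V) =
      (\<integral>x. indicator (chart_img \<alpha>) x * (volume_density A g \<alpha> (chart_inv \<alpha> x) * ?h (chart_inv \<alpha> x)) \<partial>lborel)"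
    by (rule integral_in_chart[OF \<alpha>]) simp
  also have "\<dots> = (\<integral>x. (\<Sum>i\<in>UNIV. indicator ?U x * ?D i x (axis i 1)) \<partial>lborel)"
  proof (rule Bochner_Integration.integral_cong[OF refl])
    fix x
    show "indicator (chart_img \<alpha>) x * (volume_density A g \<alpha> (chart_inv \<alpha> x) * ?h (chart_inv \<alpha> x)) =
        (\<Sum>i\<in>UNIV. indicator ?U x * ?D i x (axis i 1))"
    proof (cases "x \<in> chart_img \<alpha>")
      case True
      note dom = chart_inv_in[OF \<alpha> True]
      have pos: "0 < volume_density A g \<alpha> (chart_inv \<alpha> x)" by (rule volume_density_pos[OF \<alpha> dom])
      have eq: "volume_density A g \<alpha> (chart_inv \<alpha> x) * ?h (chart_inv \<alpha> x) = (\<Sum>i\<in>UNIV. ?D i x (axis i 1))"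
        using dom pos True by (simp add: div_in_def coords_chart_inv[OF \<alpha>])
      show ?thesis
      proof (cases "x \<in> ?U")
        case False
        then have "chart_inv \<alpha> x \<notin> C" using KU coords_chart_inv[OF \<alpha> True] by (metis image_eqI subsetD)
        then have "?h (chart_inv \<alpha> x) = 0" using div_in_zero[OF \<alpha> dom cl _ C(4)] by simp
        then show ?thesis using False by simp
      qed (use eq True in \<open>simp add: indicator_def\<close>)
    qed simp
  qed
  also have "\<dots> = 0"
    using part by (subst Bochner_Integration.integral_sum) auto
  finally show "(\<integral>p. ?h p \<partial>V) = 0" .
qed

end

section \<open>Integration over a compact manifold\<close>

locale compact_riemannian_manifold = riemannian_manifold A g
  for A :: "('m::{t2_space, second_countable_topology}, 'n::finite) chart set" and g :: "('m, 'n) metric" +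
  assumes compact_UNIV: "compact (UNIV :: 'm set)"
begin

lemma finite_chart_cover:
  "\<exists>F. finite F \<and> (\<forall>f\<in>F. fst f \<in> A \<and> compact (snd f) \<and> snd f \<subseteq> chart_img (fst f)) \<and>
    (\<forall>p. \<exists>f\<in>F. p \<in> chart_inv (fst f) ` snd f)"
proof -
  have "\<exists>\<alpha> K W. \<alpha> \<in> A \<and> compact K \<and> K \<subseteq> chart_img \<alpha> \<and> open W \<and> p \<in> W \<and> W \<subseteq> chart_inv \<alpha> ` K" for p
  proof -
    obtain \<alpha> where \<alpha>: "\<alpha> \<in> A" "p \<in> chart_dom \<alpha>" using chart_cases by blast
    then have "coords \<alpha> p \<in> chart_img \<alpha>" by blast
    then obtain r where r: "0 < r" "cball (coords \<alpha> p) r \<inter> halfspace \<subseteq> chart_img \<alpha>"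
      using chart_img_openin[OF \<alpha>(1)] unfolding openin_contains_cball by blast
    define K where "K = cball (coords \<alpha> p) r \<inter> halfspace"
    define W where "W = {q \<in> chart_dom \<alpha>. coords \<alpha> q \<in> ball (coords \<alpha> p) r}"
    have "closed (halfspace :: (real^'n) set)"
      unfolding halfspace_def by (intro closed_Collect_le continuous_intros)
    then have 1: "compact K" unfolding K_def by (intro compact_Int_closed) auto
    have 2: "open W" unfolding W_def by (rule chart_preimage_open[OF \<alpha>(1) open_ball])
    have 3: "W \<subseteq> chart_inv \<alpha> ` K"
    proof
      fix q assume q: "q \<in> W"
      then have "coords \<alpha> q \<in> K"
        using coords_in_halfspace[OF \<alpha>(1), of "coords \<alpha> q"] by (auto simp: halfspace_def K_def W_def)
      moreover have "q = chart_inv \<alpha> (coords \<alpha> q)" using q chart_inv_coords[OF \<alpha>(1)] by (simp add: W_def)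
      ultimately show "q \<in> chart_inv \<alpha> ` K" by (rule rev_image_eqI)
    qed
    have 4: "p \<in> W" using \<alpha> r by (simp add: W_def)
    show ?thesis using \<alpha>(1) 1 r(2)[folded K_def] 2 4 3 by blast
  qed
  then obtain a k W where *: "\<And>p. a p \<in> A \<and> compact (k p) \<and> k p \<subseteq> chart_img (a p) \<and> open (W p) \<and>
      p \<in> W p \<and> W p \<subseteq> chart_inv (a p) ` k p"
    by metis
  obtain P where P: "finite P" "UNIV \<subseteq> (\<Union>p\<in>P. W p)"
  proof (rule compactE_image[OF compact_UNIV, of UNIV W])
    show "open (W p)" for p using *[of p] by simp
    show "UNIV \<subseteq> (\<Union>p. W p)" using * by blast
  qed blast
  let ?F = "(\<lambda>p. (a p, k p)) ` P"
  have "\<exists>f\<in>?F. p \<in> chart_inv (fst f) ` snd f" for p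
  proof -
    obtain p' where "p' \<in> P" "p \<in> W p'" using P by blast
    moreover have "W p' \<subseteq> chart_inv (a p') ` k p'" using * by blast
    ultimately show ?thesis by (intro bexI[of _ "(a p', k p')"]) auto
  qed
  moreover have "\<forall>f\<in>?F. fst f \<in> A \<and> compact (snd f) \<and> snd f \<subseteq> chart_img (fst f)"
  proof
    fix f assume "f \<in> ?F"
    then obtain p where "f = (a p, k p)" by blast
    then show "fst f \<in> A \<and> compact (snd f) \<and> snd f \<subseteq> chart_img (fst f)" using *[of p] by simp
  qed
  ultimately show ?thesis using P(1) by (intro exI[of _ ?F]) blast
qed

lemma finite_measure_volume: "finite_measure V"
proof (rule finite_measureI)
  obtain F where F: "finite F" "\<forall>f\<in>F. fst f \<in> A \<and> compact (snd f) \<and> snd f \<subseteq> chart_img (fst f)"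
    "\<forall>p. \<exists>f\<in>F. p \<in> chart_inv (fst f) ` snd f"
    using finite_chart_cover by blast
  let ?C = "\<lambda>f. chart_inv (fst f) ` snd f"
  have C: "?C f \<in> sets V \<and> emeasure V (?C f) < \<infinity>" if f: "f \<in> F" for f
  proof -
    define \<alpha> K where f': "\<alpha> = fst f" "K = snd f"
    have \<alpha>: "\<alpha> \<in> A" and K: "compact K" "K \<subseteq> chart_img \<alpha>" unfolding f' using F(2) f by blast+
    let ?\<rho> = "\<lambda>x. volume_density A g \<alpha> (chart_inv \<alpha> x)"
    have B: "chart_inv \<alpha> ` K \<in> sets borel"
      using compact_chart_inv_image(2)[OF \<alpha> K] by simp
    have im: "coords \<alpha> ` chart_inv \<alpha> ` K = K"
      using K(2) coords_chart_inv[OF \<alpha>] by (force simp: image_image)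
    have int: "integrable lborel (\<lambda>x. indicator K x *\<^sub>R ?\<rho> x)"
      by (rule borel_integrable_compact[OF K(1)])
        (rule continuous_on_subset[OF smooth_on_continuous_on[OF volume_density_smooth(1)[OF \<alpha>]] K(2)])
    have nn: "0 \<le> indicator K x *\<^sub>R ?\<rho> x" for x
      using volume_density_pos[OF \<alpha> chart_inv_in[OF \<alpha>], of x] K(2)
      by (cases "x \<in> K") (auto simp: less_imp_le)
    have "emeasure V (chart_inv \<alpha> ` K) = (\<integral>\<^sup>+x. ennreal (?\<rho> x) * indicator K x \<partial>lborel)"
      using emeasure_volume[OF \<alpha> B compact_chart_inv_image(3)[OF \<alpha> K]]
        emeasure_chart_measure_eq[OF \<alpha> B compact_chart_inv_image(3)[OF \<alpha> K]] im by simp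
    also have "\<dots> = (\<integral>\<^sup>+x. ennreal (indicator K x *\<^sub>R ?\<rho> x) \<partial>lborel)"
      by (rule nn_integral_cong) (simp split: split_indicator)
    also have "\<dots> = ennreal (\<integral>x. indicator K x *\<^sub>R ?\<rho> x \<partial>lborel)"
      by (rule nn_integral_eq_integral[OF int]) (use nn in auto)
    finally show ?thesis using B f' by (simp add: sets_volume)
  qed
  have "space V \<subseteq> (\<Union>f\<in>F. ?C f)"
    using F(3) by blast
  then have "emeasure V (space V) \<le> emeasure V (\<Union>f\<in>F. ?C f)"
    by (rule emeasure_mono) (use C F(1) in blast)
  also have "\<dots> \<le> (\<Sum>f\<in>F. emeasure V (?C f))"
    by (rule emeasure_subadditive_finite[OF F(1)]) (use C in blast)
  also have "\<dots> < \<infinity>" using C F(1) by (simp add: ennreal_sum_less_top less_top)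
  finally show "emeasure V (space V) \<noteq> \<infinity>" by simp
qed

lemma integrable_continuous:
  fixes f :: "'m \<Rightarrow> real"
  assumes "continuous_on UNIV f"
  shows "integrable V f"
proof -
  have "bounded (range f)"
    by (intro compact_imp_bounded compact_continuous_image assms compact_UNIV)
  then obtain B where "\<And>p. norm (f p) \<le> B" by (auto simp: bounded_iff)
  then show ?thesis
    using borel_measurable_continuous_onI[OF assms]
    by (intro finite_measure.integrable_const_bound[OF finite_measure_volume, of _ B]) auto
qed

lemmas integrable_smooth = integrable_continuous[OF smooth_functions_continuous]

section \<open>Independence of the divergence from the chart\<close>

lemma interior_of_chart_open: "\<alpha> \<in> A \<Longrightarrow> open (chart_dom \<alpha> - mboundary A)"
proof -
  assume \<alpha>: "\<alpha> \<in> A"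
  have "chart_dom \<alpha> - mboundary A = {p \<in> chart_dom \<alpha>. coords \<alpha> p \<in> {x. 0 < x $ bcoord}}"
    using mboundary_iff[OF \<alpha>] coords_in_halfspace[OF \<alpha>] by (auto simp: less_le)
  moreover have "open {x :: real^'n. 0 < x $ bcoord}" by (intro open_Collect_less continuous_intros)
  ultimately show ?thesis using chart_preimage_open[OF \<alpha>, of "{x. 0 < x $ bcoord}"] by simp
qed

text \<open>The fundamental lemma of the calculus of variations on a set \<open>N\<close> of interior points of one chart.\<close>
lemma test_functions_separate:
  assumes \<alpha>: "\<alpha> \<in> A" and N: "open N" "N \<subseteq> chart_dom \<alpha> - mboundary A" and p: "p \<in> N"
    and cont: "continuous_on (coords \<alpha> ` N) (\<lambda>x. k (chart_inv \<alpha> x))"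
    and test: "\<And>\<phi> K. compact K \<Longrightarrow> K \<subseteq> chart_img \<alpha> \<Longrightarrow> chart_inv \<alpha> ` K \<subseteq> N \<Longrightarrow>
      (\<And>j. Ck_on j UNIV \<phi>) \<Longrightarrow> (\<And>x. x \<notin> K \<Longrightarrow> \<phi> x = 0) \<Longrightarrow>
      (\<lambda>q. lift_function \<alpha> \<phi> q * k q) \<in> smooth_functions A \<and> (\<integral>q. lift_function \<alpha> \<phi> q * k q \<partial>V) = 0"
  shows "k p = 0"
proof -
  let ?W = "coords \<alpha> ` N"
  let ?\<rho> = "\<lambda>x. volume_density A g \<alpha> (chart_inv \<alpha> x)"
  let ?m = "\<lambda>x. ?\<rho> x * k (chart_inv \<alpha> x)"
  have N': "q \<in> chart_dom \<alpha>" "0 < coords \<alpha> q $ bcoord" if "q \<in> N" for q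
    using that N(2) mboundary_iff[OF \<alpha>, of q] coords_in_halfspace[OF \<alpha>, of "coords \<alpha> q"]
    by (auto simp: less_le)
  have img: "?W \<subseteq> chart_img \<alpha>" using N' by blast
  have "chart_dom \<alpha> \<inter> N = N" using N' by blast
  then have "openin (top_of_set halfspace) ?W" using coords_image_openin[OF \<alpha> N(1)] by simp
  moreover have "?W \<inter> {x. 0 < x $ bcoord} = ?W" using N' by blast
  ultimately have W: "open ?W" using openin_halfspace_interior by metis
  have "?m (coords \<alpha> p) = 0"
  proof (rule bump_test_zero[OF W, where x\<^sub>0="coords \<alpha> p" and m="?m"])
    show "coords \<alpha> p \<in> ?W" using p by blast
    show "continuous_on ?W ?m"
      by (intro continuous_on_mult cont
        continuous_on_subset[OF smooth_on_continuous_on[OF volume_density_smooth(1)[OF \<alpha>]] img])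
    fix r :: real assume r: "0 < r" "cball (coords \<alpha> p) r \<subseteq> ?W"
    let ?\<phi> = "bump (coords \<alpha> p) r" and ?K = "cball (coords \<alpha> p) r"
    have "chart_inv \<alpha> ` ?K \<subseteq> N" using r(2) N'(1) chart_inv_coords[OF \<alpha>] by fastforce
    then have t: "(\<lambda>q. lift_function \<alpha> ?\<phi> q * k q) \<in> smooth_functions A"
        "(\<integral>q. lift_function \<alpha> ?\<phi> q * k q \<partial>V) = 0"
      using test[OF compact_cball order_trans[OF r(2) img] _ Ck_on_bump bump_outside[OF r(1)]] by blast+
    have "(\<integral>q. lift_function \<alpha> ?\<phi> q * k q \<partial>V) = (\<integral>x. indicator (chart_img \<alpha>) x *
        (?\<rho> x * (lift_function \<alpha> ?\<phi> (chart_inv \<alpha> x) * k (chart_inv \<alpha> x))) \<partial>lborel)"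
      by (rule integral_in_chart[OF \<alpha>
        borel_measurable_continuous_onI[OF smooth_functions_continuous[OF t(1)]]])
        (simp add: lift_function_def)
    moreover have "indicator (chart_img \<alpha>) x *
        (?\<rho> x * (lift_function \<alpha> ?\<phi> (chart_inv \<alpha> x) * k (chart_inv \<alpha> x))) =
        indicator ?W x * (?\<phi> x * ?m x)" for x
    proof (cases "x \<in> ?K")
      case True
      then have "x \<in> ?W" "x \<in> chart_img \<alpha>" using r(2) img by blast+
      then show ?thesis using \<alpha> by (simp add: lift_function_def)
    next
      case False
      then have "?\<phi> x = 0" by (rule bump_outside[OF r(1)])
      then show ?thesis using \<alpha> by (cases "x \<in> chart_img \<alpha>") (auto simp: lift_function_def)
    qed
    ultimately show "(\<integral>x. indicator ?W x * (?\<phi> x * ?m x) \<partial>lborel) = 0" using t(2) by simp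
  qed
  then show ?thesis using volume_density_pos[OF \<alpha>, of p] N'(1)[OF p] \<alpha> by simp
qed

text \<open>Tested against functions supported in both charts, the two coordinate expressions have the same
  integrals, because \<open>d\<psi>(X)\<close> does not refer to a chart; hence they are equal.\<close>
lemma div_in_chart_independent:
  assumes X: "X \<in> vector_fields A" and \<alpha>: "\<alpha> \<in> A" and \<beta>: "\<beta> \<in> A"
    and p: "p \<in> chart_dom \<alpha>" "p \<in> chart_dom \<beta>" "p \<notin> mboundary A"
  shows "div_in \<alpha> X p = div_in \<beta> X p"
proof -
  let ?N = "(chart_dom \<alpha> - mboundary A) \<inter> chart_dom \<beta>"
  let ?k = "\<lambda>q. div_in \<alpha> X q - div_in \<beta> X q"
  let ?S = "coords \<alpha> ` (chart_dom \<alpha> \<inter> chart_dom \<beta>)"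
  have "?k p = 0"
  proof (rule test_functions_separate[OF \<alpha>, of ?N])
    show "open ?N" using interior_of_chart_open[OF \<alpha>] chart_open[OF \<beta>] by (rule open_Int)
    have "continuous_on ?S (\<lambda>x. div_in \<beta> X (chart_inv \<alpha> x))"
      by (rule smooth_on_continuous_on[OF smooth_in_other_chart[OF \<beta> \<alpha> div_in_smooth[OF \<beta> X]]])
    moreover have "continuous_on ?S (\<lambda>x. div_in \<alpha> X (chart_inv \<alpha> x))"
      by (rule continuous_on_subset[OF smooth_on_continuous_on[OF div_in_smooth[OF \<alpha> X]]]) blast
    ultimately have "continuous_on ?S (\<lambda>x. ?k (chart_inv \<alpha> x))" by (intro continuous_intros)
    then show "continuous_on (coords \<alpha> ` ?N) (\<lambda>x. ?k (chart_inv \<alpha> x))"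
      by (rule continuous_on_subset) blast
  next
    fix \<phi> :: "real^'n \<Rightarrow> real" and K
    assume K: "compact K" "K \<subseteq> chart_img \<alpha>" "chart_inv \<alpha> ` K \<subseteq> ?N"
      and \<phi>: "\<And>j. Ck_on j UNIV \<phi>" "\<And>x. x \<notin> K \<Longrightarrow> \<phi> x = 0"
    let ?\<psi> = "lift_function \<alpha> \<phi>" and ?C = "chart_inv \<alpha> ` K"
    note C = compact_chart_inv_image[OF \<alpha> K(1,2)]
    have \<psi>0: "?\<psi> q = 0" if "q \<notin> ?C" for q
      by (rule lift_function_outside[OF \<alpha> K(1,2) \<phi> that])
    have \<psi>: "?\<psi> \<in> smooth_functions A" by (rule lift_function_smooth[OF \<alpha> K(1,2) \<phi>])
    let ?Z = "scale_field ?\<psi> X"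
    have Z: "?Z \<in> vector_fields A" by (rule scale_field_vector_fields[OF \<psi> X])
    have Z0: "?Z q = (\<lambda>_. 0)" if "q \<notin> ?C" for q using \<psi>0[OF that] by (simp add: scale_field_def)
    let ?h = "\<lambda>\<gamma> q. if q \<in> chart_dom \<gamma> then div_in \<gamma> ?Z q else 0"
    have Cb: "?C \<inter> mboundary A = {}" "?C \<subseteq> chart_dom \<beta>" using K(3) by blast+
    have h: "?h \<gamma> \<in> smooth_functions A" "(\<integral>q. ?h \<gamma> q \<partial>V) = 0"
      if "\<gamma> \<in> A" "?C \<subseteq> chart_dom \<gamma>" for \<gamma>
      using integral_div_in[OF that(1) Z C(1) that(2) Cb(1)] Z0 by blast+
    have diff: "?\<psi> q * ?k q = ?h \<alpha> q + (-1) * ?h \<beta> q" for q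
    proof (cases "q \<in> ?C")
      case True
      then have q: "q \<in> chart_dom \<alpha>" "q \<in> chart_dom \<beta>" using K(3) by blast+
      then show ?thesis
        using div_in_scale_field[OF \<alpha> _ \<psi> X, of q] div_in_scale_field[OF \<beta> _ \<psi> X, of q]
        by (simp add: algebra_simps)
    next
      case False
      then show ?thesis
        using \<psi>0[OF False] div_in_zero[OF \<alpha> _ C(2) False Z0] div_in_zero[OF \<beta> _ C(2) False Z0] by simp
    qed
    note int = integrable_smooth[OF h(1)[OF \<alpha> C(3)]] integrable_smooth[OF h(1)[OF \<beta> Cb(2)]]
    have "(\<integral>q. ?h \<alpha> q + (-1) * ?h \<beta> q \<partial>V) = 0"
      using int h(2)[OF \<alpha> C(3)] h(2)[OF \<beta> Cb(2)] by simp
    moreover have "(\<lambda>q. ?h \<alpha> q + (-1) * ?h \<beta> q) \<in> smooth_functions A"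
      by (intro smooth_functions_add smooth_functions_mult smooth_functions_const
        h(1)[OF \<alpha> C(3)] h(1)[OF \<beta> Cb(2)])
    ultimately show "(\<lambda>q. ?\<psi> q * ?k q) \<in> smooth_functions A \<and> (\<integral>q. ?\<psi> q * ?k q \<partial>V) = 0"
      unfolding diff by blast
  qed (use p in auto)
  then show ?thesis by simp
qed

text \<open>For a field supported in the interior of one chart, the chart that the definition of the divergence
  chooses at each point may be replaced by this one.\<close>
lemma divergence_supported:
  assumes "X \<in> vector_fields A" "\<alpha> \<in> A" "closed C" "C \<inter> mboundary A = {}" "C \<subseteq> chart_dom \<alpha>"
    "\<And>p. p \<notin> C \<Longrightarrow> X p = (\<lambda>_. 0)"
  shows "divergence A g X p = (if p \<in> chart_dom \<alpha> then div_in \<alpha> X p else 0)"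
proof (cases "p \<in> C")
  case True
  then have "p \<notin> mboundary A" "p \<in> chart_dom \<alpha>" using assms(4,5) by blast+
  then show ?thesis
    unfolding divergence_eq_div_in
    using div_in_chart_independent[OF assms(1) chart_at(1) assms(2) chart_at(2)] by simp
next
  case False
  then show ?thesis
    unfolding divergence_eq_div_in
    using div_in_zero[OF chart_at assms(3) False assms(6)] div_in_zero[OF assms(2) _ assms(3) False assms(6)]
    by simp
qed

section \<open>Integration by parts for supported fields\<close>

text \<open>The product rule applied to \<open>m q X\<close>, whose divergence has integral zero.\<close>
lemma transport_supported:
  assumes "X \<in> vector_fields A" "\<alpha> \<in> A" "compact C" "C \<inter> mboundary A = {}" "C \<subseteq> chart_dom \<alpha>"
    "\<And>p. p \<notin> C \<Longrightarrow> X p = (\<lambda>_. 0)" and q: "q \<in> smooth_functions A" and m: "m \<in> smooth_functions A"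
  shows "transport A g q X \<in> density_tangents A g"
    and "(\<integral>p. m p * transport A g q X p \<partial>V) = (\<integral>p. q p * dir_deriv A m p (X p) \<partial>V)"
proof -
  note cl = compact_imp_closed[OF assms(3)]
  let ?Y = "scale_field q X" and ?Z = "scale_field m (scale_field q X)"
  have Y: "?Y \<in> vector_fields A" and Z: "?Z \<in> vector_fields A"
    by (intro scale_field_vector_fields q m assms)+
  have Y0: "?Y p = (\<lambda>_. 0)" and Z0: "?Z p = (\<lambda>_. 0)" if "p \<notin> C" for p
    using assms(6)[OF that] by (auto simp: scale_field_def)
  let ?h = "\<lambda>X p. if p \<in> chart_dom \<alpha> then div_in \<alpha> X p else 0"
  have hY: "?h ?Y \<in> smooth_functions A" "(\<integral>p. ?h ?Y p \<partial>V) = 0"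
    using integral_div_in[OF assms(2) Y assms(3,5,4)] Y0 by blast+
  have hZ: "?h ?Z \<in> smooth_functions A" "(\<integral>p. ?h ?Z p \<partial>V) = 0"
    using integral_div_in[OF assms(2) Z assms(3,5,4)] Z0 by blast+
  have tr: "transport A g q X = (\<lambda>p. (-1) * ?h ?Y p)"
    using divergence_supported[OF Y assms(2) cl assms(4,5) Y0] by (auto simp: transport_def fun_eq_iff)
  have tr_sm: "transport A g q X \<in> smooth_functions A"
    unfolding tr by (rule smooth_functions_mult[OF smooth_functions_const hY(1)])
  then show "transport A g q X \<in> density_tangents A g"
    using hY(2) by (simp add: density_tangents_def tr)
  have eq: "m p * transport A g q X p = q p * dir_deriv A m p (X p) - ?h ?Z p" for p
  proof (cases "p \<in> chart_dom \<alpha>")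
    case True
    have "dir_deriv A m p (?Y p) = q p * dir_deriv A m p (X p)"
      using dir_deriv_scale(1)[OF m vector_fieldsD(1)[OF assms(1)]] by (simp add: scale_field_def)
    then show ?thesis
      using div_in_scale_field[OF assms(2) True m Y] True by (simp add: tr)
  next
    case False
    then have "p \<notin> C" using assms(5) by blast
    from assms(6)[OF this] have "dir_deriv A m p (X p) = 0"
      using dir_deriv_scale(2)[OF m zero_tangent] by simp
    then show ?thesis using False by (simp add: tr)
  qed
  have "integrable V (\<lambda>p. q p * dir_deriv A m p (X p))"
    by (intro integrable_smooth smooth_functions_mult q dir_deriv_smooth m assms)
  then show "(\<integral>p. m p * transport A g q X p \<partial>V) = (\<integral>p. q p * dir_deriv A m p (X p) \<partial>V)"
    unfolding eq using hZ
    by (subst Bochner_Integration.integral_diff) (auto intro: integrable_smooth)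
qed

section \<open>Mass conservation\<close>

text \<open>All the densities have mass one, so the difference quotients have integral zero. On a compact manifold
  convergence on compact subsets of the charts is uniform convergence, and it passes to the integral.\<close>
lemma time_derivative_in_density_tangents:
  assumes "is_interval I" "interior I \<noteq> {}" "t \<in> I" "\<And>s. s \<in> I \<Longrightarrow> c s \<in> densities A g"
    "has_time_derivative A c d t I"
  shows "d \<in> density_tangents A g"
proof -
  have d: "d \<in> smooth_functions A"
    and lim: "smooth_limit A (\<lambda>s p. (c s p - c t p) / (s - t)) d (at t within I)"
    using assms(5) by (auto simp: has_time_derivative_def)
  interpret finite_measure V by (rule finite_measure_volume)
  have "I \<noteq> {t}" using assms(2) by auto
  then have "t islimpt I"
    using connected_imp_perfect[of I t] is_interval_connected[OF assms(1)] assms(3) by blast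
  then have nontriv: "at t within I \<noteq> bot" by (simp add: trivial_limit_within)
  obtain F where F: "finite F" "\<forall>f\<in>F. fst f \<in> A \<and> compact (snd f) \<and> snd f \<subseteq> chart_img (fst f)"
    "\<forall>p. \<exists>f\<in>F. p \<in> chart_inv (fst f) ` snd f"
    using finite_chart_cover by blast
  let ?q = "\<lambda>s p. (c s p - c t p) / (s - t)"
  have small: "\<bar>\<integral>p. d p \<partial>V\<bar> \<le> e * measure V UNIV" if e: "0 < e" for e
  proof -
    have "\<forall>\<^sub>F s in at t within I. \<forall>f\<in>F. \<forall>x\<in>snd f. dist (?q s (chart_inv (fst f) x)) (d (chart_inv (fst f) x)) < e"
    proof (rule eventually_ball_finite[OF F(1)], rule ballI)
      fix f assume "f \<in> F"
      then have f: "fst f \<in> A" "compact (snd f)" "snd f \<subseteq> chart_img (fst f)"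
        using F(2) by blast+
      have "uniform_limit (snd f)
          (\<lambda>s. iter_deriv (chart_img (fst f)) [] (\<lambda>x. ?q s (chart_inv (fst f) x)))
          (iter_deriv (chart_img (fst f)) [] (\<lambda>x. d (chart_inv (fst f) x))) (at t within I)"
        using lim f unfolding smooth_limit_def by blast
      then show "\<forall>\<^sub>F s in at t within I. \<forall>x\<in>snd f. dist (?q s (chart_inv (fst f) x)) (d (chart_inv (fst f) x)) < e"
        using e unfolding uniform_limit_iff by simp
    qed
    moreover have "\<forall>\<^sub>F s in at t within I. s \<in> I"
      by (simp add: eventually_at_filter)
    ultimately have "\<forall>\<^sub>F s in at t within I. s \<in> I \<and>
        (\<forall>f\<in>F. \<forall>x\<in>snd f. dist (?q s (chart_inv (fst f) x)) (d (chart_inv (fst f) x)) < e)"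
      by eventually_elim auto
    then obtain s where s: "s \<in> I"
        "\<And>f x. f \<in> F \<Longrightarrow> x \<in> snd f \<Longrightarrow> dist (?q s (chart_inv (fst f) x)) (d (chart_inv (fst f) x)) < e"
      using eventually_happens'[OF nontriv] by blast
    have near: "\<bar>d p - ?q s p\<bar> \<le> e" for p
    proof -
      obtain f x where f: "f \<in> F" "x \<in> snd f" "p = chart_inv (fst f) x" using F(3) by blast
      have "dist (?q s p) (d p) < e"
        using s(2)[OF f(1,2)] f(3) by simp
      then show ?thesis by (simp add: dist_real_def abs_minus_commute)
    qed
    have cs: "c s \<in> smooth_functions A" "(\<integral>p. c s p \<partial>V) = 1" "c t \<in> smooth_functions A" "(\<integral>p. c t p \<partial>V) = 1"
      using assms(4)[OF s(1)] assms(4)[OF assms(3)] by (auto simp: densities_def)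
    have int: "integrable V d" "integrable V (c s)" "integrable V (c t)"
      using integrable_smooth d cs by blast+
    have "(\<integral>p. ?q s p \<partial>V) = 0" using int cs by simp
    then have "(\<integral>p. d p \<partial>V) = (\<integral>p. d p - ?q s p \<partial>V)"
      using int by (subst Bochner_Integration.integral_diff) auto
    also have "\<bar>\<dots>\<bar> \<le> (\<integral>p. \<bar>d p - ?q s p\<bar> \<partial>V)" by (rule integral_abs_bound)
    also have "\<dots> \<le> (\<integral>p. e \<partial>V)"
      by (rule integral_mono) (use int near in auto)
    also have "\<dots> = e * measure V UNIV" by (simp add: space_volume)
    finally show ?thesis .
  qed
  have "(\<integral>p. d p \<partial>V) = 0"
  proof (rule ccontr)
    assume nz: "(\<integral>p. d p \<partial>V) \<noteq> 0"
    let ?M = "measure V UNIV"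
    \<comment> \<open>any \<open>e\<close> with \<open>e * ?M < \<bar>\<integral> d\<bar>\<close> contradicts the bound, also if \<open>?M = 0\<close>\<close>
    let ?e = "\<bar>\<integral>p. d p \<partial>V\<bar> / (2 * (?M + 1))"
    have M: "0 \<le> ?M" by simp
    have "0 < 2 * (?M + 1)" by (intro mult_pos_pos add_nonneg_pos M) simp_all
    then have "0 < ?e" using nz by (intro divide_pos_pos) auto
    from small[OF this] have "\<bar>\<integral>p. d p \<partial>V\<bar> * (2 * (?M + 1)) \<le> \<bar>\<integral>p. d p \<partial>V\<bar> * ?M"
      using M by (simp add: field_simps)
    then have "2 * (?M + 1) \<le> ?M" using nz by (simp add: mult_le_cancel_left)
    then show False using M by simp
  qed
  then show ?thesis using d by (simp add: density_tangents_def)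
qed

section \<open>The first variation of the Rayleighian\<close>

lemma transport_lincomb:
  assumes "q \<in> smooth_functions A" "v \<in> vector_fields A" "w \<in> vector_fields A"
  shows "transport A g q (\<lambda>p \<alpha>. a *\<^sub>R v p \<alpha> + b *\<^sub>R w p \<alpha>) p = a * transport A g q v p + b * transport A g q w p"
proof -
  have eq: "scale_field q (\<lambda>p \<alpha>. a *\<^sub>R v p \<alpha> + b *\<^sub>R w p \<alpha>) =
      (\<lambda>p \<alpha>. a *\<^sub>R scale_field q v p \<alpha> + b *\<^sub>R scale_field q w p \<alpha>)"
    by (simp add: scale_field_def fun_eq_iff algebra_simps)
  show ?thesis
    unfolding transport_def eq divergence_eq_div_in
    by (subst div_in_lincomb[OF chart_at])
      (auto intro: scale_field_vector_fields assms simp: algebra_simps)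
qed

lemma velocities_lincomb:
  assumes "v \<in> velocities A g q" "w \<in> velocities A g q"
  shows "(\<lambda>p \<alpha>. a *\<^sub>R v p \<alpha> + b *\<^sub>R w p \<alpha>) \<in> velocities A g q"
proof -
  have vw: "v \<in> vector_fields A" "w \<in> vector_fields A" using assms by (auto simp: velocities_def)
  show ?thesis
    using assms vector_fields_lincomb[OF vw]
      metric_lincomb_left[OF vector_fieldsD(1)[OF vw(1)] vector_fieldsD(1)[OF vw(2)] outward_normal_in_tangent_space]
    by (simp add: velocities_def)
qed

text \<open>Along the line \<open>v + s w\<close> the Rayleighian is a quadratic polynomial in \<open>s\<close> with a minimum at
  \<open>s = 0\<close>; its linear coefficient is the first variation. The form \<open>L\<close> is known only on
  the tangent space of the densities, so both transports have to lie there.\<close>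
lemma first_variation:
  assumes q: "q \<in> densities A g" and m: "m \<in> smooth_functions A"
    and L: "\<And>h. h \<in> density_tangents A g \<Longrightarrow> L h = (\<integral>p. m p * h p \<partial>V)"
    and min: "is_arg_min (rayleighian L (dissipation A g) (transport A g) q) (\<lambda>w. w \<in> velocities A g q) v"
    and Pv: "transport A g q v \<in> density_tangents A g"
    and w: "w \<in> velocities A g q" and Pw: "transport A g q w \<in> density_tangents A g"
  shows "(\<integral>p. m p * transport A g q w p \<partial>V) + (\<integral>p. q p * g p (v p) (w p) \<partial>V) = 0"
proof -
  have v: "v \<in> velocities A g q" using min by (simp add: is_arg_min_def)
  have vf: "v \<in> vector_fields A" "w \<in> vector_fields A" using v w by (auto simp: velocities_def)
  have qs: "q \<in> smooth_functions A" using q by (simp add: densities_def)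
  let ?R = "rayleighian L (dissipation A g) (transport A g) q"
  let ?a = "(\<integral>p. m p * transport A g q w p \<partial>V) + (\<integral>p. q p * g p (v p) (w p) \<partial>V)"
  let ?b = "1 / 2 * (\<integral>p. q p * g p (w p) (w p) \<partial>V)"
  define z where "z s = (\<lambda>p \<alpha>. 1 *\<^sub>R v p \<alpha> + s *\<^sub>R w p \<alpha>)" for s :: real
  have tan: "v p \<in> tangent_space A p" "w p \<in> tangent_space A p" for p using vf vector_fieldsD(1) by blast+
  have int: "integrable V (\<lambda>p. q p * g p (x p) (y p))" if "x \<in> vector_fields A" "y \<in> vector_fields A" for x y
    by (intro integrable_smooth smooth_functions_mult qs metric_smooth that)
  have intm: "integrable V (\<lambda>p. m p * h p)" if "h \<in> density_tangents A g" for h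
    using that by (intro integrable_smooth smooth_functions_mult m) (simp add: density_tangents_def)
  have R: "?R (z s) = ?R v + s * ?a + s\<^sup>2 * ?b" for s
  proof -
    have P: "transport A g q (z s) = (\<lambda>p. transport A g q v p + s * transport A g q w p)"
      using transport_lincomb[OF qs vf, where a=1 and b=s] by (simp add: z_def fun_eq_iff)
    have sm: "transport A g q v \<in> smooth_functions A" "transport A g q w \<in> smooth_functions A"
      using Pv Pw by (auto simp: density_tangents_def)
    have i0: "(\<integral>p. transport A g q v p \<partial>V) = 0" "(\<integral>p. transport A g q w p \<partial>V) = 0"
      using Pv Pw by (auto simp: density_tangents_def)
    have "transport A g q (z s) \<in> density_tangents A g"
      unfolding P density_tangents_def
      using i0 integrable_smooth[OF sm(1)] integrable_smooth[OF sm(2)]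
        smooth_functions_add[OF sm(1) smooth_functions_mult[OF smooth_functions_const sm(2)]]
      by simp
    then have "L (transport A g q (z s)) = (\<integral>p. m p * transport A g q v p + s * (m p * transport A g q w p) \<partial>V)"
      by (simp add: L P algebra_simps)
    also have "\<dots> = L (transport A g q v) + s * (\<integral>p. m p * transport A g q w p \<partial>V)"
      using intm[OF Pv] intm[OF Pw] by (simp add: L[OF Pv])
    finally have 1: "L (transport A g q (z s)) = L (transport A g q v) + s * (\<integral>p. m p * transport A g q w p \<partial>V)" .
    have expand: "q p * g p (z s p) (z s p) =
        q p * g p (v p) (v p) + (2 * s * (q p * g p (v p) (w p)) + s\<^sup>2 * (q p * g p (w p) (w p)))" for p
    proof -
      have zt: "z s p \<in> tangent_space A p" unfolding z_def by (rule tangent_space_lincomb[OF tan])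
      have "g p (z s p) (z s p) = 1 * g p (v p) (z s p) + s * g p (w p) (z s p)"
        using metric_lincomb_left[OF tan zt, where a=1 and b=s] by (simp add: z_def)
      also have "g p (v p) (z s p) = 1 * g p (v p) (v p) + s * g p (v p) (w p)"
        using metric_lincomb_right[OF tan tan(1), where a=1 and b=s] by (simp add: z_def)
      also have "g p (w p) (z s p) = 1 * g p (v p) (w p) + s * g p (w p) (w p)"
        using metric_lincomb_right[OF tan tan(2), where a=1 and b=s] metric_sym[OF tan] by (simp add: z_def)
      finally show ?thesis by (simp add: algebra_simps power2_eq_square)
    qed
    have "(\<integral>p. q p * g p (z s p) (z s p) \<partial>V) = (\<integral>p. q p * g p (v p) (v p) \<partial>V) +
        (2 * s * (\<integral>p. q p * g p (v p) (w p) \<partial>V) + s\<^sup>2 * (\<integral>p. q p * g p (w p) (w p) \<partial>V))"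
      unfolding expand using int[OF vf(1,1)] int[OF vf] int[OF vf(2,2)] by simp
    then have 2: "dissipation A g q (z s) =
        dissipation A g q v + s * (\<integral>p. q p * g p (v p) (w p) \<partial>V) + s\<^sup>2 * ?b"
      by (simp add: dissipation_def algebra_simps)
    show ?thesis using 1 2 by (simp add: rayleighian_def algebra_simps)
  qed
  have ge: "0 \<le> s * ?a + s\<^sup>2 * ?b" for s
  proof -
    have "z s \<in> velocities A g q" unfolding z_def by (rule velocities_lincomb[OF v w])
    then have "\<not> ?R (z s) < ?R v" using min by (auto simp: is_arg_min_def)
    then show ?thesis by (simp add: R)
  qed
  have "((\<lambda>s. s * ?a + s\<^sup>2 * ?b) has_real_derivative ?a) (at 0)"
    by (auto intro!: derivative_eq_intros)
  then show "?a = 0"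
    by (rule DERIV_local_min[of _ _ _ 1]) (use ge in auto)
qed

text \<open>The Euler-Lagrange equation, tested with fields that are supported in the interior of one chart
  and constant in its coordinates up to a bump function; the points of the boundary follow by continuity.\<close>
lemma stationarity:
  assumes q: "q \<in> densities A g" and m: "m \<in> smooth_functions A"
    and L: "\<And>h. h \<in> density_tangents A g \<Longrightarrow> L h = (\<integral>p. m p * h p \<partial>V)"
    and min: "is_arg_min (rayleighian L (dissipation A g) (transport A g) q) (\<lambda>w. w \<in> velocities A g q) v"
    and Pv: "transport A g q v \<in> density_tangents A g"
    and u: "u \<in> tangent_space A p"
  shows "q p * (dir_deriv A m p u + g p (v p) u) = 0"
proof -
  have v: "v \<in> vector_fields A" using min by (simp add: is_arg_min_def velocities_def)
  have qs: "q \<in> smooth_functions A" using q by (simp add: densities_def)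
  obtain \<alpha> where \<alpha>: "\<alpha> \<in> A" and p: "p \<in> chart_dom \<alpha>" using chart_cases by blast
  define e where "e = u \<alpha>"
  let ?E = "\<lambda>p. coord_vector A \<alpha> p e"
  let ?k = "\<lambda>p. q p * (dir_deriv A m p (?E p) + g p (v p) (?E p))"
  have Et: "?E p \<in> tangent_space A p" if "p \<in> chart_dom \<alpha>" for p
    by (rule coord_vector_in_tangent_space[OF \<alpha> that])
  have sm: "smooth_on (chart_img \<alpha>) (\<lambda>x. ?k (chart_inv \<alpha> x))"
  proof (rule smooth_on_cong[rotated])
    show "smooth_on (chart_img \<alpha>) (\<lambda>x. q (chart_inv \<alpha> x) *
      (frechet_derivative (\<lambda>x. m (chart_inv \<alpha> x)) (at x within chart_img \<alpha>) e +
        (\<Sum>i\<in>UNIV. v (chart_inv \<alpha> x) \<alpha> $ i *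
          (\<Sum>j\<in>UNIV. metric_matrix A g \<alpha> (chart_inv \<alpha> x) $ i $ j * e $ j))))"
      by (intro smooth_on_mult smooth_on_add smooth_on_sum smooth_on_const smooth_on_nth
        smooth_on_has_derivative(2)[OF chart_img_openin[OF \<alpha>]] smooth_functionsD[OF m \<alpha>]
        smooth_functionsD[OF qs \<alpha>] vector_fieldsD(2)[OF v \<alpha>] metric_matrix_smooth[OF \<alpha>])
  next
    fix x assume x: "x \<in> chart_img \<alpha>"
    note dom = chart_inv_in[OF \<alpha> x]
    show "q (chart_inv \<alpha> x) *
      (frechet_derivative (\<lambda>x. m (chart_inv \<alpha> x)) (at x within chart_img \<alpha>) e +
        (\<Sum>i\<in>UNIV. v (chart_inv \<alpha> x) \<alpha> $ i *
          (\<Sum>j\<in>UNIV. metric_matrix A g \<alpha> (chart_inv \<alpha> x) $ i $ j * e $ j))) = ?k (chart_inv \<alpha> x)"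
      using dir_deriv_chart[OF m \<alpha> dom Et[OF dom]] coords_chart_inv[OF \<alpha> x]
        metric_coords[OF \<alpha> dom vector_fieldsD(1)[OF v] Et[OF dom]] coord_vector_self[OF \<alpha> dom]
      by (simp add: inner_vec_def matrix_vector_mult_def)
  qed
  then have cont: "continuous_on (chart_img \<alpha>) (\<lambda>x. ?k (chart_inv \<alpha> x))" by (rule smooth_on_continuous_on)
  have interior: "?k x = 0" if x: "x \<in> chart_dom \<alpha> - mboundary A" for x
  proof (rule test_functions_separate[OF \<alpha> interior_of_chart_open[OF \<alpha>] order_refl x])
    show "continuous_on (coords \<alpha> ` (chart_dom \<alpha> - mboundary A)) (\<lambda>x. ?k (chart_inv \<alpha> x))"
      by (rule continuous_on_subset[OF cont]) blast
  next
    fix \<phi> :: "real^'n \<Rightarrow> real" and K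
    assume K: "compact K" "K \<subseteq> chart_img \<alpha>" "chart_inv \<alpha> ` K \<subseteq> chart_dom \<alpha> - mboundary A"
      and \<phi>: "\<And>j. Ck_on j UNIV \<phi>" "\<And>x. x \<notin> K \<Longrightarrow> \<phi> x = 0"
    let ?\<psi> = "lift_function \<alpha> \<phi>" and ?w = "lift_field \<alpha> \<phi> e" and ?C = "chart_inv \<alpha> ` K"
    note C = compact_chart_inv_image[OF \<alpha> K(1,2)]
    have w: "?w \<in> vector_fields A" by (rule lift_field_smooth[OF \<alpha> K(1,2) \<phi>])
    have w0: "?w p = (\<lambda>_. 0)" if "p \<notin> ?C" for p
      using lift_function_outside[OF \<alpha> K(1,2) \<phi> that] by (simp add: lift_field_def)
    have Cb: "?C \<inter> mboundary A = {}" using K(3) by blast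
    have "g p (?w p) (outward_normal A g p) = 0" if "p \<in> mboundary A" for p
    proof -
      have wp: "?w p = (\<lambda>_. 0)" using w0 Cb that by blast
      show ?thesis unfolding wp by (rule metric_zero(1)[OF outward_normal_in_tangent_space])
    qed
    then have wE: "?w \<in> velocities A g q" using w by (simp add: velocities_def)
    have tr: "transport A g q ?w \<in> density_tangents A g"
        "(\<integral>p. m p * transport A g q ?w p \<partial>V) = (\<integral>p. q p * dir_deriv A m p (?w p) \<partial>V)"
      using transport_supported[OF w \<alpha> C(1) Cb C(3) _ qs m] w0 by blast+
    have s1: "(\<lambda>p. q p * dir_deriv A m p (?w p)) \<in> smooth_functions A"
      and s2: "(\<lambda>p. q p * g p (v p) (?w p)) \<in> smooth_functions A"
      by (intro smooth_functions_mult qs dir_deriv_smooth metric_smooth m v w)+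
    have eq: "?\<psi> p * ?k p = q p * dir_deriv A m p (?w p) + q p * g p (v p) (?w p)" for p
    proof (cases "p \<in> chart_dom \<alpha>")
      case True
      have "dir_deriv A m p (?w p) = ?\<psi> p * dir_deriv A m p (?E p)"
        unfolding lift_field_def by (rule dir_deriv_scale(1)[OF m Et[OF True]])
      moreover have "g p (v p) (?w p) = ?\<psi> p * g p (v p) (?E p)"
        unfolding lift_field_def by (rule metric_scale(2)[OF Et[OF True] vector_fieldsD(1)[OF v]])
      ultimately show ?thesis by (simp add: algebra_simps)
    next
      case False
      then have "p \<notin> ?C" using C(3) by blast
      from w0[OF this] have wp: "?w p = (\<lambda>_. 0)" .
      show ?thesis
        using False dir_deriv_scale(2)[OF m zero_tangent] metric_zero(2)[OF vector_fieldsD(1)[OF v]]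
        unfolding wp by (simp add: lift_function_def)
    qed
    have "(\<integral>p. q p * dir_deriv A m p (?w p) + q p * g p (v p) (?w p) \<partial>V) = 0"
      using first_variation[OF q m L min Pv wE tr(1)] tr(2) integrable_smooth[OF s1] integrable_smooth[OF s2]
      by simp
    then show "(\<lambda>p. ?\<psi> p * ?k p) \<in> smooth_functions A \<and> (\<integral>p. ?\<psi> p * ?k p \<partial>V) = 0"
      unfolding eq using smooth_functions_add[OF s1 s2] by blast
  qed
  have "?k (chart_inv \<alpha> (coords \<alpha> p)) = 0"
  proof (rule continuous_zero_on_halfspace[OF chart_img_openin[OF \<alpha>] cont imageI[OF p]])
    fix y assume "y \<in> chart_img \<alpha>" "0 < y $ bcoord"
    then show "?k (chart_inv \<alpha> y) = 0"
      using interior[of "chart_inv \<alpha> y"] mboundary_iff[OF \<alpha> chart_inv_in[OF \<alpha>], of y]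
        coords_chart_inv[OF \<alpha>, of y] chart_inv_in[OF \<alpha>, of y] by auto
  qed
  then show ?thesis
    using tangent_eq_coord_vector[OF \<alpha> p u] chart_inv_coords[OF \<alpha> p] unfolding e_def by metis
qed

text \<open>Where \<open>q\<close> does not vanish, stationarity says that \<open>- v\<close> represents \<open>dm\<close>, so it is the gradient; where
  \<open>q\<close> vanishes, both fields \<open>q v\<close> and \<open>q \<nabla>m\<close> do. So \<open>q \<nabla>m = - q v\<close> everywhere.\<close>
lemma minimizer_transport:
  assumes q: "q \<in> densities A g" and m: "m \<in> smooth_functions A"
    and L: "\<And>h. h \<in> density_tangents A g \<Longrightarrow> L h = (\<integral>p. m p * h p \<partial>V)"
    and min: "is_arg_min (rayleighian L (dissipation A g) (transport A g) q) (\<lambda>w. w \<in> velocities A g q) v"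
    and Pv: "transport A g q v \<in> density_tangents A g"
  shows "transport A g q v = divergence A g (scale_field q (gradient A g m))"
proof -
  have v: "v \<in> vector_fields A" using min by (simp add: is_arg_min_def velocities_def)
  have qs: "q \<in> smooth_functions A" using q by (simp add: densities_def)
  have "scale_field q (gradient A g m) p = (\<lambda>\<alpha>. (-1) *\<^sub>R scale_field q v p \<alpha> + 0 *\<^sub>R scale_field q v p \<alpha>)" for p
  proof (cases "q p = 0")
    case False
    have vp: "v p \<in> tangent_space A p" by (rule vector_fieldsD(1)[OF v])
    have "gradient A g m p = (\<lambda>\<alpha>. (-1) *\<^sub>R v p \<alpha>)"
    proof (rule gradient_eqI)
      show "(\<lambda>\<alpha>. (-1) *\<^sub>R v p \<alpha>) \<in> tangent_space A p" by (rule tangent_space_scale[OF vp])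
      fix u assume u: "u \<in> tangent_space A p"
      show "g p (\<lambda>\<alpha>. (-1) *\<^sub>R v p \<alpha>) u = dir_deriv A m p u"
        using metric_scale(1)[OF vp u, where a="-1"] stationarity[OF q m L min Pv u] False by simp
    qed
    then show ?thesis by (simp add: scale_field_def)
  qed (simp add: scale_field_def)
  then have eq: "scale_field q (gradient A g m) =
      (\<lambda>p \<alpha>. (-1) *\<^sub>R scale_field q v p \<alpha> + 0 *\<^sub>R scale_field q v p \<alpha>)"
    by (rule ext)
  have qv: "scale_field q v \<in> vector_fields A" by (rule scale_field_vector_fields[OF qs v])
  show ?thesis
    unfolding eq transport_def fun_eq_iff divergence_eq_div_in
    using div_in_lincomb[OF chart_at qv qv, where a="-1" and b=0] by simp
qed

end

section \<open>The gradient flow\<close>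

theorem theorem2p3:
  fixes A :: "('m::{t2_space, second_countable_topology}, 'n::finite) chart set"
    and g :: "('m, 'n) metric"
    and F :: "('m \<Rightarrow> real) \<Rightarrow> real"
    and \<mu> :: "('m \<Rightarrow> real) \<Rightarrow> 'm \<Rightarrow> real"
    and I :: "real set"
    and c :: "real \<Rightarrow> 'm \<Rightarrow> real"
  assumes "compact (UNIV :: 'm set)"
    and "smooth_atlas A"
    and "riemannian_metric A g"
    and "\<forall>q\<in>densities A g. has_L2_gradient A g F q (\<mu> q)"
    and "is_interval I" and "interior I \<noteq> {}"
    and "ovp_solution A (densities A g) (density_tangents A g) (velocities A g) F
           (dissipation A g) (transport A g) I c"
  shows "\<forall>t\<in>I. has_time_derivative A c
           (divergence A g (scale_field (c t) (gradient A g (\<mu> (c t))))) t I"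
proof
  interpret compact_riemannian_manifold A g
    by unfold_locales (use assms in auto)
  fix t assume t: "t \<in> I"
  let ?L = "differential (densities A g) (density_tangents A g) F (c t)"
  have Q: "c s \<in> densities A g" if "s \<in> I" for s
    using assms(7) that by (simp add: ovp_solution_def)
  obtain v where der: "has_time_derivative A c (transport A g (c t) v) t I"
    and min: "is_arg_min (rayleighian ?L (dissipation A g) (transport A g) (c t))
        (\<lambda>w. w \<in> velocities A g (c t)) v"
    using assms(7) t unfolding ovp_solution_def by blast
  have m: "\<mu> (c t) \<in> smooth_functions A"
    using assms(4) Q[OF t] by (simp add: has_L2_gradient_def)
  have L: "?L h = (\<integral>p. \<mu> (c t) p * h p \<partial>V)" if "h \<in> density_tangents A g" for h
    using assms(4) Q[OF t] that by (auto simp: has_L2_gradient_def)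
  have "transport A g (c t) v \<in> density_tangents A g"
    by (rule time_derivative_in_density_tangents[OF assms(5,6) t Q der])
  from minimizer_transport[OF Q[OF t] m L min this] der
  show "has_time_derivative A c (divergence A g (scale_field (c t) (gradient A g (\<mu> (c t))))) t I"
    by simp
qed

end
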